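(* Let $m, r$ and $d$ be integers such that $d \geq 1$ and $2 \leq 2r \leq m-1$. Then $$ \mathrm{POL}^{ss,neig}_{d,2r,m} = \left\{ L(\lambda)\begin{bmatrix} 0 & \Delta_r\\ -\Delta_r & 0\end{bmatrix} L(\lambda)^T \; : \; \begin{array}{l} L(\lambda)\in\mathrm{POL}^{m\times 2r},\\ L(\lambda) \text{ is a minimal basis},\\ \deg(L_{*1})\ge\cdots\ge\deg(L_{*2r}),\\ \deg(L_{*i})+\deg(L_{*(2r-i+1)})=d \text{ for } i=1,\ldots,2r\end{array}\right\}. $$
   Context: All matrix polynomials have coefficients in $\mathbb{C}$. $\mathrm{POL}^{p\times q}$ is the set of all $p\times q$ matrix polynomials. The degree of a matrix polynomial is the largest power of $\lambda$ with a nonzero matrix coefficient. $L_{*i}$ denotes the $i$-th column of $L(\lambda)$. $\Delta_r$ is the $r\times r$ matrix with ones on the anti-diagonal and zeros elsewhere. The (normal) rank of a matrix polynomial is its rank over the field $\mathbb{C}(\lambda)$. $\mathrm{POL}^{ss}_{d,2r,m}$ is the set of $m\times m$ skew-symmetric matrix polynomials $P(\lambda)=\sum_{i=0}^d\lambda^iA_i$ ($A_i\in\mathbb{C}^{m\times m}$, $A_i^T=-A_i$) of degree at most $d$ and normal rank at most $2r$. Eigenvalues: $\alpha\in\mathbb{C}$ is a finite eigenvalue of $P(\lambda)$ if it is a root of at least one of the invariant polynomials of $P(\lambda)$ (the nonzero diagonal entries of its Smith form over $\mathbb{C}[\lambda]$); equivalently, $\operatorname{rank}P(\alpha)<\operatorname{rank}(P)$.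 $\infty$ is an eigenvalue of $P(\lambda)$, regarded as a polynomial of grade $d$, if $0$ is an eigenvalue of $\mathrm{rev}_dP(\lambda):=\lambda^dP(1/\lambda)$. "$P$ has no eigenvalues" means no finite and no infinite eigenvalues. Then $$\mathrm{POL}^{ss,neig}_{d,2r,m}:=\{P(\lambda)\in\mathrm{POL}^{ss}_{d,2r,m} : \operatorname{rank}(P)=2r,\ \deg(P)=d,\ P(\lambda)\text{ has no eigenvalues}\}.$$ Minimal basis: for a subspace $\mathcal{V}$ of $\mathbb{C}(\lambda)^m$ (over $\mathbb{C}(\lambda)$), a minimal basis is a basis of $\mathcal{V}$ consisting of vector polynomials whose sum of degrees is minimal among all bases of $\mathcal{V}$ consisting of vector polynomials. A matrix polynomial is called a minimal basis if its columns form a minimal basis of the subspace they span over $\mathbb{C}(\lambda)$ (in particular the columns are linearly independent over $\mathbb{C}(\lambda)$). *)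

theory Defs
  imports
    Complex_Main
    "HOL-Computational_Algebra.Polynomial_Factorial"
    "Jordan_Normal_Form.DL_Rank"
begin

text \<open>
  A matrix polynomial is a matrix with entries in \<open>\<complex>[\<lambda>]\<close>, of type \<open>complex poly mat\<close>; the
  field \<open>\<complex>(\<lambda>)\<close> is \<open>complex poly fract\<close>. Rows and columns are numbered from 0.
\<close>

definition mat_coeff :: "complex poly mat \<Rightarrow> nat \<Rightarrow> complex mat" where
  "mat_coeff P k = map_mat (\<lambda>p. coeff p k) P"

definition vec_coeff :: "complex poly vec \<Rightarrow> nat \<Rightarrow> complex vec" where
  "vec_coeff v k = map_vec (\<lambda>p. coeff p k) v"

text \<open>As for \<^const>\<open>degree\<close>, the zero matrix and the zero vector get degree 0.\<close>

definition mat_degree :: "complex poly mat \<Rightarrow> nat" where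
  "mat_degree P = Max (insert 0 {k. mat_coeff P k \<noteq> 0\<^sub>m (dim_row P) (dim_col P)})"

definition vec_degree :: "complex poly vec \<Rightarrow> nat" where
  "vec_degree v = Max (insert 0 {k. vec_coeff v k \<noteq> 0\<^sub>v (dim_vec v)})"

text \<open>The sets in these definitions are finite, so that \<^const>\<open>Max\<close> is meaningful.\<close>

lemma finite_mat_coeff_nonzero:
  "finite {k. mat_coeff P k \<noteq> 0\<^sub>m (dim_row P) (dim_col P)}"
proof -
  have "{k. mat_coeff P k \<noteq> 0\<^sub>m (dim_row P) (dim_col P)}
      \<subseteq> (\<Union>i<dim_row P. \<Union>j<dim_col P. {k. k \<le> degree (P $$ (i, j))})"
    by (auto simp: mat_coeff_def mat_eq_iff intro: le_degree)
  then show ?thesis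
    by (rule finite_subset) auto
qed

lemma finite_vec_coeff_nonzero:
  "finite {k. vec_coeff v k \<noteq> 0\<^sub>v (dim_vec v)}"
proof -
  have "{k. vec_coeff v k \<noteq> 0\<^sub>v (dim_vec v)}
      \<subseteq> (\<Union>i<dim_vec v. {k. k \<le> degree (v $ i)})"
    by (auto simp: vec_coeff_def vec_eq_iff intro: le_degree)
  then show ?thesis
    by (rule finite_subset) auto
qed

definition normal_rank :: "complex poly mat \<Rightarrow> nat" where
  "normal_rank P = vec_space.rank (dim_row P) (map_mat to_fract P)"

definition POL_ss :: "nat \<Rightarrow> nat \<Rightarrow> nat \<Rightarrow> complex poly mat set" where
  "POL_ss d k m = {P \<in> carrier_mat m m.
     (\<forall>i. transpose_mat (mat_coeff P i) = - mat_coeff P i) \<and>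
     mat_degree P \<le> d \<and> normal_rank P \<le> k}"

text \<open>
  Over \<open>\<complex>[\<lambda>]\<close>, \<^const>\<open>invertible_mat\<close> means unimodular. As every polynomial divides 0, the
  divisibility condition places the zero diagonal entries last.
\<close>

definition is_smith_form :: "complex poly mat \<Rightarrow> complex poly mat \<Rightarrow> bool" where
  "is_smith_form P S \<longleftrightarrow>
     (\<exists>U V. U \<in> carrier_mat (dim_row P) (dim_row P) \<and> invertible_mat U \<and>
            V \<in> carrier_mat (dim_col P) (dim_col P) \<and> invertible_mat V \<and>
            S = U * P * V) \<and>
     diagonal_mat S \<and>
     (\<forall>i. Suc i < min (dim_row S) (dim_col S) \<longrightarrow> S $$ (i, i) dvd S $$ (Suc i, Suc i)) \<and>
     (\<forall>i < min (dim_row S) (dim_col S). S $$ (i, i) \<noteq> 0 \<longrightarrow> lead_coeff (S $$ (i, i)) = 1)"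

definition invariant_polys :: "complex poly mat \<Rightarrow> complex poly set" where
  "invariant_polys P = {S $$ (i, i) | S i. is_smith_form P S \<and>
     i < min (dim_row S) (dim_col S) \<and> S $$ (i, i) \<noteq> 0}"

definition finite_eigenvalue :: "complex poly mat \<Rightarrow> complex \<Rightarrow> bool" where
  "finite_eigenvalue P \<alpha> \<longleftrightarrow> (\<exists>p \<in> invariant_polys P. poly p \<alpha> = 0)"

text \<open>
  The reversal of grade \<open>d\<close>, that is \<open>\<lambda>\<^sup>d p(1/\<lambda>)\<close> for \<open>p\<close> of degree at most \<open>d\<close>. It differs from
  \<^const>\<open>reflect_poly\<close>, which always reverses with respect to the actual degree.
\<close>

definition rev_poly :: "nat \<Rightarrow> complex poly \<Rightarrow> complex poly" where
  "rev_poly d p = (\<Sum>i\<le>d. monom (coeff p i) (d - i))"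

lemma poly_rev_poly:
  assumes "degree p \<le> d" and "x \<noteq> 0"
  shows "poly (rev_poly d p) x = x ^ d * poly p (1 / x)"
proof -
  have "poly p (1 / x) = (\<Sum>i\<le>d. coeff p i * (1 / x) ^ i)"
    unfolding poly_altdef using assms(1)
    by (intro sum.mono_neutral_left) (auto simp: coeff_eq_0)
  moreover have "x ^ (d - i) = x ^ d * (1 / x) ^ i" if "i \<le> d" for i
    using that assms(2) by (simp add: power_diff power_one_over)
  ultimately show ?thesis
    by (simp add: rev_poly_def poly_sum poly_monom sum_distrib_left mult_ac)
qed

definition rev_mat :: "nat \<Rightarrow> complex poly mat \<Rightarrow> complex poly mat" where
  "rev_mat d P = map_mat (rev_poly d) P"

definition infinite_eigenvalue :: "nat \<Rightarrow> complex poly mat \<Rightarrow> bool" where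
  "infinite_eigenvalue d P \<longleftrightarrow> finite_eigenvalue (rev_mat d P) 0"

definition no_eigenvalues :: "nat \<Rightarrow> complex poly mat \<Rightarrow> bool" where
  "no_eigenvalues d P \<longleftrightarrow> (\<forall>\<alpha>. \<not> finite_eigenvalue P \<alpha>) \<and> \<not> infinite_eigenvalue d P"

definition POL_ss_neig :: "nat \<Rightarrow> nat \<Rightarrow> nat \<Rightarrow> complex poly mat set" where
  "POL_ss_neig d k m = {P \<in> POL_ss d k m.
     normal_rank P = k \<and> mat_degree P = d \<and> no_eigenvalues d P}"

text \<open>
  In the next two definitions \<open>W\<close> is a subspace of \<open>\<complex>(\<lambda>)\<^sup>m\<close>, and \<open>B\<close> is a set of vector
  polynomials that is embedded into \<open>\<complex>(\<lambda>)\<^sup>m\<close>.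
\<close>

definition polynomial_basis ::
    "nat \<Rightarrow> complex poly fract vec set \<Rightarrow> complex poly vec set \<Rightarrow> bool" where
  "polynomial_basis m W B \<longleftrightarrow> B \<subseteq> carrier_vec m \<and>
     vectorspace.basis class_ring ((module_vec TYPE(complex poly fract) m)\<lparr>carrier := W\<rparr>)
       (map_vec to_fract ` B)"

definition minimal_basis ::
    "nat \<Rightarrow> complex poly fract vec set \<Rightarrow> complex poly vec set \<Rightarrow> bool" where
  "minimal_basis m W B \<longleftrightarrow> polynomial_basis m W B \<and>
     (\<forall>B'. polynomial_basis m W B' \<longrightarrow> sum vec_degree B \<le> sum vec_degree B')"

text \<open>
  Bases are sets here, so linear independence of the family of columns also needs the columns to
  be pairwise distinct.
\<close>

definition is_minimal_basis :: "complex poly mat \<Rightarrow> bool" where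
  "is_minimal_basis L \<longleftrightarrow> distinct (cols L) \<and>
     minimal_basis (dim_row L) (vec_space.col_space (dim_row L) (map_mat to_fract L))
       (set (cols L))"

definition Delta :: "nat \<Rightarrow> complex poly mat" where
  "Delta r = mat r r (\<lambda>(i, j). if i + j + 1 = r then 1 else 0)"

definition skew_Delta :: "nat \<Rightarrow> complex poly mat" where
  "skew_Delta r = four_block_mat (0\<^sub>m r r) (Delta r) (- Delta r) (0\<^sub>m r r)"

end

theory Submission
  imports Defs "HOL-Computational_Algebra.Fundamental_Theorem_Algebra"
begin

text \<open>
  The eigenvalue conditions say that \<open>P(\<alpha>)\<close> has rank \<open>2r\<close> for every \<open>\<alpha>\<close> and that so does the
  coefficient of \<open>\<lambda>\<^sup>d\<close>. By Forney's criterion, \<open>L\<close> is a minimal basis iff \<open>L(\<alpha>)\<close>, for every \<open>\<alpha>\<close>, and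
  the matrix of the leading coefficients of the columns have full column rank. Both conditions
  pass through the congruence \<open>L J L\<^sup>T\<close>, which settles one inclusion.

  Conversely, the Smith form of \<open>P\<close> gives \<open>P = M K M\<^sup>T\<close> with \<open>K\<close> skew-symmetric and unimodular.
  Choosing \<open>M\<close> with minimal sum of column degrees \<open>e i\<close> makes its leading matrix injective; then
  \<open>K i j\<close> has degree at most \<open>d - e i - e j\<close>, and comparing \<open>det K\<close>, a constant, with the nonzero
  determinant of the matrix of these top coefficients shows that \<open>x \<mapsto> d - x\<close> permutes the degrees.
  So the row of \<open>K\<close> with the largest \<open>e i\<close> is constant, and a symplectic Gram--Schmidt process that
  pivots on it respects the degrees and turns \<open>K\<close> into the standard form.
\<close>

subsection \<open>Smith form\<close>

text \<open>The converse needs a symplectic elimination over C[\<lambda>], where a pivot can be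
  divided by in general only if it is constant, and where the new columns must also respect
  prescribed degrees. One grading meets both demands: give \<open>K i j\<close> the weight
  \<open>e i + e j\<close> plus its degree. A bound \<open>d\<close> on all weights is stable under
  elimination with a pivot pair of weight exactly \<open>d\<close>. The eigenvalue condition enters
  in two halves. Finite points leave \<open>det K\<close> without roots; the point at infinity makes
  the determinant of top coefficients nonzero. The latter is the coefficient of \<open>det K\<close>
  at \<open>n * d\<close> minus twice the sum of the \<open>e i\<close>, where
  \<open>n = 2 * r\<close>, so this index must be 0 and the weights have no slack left. Minimality
  of the degree sum allows the leading matrix of \<open>M\<close> to be cancelled, so that the
  weight bound can be read off the degree of \<open>P\<close>. Rank arguments are phrased through
  left inverses and matrix identities, which pass through products and ring homomorphisms.\<close>

definition unimodular :: "nat \<Rightarrow> 'a::comm_ring_1 mat \<Rightarrow> bool" where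
  "unimodular n U \<longleftrightarrow> U \<in> carrier_mat n n \<and>
     (\<exists>U' \<in> carrier_mat n n. U * U' = 1\<^sub>m n \<and> U' * U = 1\<^sub>m n)"

text \<open>Kept over an arbitrary commutative ring because the elimination is run twice: over
  C[\<lambda>] for Smith forms and over a field for rank factorizations.\<close>

definition mat_equiv :: "nat \<Rightarrow> nat \<Rightarrow> 'a::comm_ring_1 mat \<Rightarrow> 'a mat \<Rightarrow> bool" where
  "mat_equiv m n A B \<longleftrightarrow> (\<exists>U V. unimodular m U \<and> unimodular n V \<and> B = U * A * V)"

lemma unimodularI:
  assumes "U \<in> carrier_mat n n" "U' \<in> carrier_mat n n" "U * U' = 1\<^sub>m n" "U' * U = 1\<^sub>m n"
  shows "unimodular n U"
  using assms unfolding unimodular_def by blast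

lemma unimodular_carrier: "unimodular n U \<Longrightarrow> U \<in> carrier_mat n n"
  unfolding unimodular_def by blast

lemma unimodularE:
  assumes "unimodular n U"
  obtains U' where "unimodular n U'" "U \<in> carrier_mat n n" "U' \<in> carrier_mat n n"
    "U * U' = 1\<^sub>m n" "U' * U = 1\<^sub>m n"
  using assms unfolding unimodular_def by blast

lemma unimodular_iff_invertible_mat:
  assumes "U \<in> carrier_mat n n"
  shows "unimodular n U \<longleftrightarrow> invertible_mat U"
proof
  assume "unimodular n U"
  then show "invertible_mat U"
    using assms unfolding unimodular_def invertible_mat_def inverts_mat_def by auto
next
  assume "invertible_mat U"
  then obtain B where B: "U * B = 1\<^sub>m n" "B * U = 1\<^sub>m (dim_row B)"
    using assms unfolding invertible_mat_def inverts_mat_def by auto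
  have "dim_col B = n" using arg_cong[OF B(1), of dim_col] by simp
  moreover have "dim_row B = n" using arg_cong[OF B(2), of dim_col] assms by simp
  ultimately show "unimodular n U"
    using B assms by (intro unimodularI[of U n B]) auto
qed

lemma unimodular_one: "unimodular n (1\<^sub>m n)"
  by (rule unimodularI[of _ n "1\<^sub>m n"]) auto

lemma unimodular_mult:
  assumes "unimodular n U" "unimodular n V"
  shows "unimodular n (U * V)"
proof -
  obtain U' where U: "U \<in> carrier_mat n n" "U' \<in> carrier_mat n n" "U * U' = 1\<^sub>m n" "U' * U = 1\<^sub>m n"
    using assms(1) by (rule unimodularE)
  obtain V' where V: "V \<in> carrier_mat n n" "V' \<in> carrier_mat n n" "V * V' = 1\<^sub>m n" "V' * V = 1\<^sub>m n"
    using assms(2) by (rule unimodularE)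
  have "U * V * (V' * U') = U * ((V * V') * U')"
    using U(1,2) V(1,2) by (simp add: assoc_mult_mat[of _ n n _ n _ n])
  also have "\<dots> = 1\<^sub>m n" using U V by simp
  finally have 1: "U * V * (V' * U') = 1\<^sub>m n" .
  have "V' * U' * (U * V) = V' * ((U' * U) * V)"
    using U(1,2) V(1,2) by (simp add: assoc_mult_mat[of _ n n _ n _ n])
  also have "\<dots> = 1\<^sub>m n" using U V by simp
  finally show ?thesis using 1 U V by (intro unimodularI[of _ n "V' * U'"]) auto
qed

lemma unimodular_transpose:
  assumes "unimodular n U"
  shows "unimodular n (transpose_mat U)"
proof -
  obtain U' where U: "U \<in> carrier_mat n n" "U' \<in> carrier_mat n n" "U * U' = 1\<^sub>m n" "U' * U = 1\<^sub>m n"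
    using assms by (rule unimodularE)
  show ?thesis
    using U by (intro unimodularI[of _ n "transpose_mat U'"])
      (auto simp: transpose_mult[symmetric, of _ n n _ n])
qed

lemma unimodular_addrow_mat:
  assumes "k < n" "l < n" "k \<noteq> l"
  shows "unimodular n (addrow_mat n (a :: 'a::comm_ring_1) k l)"
  using addrow_mat_inv[OF assms, of a] addrow_mat_inv[OF assms, of "- a"]
  by (intro unimodularI[of _ n "addrow_mat n (- a) k l"]) auto

lemma unimodular_swaprows_mat:
  assumes "k < n" "l < n"
  shows "unimodular n (swaprows_mat n k l :: 'a::comm_ring_1 mat)"
  using swaprows_mat_inv[OF assms, where ?'a = 'a]
  by (intro unimodularI[of _ n "swaprows_mat n k l"]) auto

lemma mat_equiv_carrier:
  "mat_equiv m n A B \<Longrightarrow> A \<in> carrier_mat m n \<Longrightarrow> B \<in> carrier_mat m n"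
  unfolding mat_equiv_def using unimodular_carrier by fastforce

lemma mat_equiv_refl: "A \<in> carrier_mat m n \<Longrightarrow> mat_equiv m n A A"
  unfolding mat_equiv_def
  by (intro exI[of _ "1\<^sub>m m"] exI[of _ "1\<^sub>m n"]) (auto simp: unimodular_one)

lemma mat_equiv_trans:
  assumes "A \<in> carrier_mat m n" "mat_equiv m n A B" "mat_equiv m n B C"
  shows "mat_equiv m n A C"
proof -
  from assms(2) obtain U V where UV: "unimodular m U" "unimodular n V" "B = U * A * V"
    unfolding mat_equiv_def by blast
  from assms(3) obtain U' V' where UV': "unimodular m U'" "unimodular n V'" "C = U' * B * V'"
    unfolding mat_equiv_def by blast
  note c = UV(1,2)[THEN unimodular_carrier] UV'(1,2)[THEN unimodular_carrier]
  have "C = (U' * U) * A * (V * V')"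
    unfolding UV'(3) UV(3) using assms(1) c
    by (simp add: assoc_mult_mat[of _ m m _ m _ n] assoc_mult_mat[of _ m m _ n _ n]
        assoc_mult_mat[of _ m n _ n _ n] mult_carrier_mat[of _ m n _ n])
  then show ?thesis
    unfolding mat_equiv_def using unimodular_mult UV UV' by blast
qed

lemma mat_equiv_transpose:
  assumes "A \<in> carrier_mat m n" "mat_equiv m n A B"
  shows "mat_equiv n m (transpose_mat A) (transpose_mat B)"
proof -
  from assms(2) obtain U V where UV: "unimodular m U" "unimodular n V" "B = U * A * V"
    unfolding mat_equiv_def by blast
  note c = UV(1,2)[THEN unimodular_carrier]
  have "transpose_mat B = transpose_mat V * (transpose_mat A * transpose_mat U)"
    unfolding UV(3) using c assms(1)
    by (simp add: transpose_mult[of _ m n _ n] transpose_mult[of _ m m _ n])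
  also have "\<dots> = transpose_mat V * transpose_mat A * transpose_mat U"
    using c assms(1) by (simp add: assoc_mult_mat[of _ n n _ m _ m])
  finally show ?thesis unfolding mat_equiv_def using UV unimodular_transpose by blast
qed

lemma mat_equiv_left:
  assumes "A \<in> carrier_mat m n" "unimodular m U"
  shows "mat_equiv m n A (U * A)"
  unfolding mat_equiv_def using assms unimodular_one[of n] unimodular_carrier[OF assms(2)]
  by (intro exI[of _ U] exI[of _ "1\<^sub>m n"]) (auto simp: mult_carrier_mat)

lemma mat_equiv_addrow:
  assumes "A \<in> carrier_mat m n" "k < m" "l < m" "k \<noteq> l"
  shows "mat_equiv m n A (addrow a k l A)"
  using mat_equiv_left[OF assms(1) unimodular_addrow_mat[OF assms(2-4), of a]]
    addrow_mat[OF assms(1) assms(3), of a k] by simp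

lemma mat_equiv_swaprows:
  assumes "A \<in> carrier_mat m n" "k < m" "l < m"
  shows "mat_equiv m n A (swaprows k l A)"
  using mat_equiv_left[OF assms(1) unimodular_swaprows_mat[OF assms(2,3)]]
    swaprows_mat[OF assms] by simp

text \<open>One unimodular factor clears a whole column: if
  \<open>A $$ (i, 0) = x i * A $$ (0, 0)\<close> for all rows, everything below the corner vanishes.
  Row 0 itself is untouched, so replacing \<open>x\<close> by \<open>- x\<close> undoes the
  operation.\<close>

lemma mat_equiv_lower_block:
  assumes A: "A \<in> carrier_mat (Suc m) (Suc n)"
  shows "mat_equiv (Suc m) (Suc n) A
    (mat (Suc m) (Suc n) (\<lambda>(i, j). if i = 0 then A $$ (0, j) else A $$ (i, j) - x i * A $$ (0, j)))"
    (is "mat_equiv _ _ _ ?B")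
proof -
  define E where "E s = mat (Suc m) (Suc m)
    (\<lambda>(i, j). if i = j then 1 else if j = 0 then s * x i else 0)" for s
  have Ec: "E s \<in> carrier_mat (Suc m) (Suc m)" for s unfolding E_def by simp
  have mult: "(E s * C) $$ (i, j) = (if i = 0 then C $$ (0, j) else C $$ (i, j) + s * x i * C $$ (0, j))"
    if "C \<in> carrier_mat (Suc m) k" "i < Suc m" "j < k" for s C i j k
  proof -
    have "(E s * C) $$ (i, j) = (\<Sum>l = 0..<Suc m. E s $$ (i, l) * C $$ (l, j))"
      using that Ec[of s] by (simp add: scalar_prod_def)
    also have "\<dots> = (\<Sum>l = 0..<Suc m. (if l = i then C $$ (i, j) else 0)
        + (if l = 0 then (if i = 0 then 0 else s * x i * C $$ (0, j)) else 0))"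
      using that by (intro sum.cong) (auto simp: E_def)
    also have "\<dots> = (if i = 0 then C $$ (0, j) else C $$ (i, j) + s * x i * C $$ (0, j))"
      using that by (simp add: sum.distrib del: sum.op_ivl_Suc)
    finally show ?thesis .
  qed
  have inv: "E s * E (- s) = 1\<^sub>m (Suc m)" for s
    by (rule eq_matI) (use Ec[of s] Ec[of "- s"] in
      \<open>auto simp: mult[OF Ec] simp del: index_mult_mat(1)\<close>, auto simp: E_def)
  have "unimodular (Suc m) (E (- 1))"
    using inv[of 1] inv[of "- 1"] by (intro unimodularI[of _ _ "E 1"]) (auto simp: Ec)
  moreover have "E (- 1) * A = ?B"
    by (rule eq_matI) (use A Ec[of "- 1"] in \<open>auto simp: mult[OF A] simp del: index_mult_mat(1)\<close>)
  ultimately show ?thesis using mat_equiv_left[OF A] by metis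
qed

section \<open>Pivots of minimal size in an equivalence class\<close>

text \<open>Minimality ranges over the whole equivalence class, not over the entries of
  \<open>Q\<close>. An operation that would produce a smaller nonzero corner is then contradictory
  at once, which replaces a termination argument.\<close>

definition min_pivot :: "('a::comm_ring_1 \<Rightarrow> nat) \<Rightarrow> nat \<Rightarrow> nat \<Rightarrow> 'a mat \<Rightarrow> bool" where
  "min_pivot \<delta> m n Q \<longleftrightarrow> Q \<in> carrier_mat m n \<and> Q $$ (0, 0) \<noteq> 0 \<and>
     (\<forall>R. mat_equiv m n Q R \<longrightarrow> R $$ (0, 0) \<noteq> 0 \<longrightarrow> \<delta> (Q $$ (0, 0)) \<le> \<delta> (R $$ (0, 0)))"

lemma min_pivot_equiv:
  assumes "min_pivot \<delta> m n Q" "mat_equiv m n Q R" "R $$ (0, 0) = Q $$ (0, 0)"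
  shows "min_pivot \<delta> m n R"
  using assms mat_equiv_trans[of Q m n R] mat_equiv_carrier[of m n Q R]
  unfolding min_pivot_def by metis

lemma min_pivot_transpose:
  assumes "min_pivot \<delta> m n Q" "0 < m" "0 < n"
  shows "min_pivot \<delta> n m (transpose_mat Q)"
  unfolding min_pivot_def
proof (intro conjI allI impI)
  have Q: "Q \<in> carrier_mat m n" using assms(1) unfolding min_pivot_def by blast
  show "transpose_mat Q \<in> carrier_mat n m" using Q by simp
  show "transpose_mat Q $$ (0, 0) \<noteq> 0" using Q assms unfolding min_pivot_def by auto
  fix R assume R: "mat_equiv n m (transpose_mat Q) R" "R $$ (0, 0) \<noteq> 0"
  have Rc: "R \<in> carrier_mat n m" using mat_equiv_carrier[OF R(1)] Q by simp
  have "mat_equiv m n Q (transpose_mat R)"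
    using mat_equiv_transpose[OF _ R(1)] Q by simp
  then show "\<delta> (transpose_mat Q $$ (0, 0)) \<le> \<delta> (R $$ (0, 0))"
    using assms Q R(2) Rc unfolding min_pivot_def by auto
qed

definition smith_diag :: "nat \<Rightarrow> nat \<Rightarrow> 'a::comm_ring_1 mat \<Rightarrow> bool" where
  "smith_diag m n S \<longleftrightarrow> S \<in> carrier_mat m n \<and> (\<forall>i<m. \<forall>j<n. i \<noteq> j \<longrightarrow> S $$ (i, j) = 0) \<and>
     (\<forall>i. Suc i < min m n \<longrightarrow> S $$ (i, i) dvd S $$ (Suc i, Suc i))"

context
  fixes \<delta> :: "'a::idom \<Rightarrow> nat"
  assumes division: "\<And>a b. b \<noteq> 0 \<Longrightarrow> \<exists>q. a - q * b = 0 \<or> \<delta> (a - q * b) < \<delta> b"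
begin

text \<open>A nonzero remainder of \<open>Q $$ (i, 0)\<close> modulo the corner could be swapped
  into the corner, where it would be smaller.\<close>

lemma min_pivot_dvd_column:
  assumes min: "min_pivot \<delta> m n Q" and i: "i < m" and n: "0 < n"
  shows "Q $$ (0, 0) dvd Q $$ (i, 0)"
proof (cases "i = 0")
  case False
  have Q: "Q \<in> carrier_mat m n" "Q $$ (0, 0) \<noteq> 0" using min unfolding min_pivot_def by auto
  have m: "0 < m" using i by simp
  obtain q where q: "Q $$ (i, 0) - q * Q $$ (0, 0) = 0
      \<or> \<delta> (Q $$ (i, 0) - q * Q $$ (0, 0)) < \<delta> (Q $$ (0, 0))"
    using division[OF Q(2)] by blast
  show ?thesis
  proof (cases "Q $$ (i, 0) - q * Q $$ (0, 0) = 0")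
    case True
    then show ?thesis by (simp add: dvd_def mult.commute)
  next
    case nz: False
    define R where "R = swaprows 0 i (addrow (- q) i 0 Q)"
    have Ac: "addrow (- q) i 0 Q \<in> carrier_mat m n" using Q by simp
    have "mat_equiv m n Q R"
      unfolding R_def
      using mat_equiv_trans[OF Q(1) mat_equiv_addrow[OF Q(1) i m False]
          mat_equiv_swaprows[OF Ac m i]] .
    moreover have "R $$ (0, 0) = Q $$ (i, 0) - q * Q $$ (0, 0)"
      using Q i m n unfolding R_def by simp
    ultimately show ?thesis using min q nz unfolding min_pivot_def by force
  qed
qed simp

lemma min_pivot_dvd_row:
  assumes "min_pivot \<delta> m n Q" "j < n" "0 < m"
  shows "Q $$ (0, 0) dvd Q $$ (0, j)"
  using min_pivot_dvd_column[OF min_pivot_transpose[OF assms(1,3)], of j] assms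
  unfolding min_pivot_def by auto

text \<open>A corner of least size divides its row and its column, so both can be cleared without
  changing it. Divisibility of the other entries is derived afterwards, from the cleared
  matrix.\<close>

lemma pivot_exists:
  fixes A :: "'a mat"
  assumes A: "A \<in> carrier_mat (Suc m) (Suc n)" and "A \<noteq> 0\<^sub>m (Suc m) (Suc n)"
  obtains Q where "mat_equiv (Suc m) (Suc n) A Q"
    "\<And>i. i < m \<Longrightarrow> Q $$ (Suc i, 0) = 0" "\<And>j. j < n \<Longrightarrow> Q $$ (0, Suc j) = 0"
    "\<And>i j. i < Suc m \<Longrightarrow> j < Suc n \<Longrightarrow> Q $$ (0, 0) dvd Q $$ (i, j)"
proof -
  let ?m = "Suc m" and ?n = "Suc n"
  let ?eq = "mat_equiv ?m ?n"
  let ?C = "\<lambda>Q. ?eq A Q \<and> Q $$ (0, 0) \<noteq> 0"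
  obtain i j where ij: "i < ?m" "j < ?n" "A $$ (i, j) \<noteq> 0"
    using assms by (metis eq_matI carrier_matD index_zero_mat)
  define B where "B = swaprows 0 i A"
  have B: "?eq A B" "B \<in> carrier_mat ?m ?n"
    using mat_equiv_swaprows[OF A _ ij(1), of 0] A unfolding B_def by auto
  define D where "D = transpose_mat (swaprows 0 j (transpose_mat B))"
  have "mat_equiv ?n ?m (transpose_mat B) (swaprows 0 j (transpose_mat B))"
    using B ij by (intro mat_equiv_swaprows) auto
  from mat_equiv_transpose[OF _ this] B have "?eq B D" unfolding D_def by simp
  then have "?eq A D" using mat_equiv_trans[OF A B(1)] by blast
  moreover have "D $$ (0, 0) = A $$ (i, j)" unfolding D_def B_def using A ij by simp
  ultimately have "?C D" using ij by simp
  then obtain Q where Q: "?C Q" and Qmin: "\<And>R. ?C R \<Longrightarrow> \<delta> (Q $$ (0, 0)) \<le> \<delta> (R $$ (0, 0))"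
    using exists_least_iff[of "\<lambda>d. \<exists>Q. ?C Q \<and> \<delta> (Q $$ (0, 0)) = d"] by (metis not_less)
  have Qc: "Q \<in> carrier_mat ?m ?n" using Q mat_equiv_carrier A by blast
  have mQ: "min_pivot \<delta> ?m ?n Q"
    unfolding min_pivot_def using Q Qc Qmin mat_equiv_trans[OF A] by blast
  define a where "a = Q $$ (0, 0)"
  obtain x where x: "\<And>i. i < ?m \<Longrightarrow> Q $$ (i, 0) = x i * a"
    using min_pivot_dvd_column[OF mQ] unfolding a_def dvd_def by (metis mult.commute zero_less_Suc)
  define Q1 where "Q1 = mat ?m ?n
    (\<lambda>(i, j). if i = 0 then Q $$ (0, j) else Q $$ (i, j) - x i * Q $$ (0, j))"
  have Q1: "?eq Q Q1" unfolding Q1_def by (rule mat_equiv_lower_block[OF Qc])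
  have Q1c: "Q1 \<in> carrier_mat ?m ?n" by (simp add: Q1_def)
  have Q1a: "Q1 $$ (0, 0) = a" by (simp add: Q1_def a_def)
  have Q1col: "Q1 $$ (Suc i, 0) = 0" if "i < m" for i
    using that x[of "Suc i"] by (simp add: Q1_def a_def)
  have mQ1: "min_pivot \<delta> ?m ?n Q1" using min_pivot_equiv[OF mQ Q1] Q1a a_def by simp
  obtain y where y: "\<And>j. j < ?n \<Longrightarrow> Q1 $$ (0, j) = y j * a"
    using min_pivot_dvd_row[OF mQ1] unfolding Q1a dvd_def by (metis mult.commute zero_less_Suc)
  define T where "T = mat ?n ?m (\<lambda>(i, j). if i = 0 then transpose_mat Q1 $$ (0, j)
    else transpose_mat Q1 $$ (i, j) - y i * transpose_mat Q1 $$ (0, j))"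
  have T: "mat_equiv ?n ?m (transpose_mat Q1) T"
    unfolding T_def using Q1c by (intro mat_equiv_lower_block) simp
  define Q2 where "Q2 = transpose_mat T"
  have Q2: "?eq Q1 Q2" using mat_equiv_transpose[OF _ T] Q1c unfolding Q2_def by simp
  have Q2c: "Q2 \<in> carrier_mat ?m ?n" by (simp add: Q2_def T_def)
  have Q2i: "Q2 $$ (i, j) = (if j = 0 then Q1 $$ (i, 0) else Q1 $$ (i, j) - y j * Q1 $$ (i, 0))"
    if "i < ?m" "j < ?n" for i j
    using that Q1c by (simp add: Q2_def T_def)
  have Q2a: "Q2 $$ (0, 0) = a" using Q2i[of 0 0] Q1a by simp
  have Q2col: "Q2 $$ (Suc i, 0) = 0" if "i < m" for i
    using that Q2i[of "Suc i" 0] Q1col by simp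
  have Q2row: "Q2 $$ (0, Suc j) = 0" if "j < n" for j
    using that Q2i[of 0 "Suc j"] y Q1a by simp
  have mQ2: "min_pivot \<delta> ?m ?n Q2" using min_pivot_equiv[OF mQ1 Q2] Q1a Q2a by simp
  have "a dvd Q2 $$ (i, j)" if ij: "i < ?m" "j < ?n" for i j
  proof (cases "i = 0 \<or> j = 0")
    case True
    then show ?thesis using ij Q2a Q2row[of "j - 1"] Q2col[of "i - 1"] by (cases i; cases j) auto
  next
    case False
    \<comment> \<open>Row \<open>i\<close> has a zero in column 0, so adding it to row 0 keeps the
      corner, and row 0 then shows the entries of row \<open>i\<close>.\<close>
    define R where "R = addrow 1 0 i Q2"
    have R: "?eq Q2 R" unfolding R_def using False ij by (intro mat_equiv_addrow[OF Q2c]) auto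
    have R0: "R $$ (0, 0) = a" using Q2c ij Q2a Q2col[of "i - 1"] False by (cases i) (auto simp: R_def)
    have "R $$ (0, 0) dvd R $$ (0, j)"
      using min_pivot_dvd_row[OF min_pivot_equiv[OF mQ2 R]] R0 Q2a ij by simp
    moreover have "R $$ (0, j) = Q2 $$ (i, j)"
      using Q2c ij Q2row[of "j - 1"] False by (cases j) (auto simp: R_def)
    ultimately show ?thesis using R0 by simp
  qed
  then show thesis
    using that[of Q2] mat_equiv_trans[OF A _ mat_equiv_trans[OF Qc Q1 Q2]] Q Q2a Q2col Q2row by auto
qed

end

section \<open>Diagonalization and monic normalization\<close>

lemma dvd_mult_mat:
  assumes "A \<in> carrier_mat m k" "B \<in> carrier_mat k n" "i < m" "j < n"
    and "(\<forall>i<m. \<forall>l<k. a dvd A $$ (i, l)) \<or> (\<forall>l<k. \<forall>j<n. a dvd B $$ (l, j))"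
  shows "(a::'a::comm_ring_1) dvd (A * B) $$ (i, j)"
  using assms by (auto simp: scalar_prod_def intro!: dvd_sum)

lemma unimodular_four_block_one:
  assumes "unimodular n U"
  shows "unimodular (Suc n) (four_block_mat (1\<^sub>m 1) (0\<^sub>m 1 n) (0\<^sub>m n 1) U)"
proof -
  obtain U' where U: "U \<in> carrier_mat n n" "U' \<in> carrier_mat n n" "U * U' = 1\<^sub>m n" "U' * U = 1\<^sub>m n"
    using assms by (rule unimodularE)
  let ?f = "\<lambda>U. four_block_mat (1\<^sub>m 1) (0\<^sub>m 1 n) (0\<^sub>m n 1) U"
  have *: "?f X * ?f Y = 1\<^sub>m (Suc n)" if "X \<in> carrier_mat n n" "Y \<in> carrier_mat n n" "X * Y = 1\<^sub>m n"
    for X Y :: "'a mat"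
    using that by (subst mult_four_block_mat[of _ 1 1 _ n _ n _ _ 1 _ n]) auto
  have "?f X \<in> carrier_mat (Suc n) (Suc n)" if "X \<in> carrier_mat n n" for X :: "'a mat"
    using that by (intro carrier_matI) auto
  then show ?thesis using U * by (intro unimodularI[of _ _ "?f U'"]) auto
qed

lemma smith_diag_exists:
  fixes A :: "'a::idom mat" and \<delta> :: "'a \<Rightarrow> nat"
  assumes division: "\<And>a b. b \<noteq> 0 \<Longrightarrow> \<exists>q. a - q * b = 0 \<or> \<delta> (a - q * b) < \<delta> b"
    and "A \<in> carrier_mat m n"
  shows "\<exists>S. mat_equiv m n A S \<and> smith_diag m n S"
  using assms(2)
proof (induction m arbitrary: n A)
  case 0
  then show ?case using mat_equiv_refl[of A 0 n] by (auto simp: smith_diag_def)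
next
  case (Suc m n' A)
  show ?case
  proof (cases "n' = 0 \<or> A = 0\<^sub>m (Suc m) n'")
    case True
    then show ?thesis using mat_equiv_refl[OF Suc.prems] Suc.prems by (auto simp: smith_diag_def)
  next
    case False
    then obtain n where n: "n' = Suc n" by (cases n') auto
    obtain Q where Q: "mat_equiv (Suc m) (Suc n) A Q"
      "\<And>i. i < m \<Longrightarrow> Q $$ (Suc i, 0) = 0" "\<And>j. j < n \<Longrightarrow> Q $$ (0, Suc j) = 0"
      "\<And>i j. i < Suc m \<Longrightarrow> j < Suc n \<Longrightarrow> Q $$ (0, 0) dvd Q $$ (i, j)"
      using pivot_exists[of \<delta> A m n] division Suc.prems False n by metis
    have Qc: "Q \<in> carrier_mat (Suc m) (Suc n)" using mat_equiv_carrier[OF Q(1)] Suc.prems n by simp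
    define a where "a = Q $$ (0, 0)"
    define B where "B = mat m n (\<lambda>(i, j). Q $$ (Suc i, Suc j))"
    have Bc: "B \<in> carrier_mat m n" by (simp add: B_def)
    let ?blk = "\<lambda>X. four_block_mat (mat 1 1 (\<lambda>_. a)) (0\<^sub>m 1 n) (0\<^sub>m m 1) X"
    have "Q $$ (i, 0) = 0" if "0 < i" "i < Suc m" for i using that Q(2)[of "i - 1"] by simp
    moreover have "Q $$ (0, j) = 0" if "0 < j" "j < Suc n" for j using that Q(3)[of "j - 1"] by simp
    ultimately have QB: "Q = ?blk B"
      by (intro eq_matI) (use Qc in \<open>auto simp: B_def a_def\<close>)
    obtain S where S: "mat_equiv m n B S" "smith_diag m n S" using Suc.IH[OF Bc] by blast
    then obtain U V where UV: "unimodular m U" "unimodular n V" "S = U * B * V"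
      unfolding mat_equiv_def by blast
    note c = UV(1,2)[THEN unimodular_carrier]
    have Sc: "S \<in> carrier_mat m n" using c Bc UV(3) by auto
    let ?U = "four_block_mat (1\<^sub>m 1) (0\<^sub>m 1 m) (0\<^sub>m m 1) U"
    let ?V = "four_block_mat (1\<^sub>m 1) (0\<^sub>m 1 n) (0\<^sub>m n 1) V"
    have "?U * Q = ?blk (U * B)"
      unfolding QB using c Bc by (subst mult_four_block_mat[of _ 1 1 _ m _ m _ _ 1 _ n]) auto
    moreover have "?blk (U * B) * ?V = ?blk S"
      unfolding UV(3) using c Bc by (subst mult_four_block_mat[of _ 1 1 _ n _ m _ _ 1 _ n]) auto
    ultimately have "mat_equiv (Suc m) (Suc n) Q (?blk S)"
      unfolding mat_equiv_def using UV(1,2)[THEN unimodular_four_block_one] by metis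
    then have 1: "mat_equiv (Suc m) (Suc n) A (?blk S)"
      using mat_equiv_trans[OF _ Q(1)] Suc.prems n by blast
    \<comment> \<open>The corner divides all combinations of entries of \<open>B\<close>, hence the
      diagonal obtained recursively; this attaches \<open>a\<close> to the front of the divisibility
      chain.\<close>
    have "\<forall>i<m. \<forall>j<n. a dvd B $$ (i, j)" using Q(4) by (auto simp: B_def a_def)
    then have "\<forall>i<m. \<forall>j<n. a dvd (U * B) $$ (i, j)"
      using dvd_mult_mat[OF c(1) Bc] by blast
    then have aS: "a dvd S $$ (i, j)" if "i < m" "j < n" for i j
      unfolding UV(3) using that dvd_mult_mat[OF mult_carrier_mat[OF c(1) Bc] c(2)] by blast
    have "smith_diag (Suc m) (Suc n) (?blk S)"
      unfolding smith_diag_def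
    proof (intro conjI allI impI)
      show "?blk S \<in> carrier_mat (Suc m) (Suc n)" using Sc by (intro carrier_matI) auto
      fix i j assume "i < Suc m" "j < Suc n" "i \<noteq> j"
      then show "?blk S $$ (i, j) = 0" using Sc S(2) unfolding smith_diag_def by auto
    next
      fix i assume i: "Suc i < min (Suc m) (Suc n)"
      show "?blk S $$ (i, i) dvd ?blk S $$ (Suc i, Suc i)"
      proof (cases i)
        case 0
        then show ?thesis using i Sc aS[of 0 0] by auto
      next
        case (Suc k)
        then show ?thesis using i Sc S(2) unfolding smith_diag_def by auto
      qed
    qed
    then show ?thesis using 1 n by blast
  qed
qed

lemma smith_form_exists:
  assumes P: "P \<in> carrier_mat m n"
  shows "\<exists>S. is_smith_form P S"
proof -
  have "\<exists>q. a - q * b = 0 \<or> degree (a - q * b) < degree b" if "b \<noteq> 0" for a b :: "complex poly"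
  proof -
    have "a - (a div b) * b = a mod b" by (simp add: minus_div_mult_eq_mod)
    then show ?thesis using degree_mod_less[OF that, of a] by metis
  qed
  from smith_diag_exists[of degree, OF this P] obtain S0 where
    S0: "mat_equiv m n P S0" "smith_diag m n S0" by blast
  then obtain U V where UV: "unimodular m U" "unimodular n V" "S0 = U * P * V"
    unfolding mat_equiv_def by blast
  note c = UV(1,2)[THEN unimodular_carrier]
  have S0c: "S0 \<in> carrier_mat m n" using S0(2) by (simp add: smith_diag_def)
  \<comment> \<open>Positions with a zero entry or with \<open>i \<ge> n\<close> get the factor 1,
    so that scaling by \<open>inverse (u i)\<close> is always invertible.\<close>
  define u where "u i = (if i < n \<and> S0 $$ (i, i) \<noteq> 0 then lead_coeff (S0 $$ (i, i)) else 1)" for i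
  have u0: "u i \<noteq> 0" for i by (simp add: u_def)
  define D where "D f = mat m m (\<lambda>(i, j). if i = j then [:f i:] else 0)" for f :: "nat \<Rightarrow> complex"
  have Dc: "D f \<in> carrier_mat m m" for f by (simp add: D_def)
  have D_mult: "(D f * X) $$ (i, j) = [:f i:] * X $$ (i, j)"
    if "X \<in> carrier_mat m k" "i < m" "j < k" for f X i j k
  proof -
    have "(D f * X) $$ (i, j) = (\<Sum>l = 0..<m. D f $$ (i, l) * X $$ (l, j))"
      using that Dc[of f] by (simp add: scalar_prod_def)
    also have "\<dots> = (\<Sum>l = 0..<m. if l = i then [:f i:] * X $$ (i, j) else 0)"
      using that by (intro sum.cong) (auto simp: D_def)
    finally show ?thesis using that by simp
  qed
  have inv: "D f * D g = 1\<^sub>m m" if "\<And>i. f i * g i = 1" for f g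
    by (rule eq_matI) (use Dc that in \<open>auto simp: D_mult[OF Dc] simp del: index_mult_mat(1)\<close>,
      auto simp: D_def pCons_one that)
  have uD: "unimodular m (D (\<lambda>i. inverse (u i)))"
    using inv[of u "\<lambda>i. inverse (u i)"] inv[of "\<lambda>i. inverse (u i)" u] u0
    by (intro unimodularI[of _ _ "D u"]) (auto simp: Dc)
  define S where "S = D (\<lambda>i. inverse (u i)) * S0"
  have Sc: "S \<in> carrier_mat m n" unfolding S_def by (rule mult_carrier_mat[OF Dc S0c])
  have Si: "S $$ (i, j) = Polynomial.smult (inverse (u i)) (S0 $$ (i, j))" if "i < m" "j < n" for i j
    unfolding S_def using D_mult[OF S0c that] by simp
  have SUV: "S = (D (\<lambda>i. inverse (u i)) * U) * P * V"
    unfolding S_def UV(3) using Dc[of "\<lambda>i. inverse (u i)"] c P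
    by (simp add: assoc_mult_mat[of _ m m _ m _ n] assoc_mult_mat[of _ m m _ n _ n]
        mult_carrier_mat[of _ m n _ n])
  have "unimodular m (D (\<lambda>i. inverse (u i)) * U)" by (rule unimodular_mult[OF uD UV(1)])
  then have ex: "\<exists>U V. U \<in> carrier_mat (dim_row P) (dim_row P) \<and> invertible_mat U \<and>
            V \<in> carrier_mat (dim_col P) (dim_col P) \<and> invertible_mat V \<and> S = U * P * V"
    using P UV(2) SUV by (metis carrier_matD unimodular_carrier unimodular_iff_invertible_mat)
  have "is_smith_form P S"
    unfolding is_smith_form_def
  proof (intro conjI allI impI)
    show "diagonal_mat S"
      using Sc Si S0(2) unfolding diagonal_mat_def smith_diag_def by auto
    fix i
    {
      assume i: "Suc i < min (dim_row S) (dim_col S)"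
      then have "S0 $$ (i, i) dvd S0 $$ (Suc i, Suc i)" using S0(2) Sc unfolding smith_diag_def by auto
      then show "S $$ (i, i) dvd S $$ (Suc i, Suc i)"
        using i Sc u0 by (simp add: Si Polynomial.smult_dvd_iff Polynomial.dvd_smult)
    next
      assume "i < min (dim_row S) (dim_col S)" "S $$ (i, i) \<noteq> 0"
      then show "lead_coeff (S $$ (i, i)) = 1"
        using Sc Si[of i i] by (auto simp: u_def)
    }
  qed (use ex in auto)
  then show ?thesis by blast
qed

subsection \<open>Rank of matrices over a field\<close>

lemma (in vec_space) card_lin_indpt_le_rank:
  assumes B: "B \<in> carrier_mat n b"
    and sub: "T \<subseteq> span (set (cols B))" and T: "lin_indpt T"
  shows "card T \<le> rank B"
proof -
  have Bc: "set (cols B) \<subseteq> carrier_vec n" using B cols_dim by blast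
  have sm: "submodule class_ring (span (set (cols B))) V" by (rule span_is_submodule[OF Bc])
  interpret w: vectorspace class_ring "span_vs (set (cols B))"
    using Bc span_is_subspace subspace_is_vs by blast
  have "\<not> module.lin_dep class_ring (span_vs (set (cols B))) T"
    using span_li_not_depend(2)[OF sub sm] T by simp
  then show ?thesis
    unfolding rank_def using w.li_le_dim(2)[of T] sub fin_dim_span_cols[OF B] by auto
qed

text \<open>The columns of \<open>B * C\<close> lie in the column space of \<open>B\<close>, and
  \<open>B\<close> has only \<open>k\<close> columns.\<close>

lemma rank_le_inner:
  fixes B :: "'a::field mat"
  assumes B: "B \<in> carrier_mat m k" and C: "C \<in> carrier_mat k n"
  shows "vec_space.rank m (B * C) \<le> k"
proof -
  interpret vec_space "TYPE('a)" m .
  have BC: "B * C \<in> carrier_mat m n" using B C by simp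
  obtain S where S: "maximal S (\<lambda>T. T \<subseteq> set (cols (B * C)) \<and> lin_indpt T)"
    using maximal_exists_superset[of "set (cols (B * C))" "\<lambda>T. T \<subseteq> set (cols (B * C)) \<and> lin_indpt T" "{}"]
    by (meson List.finite_set empty_iff empty_subsetI finite_lin_indpt2 finite.emptyI)
  have "set (cols (B * C)) \<subseteq> col_space B"
  proof
    fix x assume "x \<in> set (cols (B * C))"
    then obtain j where j: "j < n" "x = col (B * C) j" using BC by (auto simp: cols_def)
    then have "x = B *\<^sub>v col C j" using B C col_mult2[OF B C j(1)] by simp
    then show "x \<in> col_space B"
      unfolding col_space_eq[OF B] using B C by (auto intro!: bexI[of _ "col C j"])
  qed
  then have "S \<subseteq> span (set (cols B))" "lin_indpt S"
    using S unfolding maximal_def col_space_def by auto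
  then have "card S \<le> rank B" using card_lin_indpt_le_rank[OF B] by blast
  then show ?thesis using rank_card_indpt[OF BC S] rank_le_nc[OF B] by simp
qed

section \<open>Left inverses and rank factorizations\<close>

lemma mult_mat_zero_vec: "A \<in> carrier_mat m n \<Longrightarrow> A *\<^sub>v 0\<^sub>v n = 0\<^sub>v m"
  by (intro eq_vecI) auto

definition left_invertible :: "nat \<Rightarrow> nat \<Rightarrow> 'a::comm_ring_1 mat \<Rightarrow> bool" where
  "left_invertible m n A \<longleftrightarrow> A \<in> carrier_mat m n \<and> (\<exists>X \<in> carrier_mat n m. X * A = 1\<^sub>m n)"

lemma left_invertible_kernel:
  assumes "left_invertible m n A" "v \<in> carrier_vec n" "A *\<^sub>v v = 0\<^sub>v m"
  shows "v = 0\<^sub>v n"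
proof -
  obtain X where X: "A \<in> carrier_mat m n" "X \<in> carrier_mat n m" "X * A = 1\<^sub>m n"
    using assms(1) unfolding left_invertible_def by blast
  have "v = (X * A) *\<^sub>v v" using X assms by simp
  also have "\<dots> = X *\<^sub>v (A *\<^sub>v v)" by (rule assoc_mult_mat_vec[OF X(2,1) assms(2)])
  finally show ?thesis using assms mult_mat_zero_vec[OF X(2)] by simp
qed

lemma left_invertible_distinct_cols:
  assumes "left_invertible m n A"
  shows "distinct (cols A)"
proof (rule ccontr)
  obtain X where X: "A \<in> carrier_mat m n" "X \<in> carrier_mat n m" "X * A = 1\<^sub>m n"
    using assms unfolding left_invertible_def by blast
  assume "\<not> distinct (cols A)"
  then obtain i j where ij: "i < n" "j < n" "i \<noteq> j" "col A i = col A j"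
    using X by (auto simp: distinct_conv_nth)
  have "col (X * A) i = col (X * A) j" using ij col_mult2[OF X(2,1)] by simp
  then have "col (1\<^sub>m n :: 'a mat) i $ i = col (1\<^sub>m n) j $ i" unfolding X by simp
  then show False using ij by simp
qed

text \<open>\<open>A * Y\<close> has the left inverse \<open>X\<close>, hence \<open>k\<close>
  independent columns inside the column space of \<open>A\<close>. Together with
  \<open>rank_le_inner\<close> this lets ranks be computed from matrix identities alone.\<close>

lemma rank_ge_identity:
  fixes A :: "'a::field mat"
  assumes A: "A \<in> carrier_mat m n" and X: "X \<in> carrier_mat k m" and Y: "Y \<in> carrier_mat n k"
    and eq: "X * A * Y = 1\<^sub>m k"
  shows "k \<le> vec_space.rank m A"
proof -
  interpret vec_space "TYPE('a)" m .
  let ?D = "A * Y"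
  have D: "?D \<in> carrier_mat m k" using A Y by simp
  have "X * ?D = 1\<^sub>m k" using eq assoc_mult_mat[OF X A Y] by simp
  then have l: "left_invertible m k ?D" unfolding left_invertible_def using D X by blast
  then have dist: "distinct (cols ?D)" by (rule left_invertible_distinct_cols)
  have "lin_indpt (set (cols ?D))" using lin_depE[OF D _ dist] left_invertible_kernel[OF l] by blast
  moreover have "set (cols ?D) \<subseteq> span (set (cols A))"
  proof
    fix x assume "x \<in> set (cols ?D)"
    then obtain j where j: "j < k" "x = col ?D j" using D by (auto simp: cols_def)
    then have "x = A *\<^sub>v col Y j" using col_mult2[OF A Y j(1)] by simp
    then have "x \<in> col_space A"
      unfolding col_space_eq[OF A] using A Y by (auto intro!: bexI[of _ "col Y j"])
    then show "x \<in> span (set (cols A))" unfolding col_space_def .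
  qed
  ultimately have "card (set (cols ?D)) \<le> rank A" using card_lin_indpt_le_rank[OF A] by blast
  then show ?thesis using distinct_card[OF dist] D Y by simp
qed

lemma mult_mat_regroup:
  assumes "A \<in> carrier_mat a b" "B \<in> carrier_mat b c" "C \<in> carrier_mat c d" "D \<in> carrier_mat d e"
  shows "A * (B * C) * D = (A * B) * (C * (D :: 'a::semiring_0 mat))"
proof -
  have "A * (B * C) = A * B * C" by (rule assoc_mult_mat[OF assms(1-3), symmetric])
  then show ?thesis using assoc_mult_mat[OF mult_carrier_mat[OF assms(1,2)] assms(3,4)] by simp
qed

lemma rank_eqI:
  fixes B :: "'a::field mat"
  assumes B: "B \<in> carrier_mat m k" and C: "C \<in> carrier_mat k n"
    and X: "X \<in> carrier_mat k m" and Y: "Y \<in> carrier_mat n k" and "X * (B * C) * Y = 1\<^sub>m k"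
  shows "vec_space.rank m (B * C) = k"
  using rank_le_inner[OF B C] rank_ge_identity[OF mult_carrier_mat[OF B C] X Y assms(5)] by simp

text \<open>Made for Smith forms: the divisibility chain makes the set of nonzero diagonal positions
  downward closed, hence an initial segment whose length is the rank.\<close>

lemma down_closed_eq_lessThan:
  assumes "\<And>i. Suc i < N \<Longrightarrow> s (Suc i) \<Longrightarrow> s i"
  shows "{i. i < N \<and> s i} = {..<card {i. i < N \<and> s i}}"
  using assms
proof (induction N)
  case 0
  then show ?case by simp
next
  case (Suc N)
  have IH: "{i. i < N \<and> s i} = {..<card {i. i < N \<and> s i}}" using Suc by simp
  show ?case
  proof (cases "s N")
    case False
    then have "{i. i < Suc N \<and> s i} = {i. i < N \<and> s i}" by (auto simp: less_Suc_eq)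
    then show ?thesis using IH by simp
  next
    case True
    have "s (N - k)" for k
    proof (induction k)
      case (Suc k)
      then show ?case using Suc.prems \<open>\<And>i. Suc i < Suc N \<Longrightarrow> s (Suc i) \<Longrightarrow> s i\<close>[of "N - Suc k"]
        by (cases "k < N") (auto simp: Suc_diff_Suc)
    qed (use True in simp)
    then have "s i" if "i < Suc N" for i using that by (metis diff_diff_cancel less_Suc_eq_le)
    then have "{i. i < Suc N \<and> s i} = {..<Suc N}" by auto
    then show ?thesis by simp
  qed
qed

lemma index_mult_mat_sum:
  assumes "A \<in> carrier_mat m k" "B \<in> carrier_mat k n" "i < m" "j < n"
  shows "(A * B) $$ (i, j) = (\<Sum>l<k. A $$ (i, l) * B $$ (l, j))"
  using assms by (auto simp: scalar_prod_def atLeast0LessThan intro!: sum.cong)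

definition rect_id :: "nat \<Rightarrow> nat \<Rightarrow> 'a::{zero,one} mat" where
  "rect_id m n = mat m n (\<lambda>(i, j). if i = j then 1 else 0)"

lemma rect_id_carrier [simp]: "rect_id m n \<in> carrier_mat m n"
  by (simp add: rect_id_def)

lemma rect_id_mult:
  assumes A: "(A :: 'a::comm_ring_1 mat) \<in> carrier_mat n k" and "i < m" "j < k"
  shows "(rect_id m n * A) $$ (i, j) = (if i < n then A $$ (i, j) else 0)"
proof -
  have "(rect_id m n * A) $$ (i, j) = (\<Sum>l = 0..<n. rect_id m n $$ (i, l) * A $$ (l, j))"
    using assms by (simp add: scalar_prod_def rect_id_def)
  also have "\<dots> = (\<Sum>l = 0..<n. if l = i then A $$ (i, j) else 0)"
    using assms by (intro sum.cong) (auto simp: rect_id_def)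
  finally show ?thesis by simp
qed

lemma mult_rect_id:
  assumes A: "(A :: 'a::comm_ring_1 mat) \<in> carrier_mat k m" and "i < k" "j < n"
  shows "(A * rect_id m n) $$ (i, j) = (if j < m then A $$ (i, j) else 0)"
proof -
  have "(A * rect_id m n) $$ (i, j) = (\<Sum>l = 0..<m. A $$ (i, l) * rect_id m n $$ (l, j))"
    using assms by (simp add: scalar_prod_def rect_id_def)
  also have "\<dots> = (\<Sum>l = 0..<m. if l = j then A $$ (i, j) else 0)"
    using assms by (intro sum.cong) (auto simp: rect_id_def)
  finally show ?thesis by simp
qed

text \<open>The diagonal matrix \<open>U * A * V\<close> is supported on the first \<open>k\<close>
  positions and therefore factors through \<open>k\<close> coordinates. \<open>B\<close> and
  \<open>C\<close> absorb the inverses of \<open>U\<close> and \<open>V\<close>; \<open>X\<close>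
  and \<open>Y\<close> restrict to these coordinates, with \<open>X\<close> also dividing by the
  diagonal entries.\<close>

lemma equiv_diag_factorization:
  fixes A :: "'a::field mat"
  assumes A: "A \<in> carrier_mat m n" and U: "unimodular m U" and V: "unimodular n V"
    and off: "\<forall>i<m. \<forall>j<n. i \<noteq> j \<longrightarrow> (U * A * V) $$ (i, j) = 0"
    and supp: "{i. i < min m n \<and> (U * A * V) $$ (i, i) \<noteq> 0} = {..<k}"
  obtains B C X Y where "B \<in> carrier_mat m k" "C \<in> carrier_mat k n"
    "X \<in> carrier_mat k m" "Y \<in> carrier_mat n k" "A = B * C" "X * A * Y = 1\<^sub>m k"
proof -
  let ?S = "U * A * V"
  obtain U' where U': "U \<in> carrier_mat m m" "U' \<in> carrier_mat m m" "U' * U = 1\<^sub>m m"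
    using U by (rule unimodularE)
  obtain V' where V': "V \<in> carrier_mat n n" "V' \<in> carrier_mat n n" "V * V' = 1\<^sub>m n"
    using V by (rule unimodularE)
  have S: "?S \<in> carrier_mat m n" using A U' V' by auto
  have km: "i < m \<and> i < n \<and> ?S $$ (i, i) \<noteq> 0" if "i < k" for i using supp that by auto
  have zero: "?S $$ (i, j) = 0" if "i < m" "j < n" "\<not> (i = j \<and> i < k)" for i j
    using that off supp by (cases "i = j") auto
  define D where "D = mat k k (\<lambda>(i, j). if i = j then inverse (?S $$ (i, i)) else 0)"
  have D: "D \<in> carrier_mat k k" by (simp add: D_def)
  let ?E = "rect_id m k :: 'a mat" and ?F = "rect_id k m :: 'a mat" and ?G = "rect_id n k :: 'a mat"
  have FS: "?F * ?S \<in> carrier_mat k n" by (rule mult_carrier_mat[OF rect_id_carrier S])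
  have EFS: "?E * (?F * ?S) = ?S"
  proof (rule eq_matI)
    fix i j assume "i < dim_row ?S" "j < dim_col ?S"
    then have ij: "i < m" "j < n" using S by auto
    show "(?E * (?F * ?S)) $$ (i, j) = ?S $$ (i, j)"
      unfolding rect_id_mult[OF FS ij] using ij zero[of i j] rect_id_mult[OF S, of i k j] by auto
  qed (use S in \<open>auto simp: rect_id_def\<close>)
  have "D * (?F * ?S) * ?G = 1\<^sub>m k"
  proof (rule eq_matI)
    fix i j assume "i < dim_row (1\<^sub>m k :: 'a mat)" "j < dim_col (1\<^sub>m k :: 'a mat)"
    then have ij: "i < k" "j < k" by auto
    have "(D * (?F * ?S) * ?G) $$ (i, j) = (D * (?F * ?S)) $$ (i, j)"
      using mult_rect_id[OF mult_carrier_mat[OF D FS] ij] km[OF ij(2)] by simp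
    also have "\<dots> = (\<Sum>l<k. D $$ (i, l) * (?F * ?S) $$ (l, j))"
      using ij km[OF ij(2)] by (intro index_mult_mat_sum[OF D FS]) auto
    also have "\<dots> = (\<Sum>l<k. if l = i then inverse (?S $$ (i, i)) * ?S $$ (i, j) else 0)"
    proof (intro sum.cong refl)
      fix l assume "l \<in> {..<k}"
      then show "D $$ (i, l) * (?F * ?S) $$ (l, j)
        = (if l = i then inverse (?S $$ (i, i)) * ?S $$ (i, j) else 0)"
        using ij km[of l] km[OF ij(2)] rect_id_mult[OF S, of l k j] unfolding D_def by auto
    qed
    also have "\<dots> = inverse (?S $$ (i, i)) * ?S $$ (i, j)" using ij by simp
    also have "\<dots> = 1\<^sub>m k $$ (i, j)"
      using ij km[OF ij(1)] km[OF ij(2)] zero[of i j] by (cases "i = j") auto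
    finally show "(D * (?F * ?S) * ?G) $$ (i, j) = 1\<^sub>m k $$ (i, j)" .
  qed (use D in \<open>auto simp: rect_id_def\<close>)
  note DG = this
  have UA: "U * A \<in> carrier_mat m n" using U' A by simp
  have 1: "U' * ?S * V' = A"
  proof -
    have "U' * ?S * V' = U' * (?S * V')" by (rule assoc_mult_mat[OF U'(2) S V'(2)])
    also have "?S * V' = U * A * (V * V')" by (rule assoc_mult_mat[OF UA V'(1,2)])
    also have "\<dots> = U * A" unfolding V'(3) by (rule right_mult_one_mat[OF UA])
    also have "U' * (U * A) = U' * U * A" by (rule assoc_mult_mat[OF U'(2,1) A, symmetric])
    finally show ?thesis using U' A by simp
  qed
  have 2: "A = (U' * ?E) * ((?F * ?S) * V')"
  proof -
    have FSV: "(?F * ?S) * V' \<in> carrier_mat k n" by (rule mult_carrier_mat[OF FS V'(2)])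
    have "(U' * ?E) * ((?F * ?S) * V') = U' * (?E * ((?F * ?S) * V'))"
      by (rule assoc_mult_mat[OF U'(2) rect_id_carrier FSV])
    also have "?E * ((?F * ?S) * V') = (?E * (?F * ?S)) * V'"
      by (rule assoc_mult_mat[OF rect_id_carrier FS V'(2), symmetric])
    also have "U' * \<dots> = U' * ?S * V'" unfolding EFS
      by (rule assoc_mult_mat[OF U'(2) S V'(2), symmetric])
    finally show ?thesis using 1 by simp
  qed
  have 3: "(D * (?F * U)) * A * (V * ?G) = 1\<^sub>m k"
  proof -
    have FU: "?F * U \<in> carrier_mat k m" by (rule mult_carrier_mat[OF rect_id_carrier U'(1)])
    have FUA: "?F * (U * A) \<in> carrier_mat k n" by (rule mult_carrier_mat[OF rect_id_carrier UA])
    have DFUA: "D * (?F * (U * A)) \<in> carrier_mat k n" by (rule mult_carrier_mat[OF D FUA])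
    have "(D * (?F * U)) * A = D * ((?F * U) * A)" by (rule assoc_mult_mat[OF D FU A])
    also have "(?F * U) * A = ?F * (U * A)" by (rule assoc_mult_mat[OF rect_id_carrier U'(1) A])
    finally have "(D * (?F * U)) * A * (V * ?G) = (D * (?F * (U * A))) * V * ?G"
      using assoc_mult_mat[OF DFUA V'(1) rect_id_carrier[of n k]] by simp
    also have "(D * (?F * (U * A))) * V = D * ((?F * (U * A)) * V)"
      by (rule assoc_mult_mat[OF D FUA V'(1)])
    also have "(?F * (U * A)) * V = ?F * ?S" by (rule assoc_mult_mat[OF rect_id_carrier UA V'(1)])
    finally show ?thesis using DG by simp
  qed
  show thesis
    by (rule that[OF mult_carrier_mat[OF U'(2) rect_id_carrier] mult_carrier_mat[OF FS V'(2)]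
          mult_carrier_mat[OF D mult_carrier_mat[OF rect_id_carrier U'(1)]]
          mult_carrier_mat[OF V'(1) rect_id_carrier] 2 3])
qed

lemma rank_equiv_diag:
  fixes A :: "'a::field mat"
  assumes "A \<in> carrier_mat m n" "unimodular m U" "unimodular n V"
    and "\<forall>i<m. \<forall>j<n. i \<noteq> j \<longrightarrow> (U * A * V) $$ (i, j) = 0"
    and "{i. i < min m n \<and> (U * A * V) $$ (i, i) \<noteq> 0} = {..<k}"
  shows "vec_space.rank m A = k"
  by (rule equiv_diag_factorization[OF assms]) (use rank_eqI in blast)+

lemma rank_factorization:
  fixes A :: "'a::field mat"
  assumes A: "A \<in> carrier_mat m n"
  obtains B C X Y where "B \<in> carrier_mat m (vec_space.rank m A)"
    "C \<in> carrier_mat (vec_space.rank m A) n"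
    "X \<in> carrier_mat (vec_space.rank m A) m" "Y \<in> carrier_mat n (vec_space.rank m A)"
    "A = B * C" "X * A * Y = 1\<^sub>m (vec_space.rank m A)"
proof -
  \<comment> \<open>Over a field every division is exact, so the constant size function 0 satisfies
    the division hypothesis of the elimination.\<close>
  have "\<exists>q. a - q * b = 0 \<or> (0::nat) < 0" if "b \<noteq> 0" for a b :: 'a
    using that by (intro exI[of _ "a / b"]) simp
  from smith_diag_exists[of "\<lambda>_. 0", OF this A] obtain U V where
    UV: "unimodular m U" "unimodular n V" "smith_diag m n (U * A * V)"
    unfolding mat_equiv_def by blast
  let ?s = "\<lambda>i. (U * A * V) $$ (i, i) \<noteq> 0"
  have off: "\<forall>i<m. \<forall>j<n. i \<noteq> j \<longrightarrow> (U * A * V) $$ (i, j) = 0"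
    using UV(3) unfolding smith_diag_def by blast
  have "{i. i < min m n \<and> ?s i} = {..<card {i. i < min m n \<and> ?s i}}"
    using UV(3) by (intro down_closed_eq_lessThan) (auto simp: smith_diag_def)
  then obtain k where "{i. i < min m n \<and> ?s i} = {..<k}" by blast
  note fac = A UV(1,2) off this
  show thesis
    by (rule equiv_diag_factorization[OF fac]) (rule that[unfolded rank_equiv_diag[OF fac]])
qed

text \<open>From \<open>A = B * C\<close> and \<open>X * A * Y = 1\<close> the square matrices
  \<open>X * B\<close> and \<open>C * Y\<close> are mutually inverse, so \<open>Y * X\<close> is a
  generalized inverse: \<open>A * (Y * X) * A = A\<close>. The trivial kernel cancels the left
  factor \<open>A\<close>, and \<open>Y * X\<close> becomes a left inverse.\<close>

lemma left_invertibleI_kernel: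
  fixes A :: "'a::field mat"
  assumes A: "A \<in> carrier_mat m n"
    and ker: "\<And>v. v \<in> carrier_vec n \<Longrightarrow> A *\<^sub>v v = 0\<^sub>v m \<Longrightarrow> v = 0\<^sub>v n"
  shows "left_invertible m n A"
proof -
  let ?k = "vec_space.rank m A"
  obtain B C X Y where f: "B \<in> carrier_mat m ?k" "C \<in> carrier_mat ?k n"
    "X \<in> carrier_mat ?k m" "Y \<in> carrier_mat n ?k" "A = B * C" "X * A * Y = 1\<^sub>m ?k"
    by (rule rank_factorization[OF A]) (use that in blast)
  have XB: "X * B \<in> carrier_mat ?k ?k" and CY: "C * Y \<in> carrier_mat ?k ?k" using f by auto
  have "X * A * Y = (X * B) * (C * Y)"
    unfolding f(5) by (rule mult_mat_regroup[OF f(3,1,2,4)])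
  then have "(X * B) * (C * Y) = 1\<^sub>m ?k" using f(6) by simp
  from mat_mult_left_right_inverse[OF XB CY this] have inv: "(C * Y) * (X * B) = 1\<^sub>m ?k" .
  have YX: "Y * X \<in> carrier_mat n m" using f by auto
  let ?Z = "(X * B) * C"
  have Z: "?Z \<in> carrier_mat ?k n" using XB f(2) by simp
  have "(Y * X) * A = Y * (X * B) * C"
    unfolding f(5) by (rule mult_mat_regroup[OF f(4,3,1,2), symmetric])
  also have "\<dots> = Y * ?Z" by (rule assoc_mult_mat[OF f(4) XB f(2)])
  finally have "A * ((Y * X) * A) = (B * C) * (Y * ?Z)" using f(5) by simp
  also have "\<dots> = B * (C * Y) * ?Z" by (rule mult_mat_regroup[OF f(1,2,4) Z, symmetric])
  also have "\<dots> = B * ((C * Y) * ?Z)" by (rule assoc_mult_mat[OF f(1) CY Z])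
  also have "(C * Y) * ?Z = ((C * Y) * (X * B)) * C" by (rule assoc_mult_mat[OF CY XB f(2), symmetric])
  also have "\<dots> = C" unfolding inv using f by simp
  also have "B * C = A" using f(5) by simp
  finally have AYXA: "A * ((Y * X) * A) = A" .
  have YXA: "(Y * X) * A \<in> carrier_mat n n" using YX A by simp
  have "(Y * X) * A = 1\<^sub>m n"
  proof (rule mat_col_eqI)
    fix j assume "j < dim_col (1\<^sub>m n :: 'a mat)"
    then have j: "j < n" by simp
    let ?v = "col ((Y * X) * A) j - col (1\<^sub>m n) j"
    have v: "?v \<in> carrier_vec n" using YXA j by (intro minus_carrier_vec col_carrier_vec) auto
    have "A *\<^sub>v ?v = A *\<^sub>v col ((Y * X) * A) j - A *\<^sub>v col (1\<^sub>m n) j"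
      using A YXA j by (intro mult_minus_distrib_mat_vec[of _ m n] col_carrier_vec) auto
    also have "A *\<^sub>v col ((Y * X) * A) j = col A j"
      using col_mult2[OF A YXA j] AYXA by simp
    also have "A *\<^sub>v col (1\<^sub>m n) j = col A j"
      using col_mult2[OF A one_carrier_mat j] A by simp
    finally have "A *\<^sub>v ?v = 0\<^sub>v m" using A by auto
    from ker[OF v this] have z: "?v = 0\<^sub>v n" .
    show "col (Y * X * A) j = col (1\<^sub>m n) j"
    proof (rule eq_vecI)
      fix i assume i: "i < dim_vec (col (1\<^sub>m n :: 'a mat) j)"
      then have "?v $ i = 0" unfolding z by simp
      then show "col (Y * X * A) j $ i = col (1\<^sub>m n) j $ i" using i YXA by simp
    qed (use YXA in auto)
  qed (use YXA in auto)
  then show ?thesis unfolding left_invertible_def using A YX by blast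
qed

text \<open>Rank \<open>n\<close> through a middle of size \<open>n\<close> leaves no slack: if
  \<open>X * P * Y = 1\<close>, then the square factors \<open>X * A\<close> and
  \<open>K * A^T * Y\<close> are mutually inverse, which shows both properties at once. The
  equivalence is applied at every \<open>\<alpha>\<close> and to the coefficient of
  \<open>\<lambda>^d\<close>, in both inclusions.\<close>

lemma rank_congruence:
  fixes A :: "'a::field mat"
  assumes A: "A \<in> carrier_mat m n" and K: "K \<in> carrier_mat n n"
  shows "vec_space.rank m (A * K * transpose_mat A) = n \<longleftrightarrow> left_invertible m n A \<and> det K \<noteq> 0"
proof
  let ?P = "A * K * transpose_mat A"
  have T: "transpose_mat A \<in> carrier_mat n m" using A by simp
  assume r: "vec_space.rank m ?P = n"
  have P: "?P \<in> carrier_mat m m" using A K by auto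
  obtain X Y where f: "X \<in> carrier_mat n m" "Y \<in> carrier_mat m n" "X * ?P * Y = 1\<^sub>m n"
    by (rule rank_factorization[OF P, unfolded r]) (use that in blast)
  let ?W = "transpose_mat A * Y"
  have W: "?W \<in> carrier_mat n n" and XA: "X * A \<in> carrier_mat n n" using T f A by auto
  have KW: "K * ?W \<in> carrier_mat n n" using K W by simp
  have "X * ?P * Y = (X * A) * ((K * transpose_mat A) * Y)"
    unfolding assoc_mult_mat[OF A K T] using mult_mat_regroup[OF f(1) A mult_carrier_mat[OF K T] f(2)] .
  then have "X * ?P * Y = (X * A) * (K * ?W)" unfolding assoc_mult_mat[OF K T f(2)] .
  then have "(X * A) * (K * ?W) = 1\<^sub>m n" using f by simp
  then have inv: "(K * ?W) * (X * A) = 1\<^sub>m n" using mat_mult_left_right_inverse[OF XA KW] by blast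
  then have "(K * ?W * X) * A = 1\<^sub>m n" using assoc_mult_mat[OF KW f(1) A] by simp
  moreover have "K * ?W * X \<in> carrier_mat n m" using KW f by auto
  ultimately have "left_invertible m n A" unfolding left_invertible_def using A by blast
  moreover have "det K \<noteq> 0"
    using arg_cong[OF inv, of det] det_mult[OF KW XA] det_mult[OF K W] by auto
  ultimately show "left_invertible m n A \<and> det K \<noteq> 0" ..
next
  let ?P = "A * K * transpose_mat A"
  have T: "transpose_mat A \<in> carrier_mat n m" using A by simp
  assume *: "left_invertible m n A \<and> det K \<noteq> 0"
  then obtain X where X: "X \<in> carrier_mat n m" "X * A = 1\<^sub>m n" unfolding left_invertible_def by blast
  have "left_invertible n n K"
    using left_invertibleI_kernel[OF K] det_0_iff_vec_prod_zero_field[OF K] * by blast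
  then obtain K' where K': "K' \<in> carrier_mat n n" "K' * K = 1\<^sub>m n" unfolding left_invertible_def by blast
  have KK': "K * K' = 1\<^sub>m n" using mat_mult_left_right_inverse[OF K'(1) K K'(2)] .
  have AX: "transpose_mat A * transpose_mat X = 1\<^sub>m n"
    using transpose_mult[OF X(1) A] X(2) by simp
  have KA: "K * transpose_mat A \<in> carrier_mat n m" using K T by simp
  have PA: "A * (K * transpose_mat A) = ?P" using assoc_mult_mat[OF A K T] by simp
  have "X * ?P = (X * A) * (K * transpose_mat A)"
    unfolding PA[symmetric] using assoc_mult_mat[OF X(1) A KA] by simp
  also have "\<dots> = K * transpose_mat A" unfolding X(2) by (rule left_mult_one_mat[OF KA])
  finally have "X * ?P * (transpose_mat X * K') = K * transpose_mat A * (transpose_mat X * K')" by simp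
  also have "\<dots> = K * (transpose_mat A * (transpose_mat X * K'))"
    using K T X K' by (intro assoc_mult_mat[of _ n n _ m _ n]) auto
  also have "transpose_mat A * (transpose_mat X * K') = transpose_mat A * transpose_mat X * K'"
    using T X K' by (intro assoc_mult_mat[of _ n m _ n _ n, symmetric]) auto
  also have "\<dots> = K'" using AX K' by simp
  also have "K * K' = 1\<^sub>m n" by (rule KK')
  finally have eq: "X * ?P * (transpose_mat X * K') = 1\<^sub>m n" .
  show "vec_space.rank m ?P = n"
    using rank_eqI[OF A KA X(1), of "transpose_mat X * K'"] eq X K' unfolding PA by auto
qed

subsection \<open>Eigenvalues and rank\<close>

abbreviation eval_mat :: "complex \<Rightarrow> complex poly mat \<Rightarrow> complex mat" where
  "eval_mat \<alpha> \<equiv> map_mat (\<lambda>p. poly p \<alpha>)"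

interpretation eval_hom: comm_ring_hom "\<lambda>p. poly p (\<alpha> :: 'a::comm_ring_1)"
  by unfold_locales auto

interpretation fract_hom: inj_comm_ring_hom "to_fract :: 'a::idom \<Rightarrow> 'a fract"
  by unfold_locales auto

lemma (in comm_ring_hom) unimodular_map_mat:
  assumes "unimodular n U"
  shows "unimodular n (map_mat hom U)"
proof -
  obtain U' where U: "U \<in> carrier_mat n n" "U' \<in> carrier_mat n n" "U * U' = 1\<^sub>m n" "U' * U = 1\<^sub>m n"
    using assms by (rule unimodularE)
  show ?thesis
    by (rule unimodularI[of _ n "map_mat hom U'"])
      (use U in \<open>auto simp: mat_hom_mult[symmetric, of _ n n _ n] mat_hom_one\<close>)
qed

text \<open>Stated for a homomorphism \<open>h\<close> into a field so that the embedding into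
  C(\<lambda>) and the evaluation at a point are both instances. Divisibility is preserved by
  \<open>h\<close>, which keeps the support of the image of the diagonal an initial segment.\<close>

lemma rank_smith_form:
  fixes h :: "complex poly \<Rightarrow> 'b::field"
  assumes h: "comm_ring_hom h" and P: "P \<in> carrier_mat m n" and S: "is_smith_form P S"
  shows "vec_space.rank m (map_mat h P) = card {i. i < min m n \<and> h (S $$ (i, i)) \<noteq> 0}"
proof -
  interpret comm_ring_hom h by (rule h)
  obtain U V where UV: "U \<in> carrier_mat m m" "invertible_mat U" "V \<in> carrier_mat n n"
    "invertible_mat V" "S = U * P * V"
    using S P unfolding is_smith_form_def by auto
  have u: "unimodular m U" "unimodular n V" using UV unimodular_iff_invertible_mat by blast+
  have Sc: "S \<in> carrier_mat m n" using UV P by auto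
  have eq: "map_mat h U * map_mat h P * map_mat h V = map_mat h S"
    using UV(5) mat_hom_mult[OF mult_carrier_mat[OF UV(1) P] UV(3)] mat_hom_mult[OF UV(1) P] by simp
  have off: "\<forall>i<m. \<forall>j<n. i \<noteq> j \<longrightarrow> (map_mat h U * map_mat h P * map_mat h V) $$ (i, j) = 0"
    unfolding eq using S Sc unfolding is_smith_form_def diagonal_mat_def by auto
  have "{i. i < min m n \<and> h (S $$ (i, i)) \<noteq> 0} = {..<card {i. i < min m n \<and> h (S $$ (i, i)) \<noteq> 0}}"
  proof (rule down_closed_eq_lessThan)
    fix i assume "Suc i < min m n" and nz: "h (S $$ (Suc i, Suc i)) \<noteq> 0"
    then have "S $$ (i, i) dvd S $$ (Suc i, Suc i)" using S Sc unfolding is_smith_form_def by auto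
    then show "h (S $$ (i, i)) \<noteq> 0" using nz by (auto simp: dvd_def hom_mult)
  qed
  moreover have "{i. i < min m n \<and> (map_mat h U * map_mat h P * map_mat h V) $$ (i, i) \<noteq> 0}
      = {i. i < min m n \<and> h (S $$ (i, i)) \<noteq> 0}"
    unfolding eq using Sc by auto
  ultimately have supp: "{i. i < min m n \<and> (map_mat h U * map_mat h P * map_mat h V) $$ (i, i) \<noteq> 0}
      = {..<card {i. i < min m n \<and> h (S $$ (i, i)) \<noteq> 0}}" by (rule trans[rotated])
  show ?thesis
    by (rule rank_equiv_diag[OF _ unimodular_map_mat[OF u(1)] unimodular_map_mat[OF u(2)] off supp])
      (use P in simp)
qed

lemma normal_rank_smith_form:
  assumes P: "P \<in> carrier_mat m n" and S: "is_smith_form P S"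
  shows "normal_rank P = card {i. i < min m n \<and> S $$ (i, i) \<noteq> 0}"
  unfolding normal_rank_def
  using rank_smith_form[OF fract_hom.comm_ring_hom_axioms P S] P by simp

lemma rank_eval_smith_form:
  assumes P: "P \<in> carrier_mat m n" and S: "is_smith_form P S"
  shows "vec_space.rank m (eval_mat \<alpha> P) = card {i. i < min m n \<and> poly (S $$ (i, i)) \<alpha> \<noteq> 0}"
  by (rule rank_smith_form[OF eval_hom.comm_ring_hom_axioms P S])

lemma smith_form_carrier: "is_smith_form P S \<Longrightarrow> P \<in> carrier_mat m n \<Longrightarrow> S \<in> carrier_mat m n"
  unfolding is_smith_form_def by auto

lemma rank_eval_less_iff:
  assumes P: "P \<in> carrier_mat m n" and S: "is_smith_form P S"
  shows "vec_space.rank m (eval_mat \<alpha> P) < normal_rank P \<longleftrightarrow>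
    (\<exists>i < min m n. S $$ (i, i) \<noteq> 0 \<and> poly (S $$ (i, i)) \<alpha> = 0)"
proof -
  let ?A = "{i. i < min m n \<and> poly (S $$ (i, i)) \<alpha> \<noteq> 0}"
  let ?B = "{i. i < min m n \<and> S $$ (i, i) \<noteq> 0}"
  have less: "card X < card Y \<longleftrightarrow> X \<noteq> Y" if "finite Y" "X \<subseteq> Y" for X Y :: "nat set"
    using that card_mono[of Y X] card_subset_eq[of Y X] by (auto simp: less_le)
  have "card ?A < card ?B \<longleftrightarrow> ?A \<noteq> ?B" by (rule less) auto
  also have "\<dots> \<longleftrightarrow> (\<exists>i < min m n. S $$ (i, i) \<noteq> 0 \<and> poly (S $$ (i, i)) \<alpha> = 0)"
    by (auto simp: set_eq_iff)
  finally show ?thesis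
    unfolding normal_rank_smith_form[OF assms] rank_eval_smith_form[OF assms] .
qed

text \<open>Invariant polynomials are collected over all Smith forms of \<open>P\<close>. The rank
  at \<open>\<alpha>\<close> refers to none of them, so every Smith form gives the same verdict;
  that one exists gives the direction from a rank drop to an eigenvalue.\<close>

lemma finite_eigenvalue_iff_rank:
  assumes P: "P \<in> carrier_mat m n"
  shows "finite_eigenvalue P \<alpha> \<longleftrightarrow> vec_space.rank m (eval_mat \<alpha> P) < normal_rank P"
proof
  assume "finite_eigenvalue P \<alpha>"
  then obtain S i where "is_smith_form P S" "i < min (dim_row S) (dim_col S)"
    "S $$ (i, i) \<noteq> 0" "poly (S $$ (i, i)) \<alpha> = 0"
    unfolding finite_eigenvalue_def invariant_polys_def by blast
  then show "vec_space.rank m (eval_mat \<alpha> P) < normal_rank P"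
    using rank_eval_less_iff[OF P] smith_form_carrier[OF _ P] by (metis carrier_matD)
next
  assume *: "vec_space.rank m (eval_mat \<alpha> P) < normal_rank P"
  obtain S where S: "is_smith_form P S" using smith_form_exists[OF P] by blast
  then show "finite_eigenvalue P \<alpha>"
    using * rank_eval_less_iff[OF P S] smith_form_carrier[OF S P]
    unfolding finite_eigenvalue_def invariant_polys_def by fastforce
qed

lemma rank_eval_le_normal_rank:
  assumes P: "P \<in> carrier_mat m n"
  shows "vec_space.rank m (eval_mat \<alpha> P) \<le> normal_rank P"
proof -
  obtain S where S: "is_smith_form P S" using smith_form_exists[OF P] by blast
  show ?thesis unfolding normal_rank_smith_form[OF P S] rank_eval_smith_form[OF P S]
    by (intro card_mono) auto
qed

text \<open>Supplies points of generic rank, where a statement about the normal rank becomes one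
  about a constant matrix.\<close>

lemma finite_rank_drop:
  assumes P: "P \<in> carrier_mat m n"
  shows "finite {\<alpha>. vec_space.rank m (eval_mat \<alpha> P) \<noteq> normal_rank P}"
proof -
  obtain S where S: "is_smith_form P S" using smith_form_exists[OF P] by blast
  have "{\<alpha>. vec_space.rank m (eval_mat \<alpha> P) \<noteq> normal_rank P}
    \<subseteq> (\<Union>i \<in> {i. i < min m n \<and> S $$ (i, i) \<noteq> 0}. {\<alpha>. poly (S $$ (i, i)) \<alpha> = 0})"
    using rank_eval_less_iff[OF P S] rank_eval_le_normal_rank[OF P] by (auto simp: less_le)
  moreover have "finite \<dots>" by (auto intro: poly_roots_finite)
  ultimately show ?thesis by (rule finite_subset)
qed

section \<open>Degrees, reversal and the point at infinity\<close>

lemma degree_le_iff_coeff: "degree p \<le> d \<longleftrightarrow> (\<forall>k>d. coeff p k = 0)"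
  by (metis coeff_eq_0 degree_le leD le_less_trans not_le)

lemma mat_degree_le_iff:
  assumes "P \<in> carrier_mat m n"
  shows "mat_degree P \<le> d \<longleftrightarrow> (\<forall>i<m. \<forall>j<n. degree (P $$ (i, j)) \<le> d)"
proof -
  have "mat_degree P \<le> d \<longleftrightarrow> (\<forall>k. mat_coeff P k \<noteq> 0\<^sub>m (dim_row P) (dim_col P) \<longrightarrow> k \<le> d)"
    unfolding mat_degree_def using finite_mat_coeff_nonzero[of P] by (subst Max_le_iff) auto
  also have "\<dots> \<longleftrightarrow> (\<forall>k>d. \<forall>i<m. \<forall>j<n. coeff (P $$ (i, j)) k = 0)"
    using assms by (auto simp: mat_eq_iff mat_coeff_def not_le[symmetric])
  finally show ?thesis unfolding degree_le_iff_coeff by blast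
qed

lemma vec_degree_le_iff:
  "vec_degree v \<le> d \<longleftrightarrow> (\<forall>i<dim_vec v. degree (v $ i) \<le> d)"
proof -
  have "vec_degree v \<le> d \<longleftrightarrow> (\<forall>k. vec_coeff v k \<noteq> 0\<^sub>v (dim_vec v) \<longrightarrow> k \<le> d)"
    unfolding vec_degree_def using finite_vec_coeff_nonzero[of v] by (subst Max_le_iff) auto
  also have "\<dots> \<longleftrightarrow> (\<forall>k>d. \<forall>i<dim_vec v. coeff (v $ i) k = 0)"
    by (auto simp: vec_eq_iff vec_coeff_def not_le[symmetric])
  finally show ?thesis unfolding degree_le_iff_coeff by blast
qed

lemma degree_le_vec_degree:
  assumes "L \<in> carrier_mat m n" "i < m" "j < n"
  shows "degree (L $$ (i, j)) \<le> vec_degree (col L j)"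
  using vec_degree_le_iff[of "col L j" "vec_degree (col L j)"] assms by auto

lemma rank_smult_le:
  fixes A :: "'a::field mat"
  assumes A: "A \<in> carrier_mat m n"
  shows "vec_space.rank m (c \<cdot>\<^sub>m A) \<le> vec_space.rank m A"
proof -
  obtain B C where BC: "B \<in> carrier_mat m (vec_space.rank m A)"
    "C \<in> carrier_mat (vec_space.rank m A) n" "A = B * C"
    by (rule rank_factorization[OF A]) (use that in blast)
  have "c \<cdot>\<^sub>m A = (c \<cdot>\<^sub>m B) * C" using BC by (metis mult_smult_assoc_mat)
  then show ?thesis using rank_le_inner[of "c \<cdot>\<^sub>m B" m _ C n] BC by (metis smult_carrier_mat)
qed

lemma rank_smult:
  fixes A :: "'a::field mat"
  assumes A: "A \<in> carrier_mat m n" and c: "c \<noteq> 0"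
  shows "vec_space.rank m (c \<cdot>\<^sub>m A) = vec_space.rank m A"
proof -
  have "inverse c \<cdot>\<^sub>m (c \<cdot>\<^sub>m A) = A" using c A by (intro eq_matI) auto
  then show ?thesis
    using rank_smult_le[OF A, of c] rank_smult_le[of "c \<cdot>\<^sub>m A" m n "inverse c"] A
    by (metis le_antisym smult_carrier_mat)
qed

lemma eval_rev_mat:
  assumes P: "P \<in> carrier_mat m n" and deg: "\<forall>i<m. \<forall>j<n. degree (P $$ (i, j)) \<le> d" and "\<alpha> \<noteq> 0"
  shows "eval_mat \<alpha> (rev_mat d P) = \<alpha> ^ d \<cdot>\<^sub>m eval_mat (1 / \<alpha>) P"
  by (rule eq_matI) (use assms in \<open>auto simp: rev_mat_def poly_rev_poly\<close>)

text \<open>Here an eigenvalue at infinity becomes a rank drop of a constant matrix, the coefficient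
  of \<open>\<lambda>^d\<close>.\<close>

lemma eval_rev_mat_0: "eval_mat 0 (rev_mat d P) = mat_coeff P d"
proof -
  have "poly (rev_poly d p) 0 = coeff p d" for p
  proof -
    have "poly (rev_poly d p) 0 = (\<Sum>i\<le>d. if i = d then coeff p d else 0)"
      unfolding rev_poly_def poly_sum by (intro sum.cong) (auto simp: poly_monom)
    then show ?thesis by simp
  qed
  then show ?thesis unfolding rev_mat_def mat_coeff_def by (intro eq_matI) auto
qed

text \<open>Outside a finite set of points, \<open>\<alpha>\<close> is generic for the reversal and
  \<open>1 / \<alpha>\<close> for \<open>P\<close>, and there the two matrices differ only by the
  nonzero scalar \<open>\<alpha> ^ d\<close>.\<close>

lemma normal_rank_rev_mat:
  assumes P: "P \<in> carrier_mat m n" and deg: "\<forall>i<m. \<forall>j<n. degree (P $$ (i, j)) \<le> d"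
  shows "normal_rank (rev_mat d P) = normal_rank P"
proof -
  let ?R = "rev_mat d P"
  have R: "?R \<in> carrier_mat m n" using P by (simp add: rev_mat_def)
  let ?F = "\<lambda>P. {\<alpha>. vec_space.rank m (eval_mat \<alpha> P) \<noteq> normal_rank P}"
  have "finite (?F ?R \<union> (\<lambda>x. 1 / x) ` ?F P \<union> {0})"
    using finite_rank_drop[OF P] finite_rank_drop[OF R] by blast
  then obtain \<alpha> :: complex where \<alpha>: "\<alpha> \<notin> ?F ?R \<union> (\<lambda>x. 1 / x) ` ?F P \<union> {0}"
    by (meson ex_new_if_finite infinite_UNIV_char_0)
  have "1 / \<alpha> \<notin> ?F P"
  proof
    assume "1 / \<alpha> \<in> ?F P"
    then have "1 / (1 / \<alpha>) \<in> (\<lambda>x. 1 / x) ` ?F P" by (rule imageI)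
    then show False using \<alpha> by auto
  qed
  then have "normal_rank P = vec_space.rank m (eval_mat (1 / \<alpha>) P)" by simp
  also have "\<dots> = vec_space.rank m (eval_mat \<alpha> ?R)"
    using eval_rev_mat[OF P deg, of \<alpha>] \<alpha> rank_smult[of "eval_mat (1 / \<alpha>) P" m n "\<alpha> ^ d"] P by simp
  also have "\<dots> = normal_rank ?R" using \<alpha> by simp
  finally show ?thesis ..
qed

lemma rank_zero_mat: "vec_space.rank m (0\<^sub>m m n :: 'a::field mat) = 0"
  using rank_le_inner[of "0\<^sub>m m 0 :: 'a mat" m 0 "0\<^sub>m 0 n" n] by simp

text \<open>Since ranks never exceed the normal rank, absence of eigenvalues means equality
  everywhere. The normal rank itself is recovered at a point that attains it, and
  \<open>0 < k\<close> makes a coefficient of rank \<open>k\<close> nonzero, which forces the degree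
  to be exactly \<open>d\<close>.\<close>

lemma POL_ss_neig_iff:
  assumes k: "0 < k"
  shows "P \<in> POL_ss_neig d k m \<longleftrightarrow> P \<in> carrier_mat m m \<and> transpose_mat P = - P \<and>
    (\<forall>i<m. \<forall>j<m. degree (P $$ (i, j)) \<le> d) \<and>
    (\<forall>\<alpha>. vec_space.rank m (eval_mat \<alpha> P) = k) \<and> vec_space.rank m (mat_coeff P d) = k"
    (is "?l \<longleftrightarrow> ?r")
proof (cases "P \<in> carrier_mat m m \<and> transpose_mat P = - P \<and> (\<forall>i<m. \<forall>j<m. degree (P $$ (i, j)) \<le> d)")
  case True
  then have P: "P \<in> carrier_mat m m" and sk: "transpose_mat P = - P"
    and deg: "\<forall>i<m. \<forall>j<m. degree (P $$ (i, j)) \<le> d" by auto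
  let ?rk = "vec_space.rank m"
  have R: "rev_mat d P \<in> carrier_mat m m" using P by (simp add: rev_mat_def)
  have skew: "transpose_mat (mat_coeff P i) = - mat_coeff P i" for i
  proof (rule eq_matI)
    fix a b assume "a < dim_row (- mat_coeff P i)" "b < dim_col (- mat_coeff P i)"
    then have ab: "a < m" "b < m" using P by (auto simp: mat_coeff_def)
    have "P $$ (b, a) = - P $$ (a, b)"
      using arg_cong[OF sk, of "\<lambda>X. X $$ (a, b)"] P ab by simp
    then show "transpose_mat (mat_coeff P i) $$ (a, b) = (- mat_coeff P i) $$ (a, b)"
      using P ab by (simp add: mat_coeff_def)
  qed (use P in \<open>auto simp: mat_coeff_def\<close>)
  have noeig: "no_eigenvalues d P \<longleftrightarrow>
    (\<forall>\<alpha>. ?rk (eval_mat \<alpha> P) = normal_rank P) \<and> ?rk (mat_coeff P d) = normal_rank P"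
    unfolding no_eigenvalues_def infinite_eigenvalue_def finite_eigenvalue_iff_rank[OF P]
      finite_eigenvalue_iff_rank[OF R] normal_rank_rev_mat[OF P deg]
    using rank_eval_le_normal_rank[OF P] rank_eval_le_normal_rank[OF R, of 0]
    unfolding normal_rank_rev_mat[OF P deg] eval_rev_mat_0 by (metis nat_less_le)
  have mdeg: "mat_degree P = d" if "?rk (mat_coeff P d) = k"
  proof -
    have "mat_coeff P d \<noteq> 0\<^sub>m m m" using that k rank_zero_mat[of m m, where ?'a = complex] by auto
    then have "d \<in> insert 0 {k. mat_coeff P k \<noteq> 0\<^sub>m (dim_row P) (dim_col P)}" using P by simp
    then have "d \<le> mat_degree P"
      unfolding mat_degree_def using finite_mat_coeff_nonzero[of P] by (intro Max_ge) auto
    then show ?thesis using mat_degree_le_iff[OF P, of d] deg by simp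
  qed
  have gen: "normal_rank P = k" if "\<forall>\<alpha>. ?rk (eval_mat \<alpha> P) = k"
  proof -
    obtain \<alpha> where "?rk (eval_mat \<alpha> P) = normal_rank P"
      using ex_new_if_finite[OF infinite_UNIV_char_0 finite_rank_drop[OF P]] by auto
    then show ?thesis using that by simp
  qed
  show ?thesis
    unfolding POL_ss_neig_def POL_ss_def
    using P sk deg skew mat_degree_le_iff[OF P, of d]
    by (simp add: noeig) (metis gen mdeg le_refl)
next
  case False
  have "\<not> ?l"
  proof
    assume l: ?l
    then have P: "P \<in> carrier_mat m m" and sk: "\<And>i. transpose_mat (mat_coeff P i) = - mat_coeff P i"
      and deg: "mat_degree P \<le> d" unfolding POL_ss_neig_def POL_ss_def by auto
    have "transpose_mat P = - P"
    proof (rule eq_matI)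
      fix a b assume "a < dim_row (- P)" "b < dim_col (- P)"
      then have ab: "a < m" "b < m" using P by auto
      have "coeff (P $$ (b, a)) i = - coeff (P $$ (a, b)) i" for i
        using arg_cong[OF sk[of i], of "\<lambda>X. X $$ (a, b)"] P ab by (simp add: mat_coeff_def)
      then show "transpose_mat P $$ (a, b) = (- P) $$ (a, b)"
        using P ab by (simp add: poly_eq_iff)
    qed (use P in auto)
    then show False using False P deg mat_degree_le_iff[OF P] by blast
  qed
  then show ?thesis using False by blast
qed

subsection \<open>Column degrees\<close>

text \<open>Here \<open>e\<close> is meant as a prescribed bound for the column degrees, which need
  not be attained. A column below its bound contributes a zero column, so injectivity of this matrix
  also certifies that the bounds are sharp.\<close>

definition lead_mat :: "(nat \<Rightarrow> nat) \<Rightarrow> complex poly mat \<Rightarrow> complex mat" where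
  "lead_mat e L = mat (dim_row L) (dim_col L) (\<lambda>(i, j). coeff (L $$ (i, j)) (e j))"

abbreviation col_degree :: "complex poly mat \<Rightarrow> nat \<Rightarrow> nat" where
  "col_degree L j \<equiv> vec_degree (col L j)"

lemma lead_mat_carrier: "L \<in> carrier_mat m n \<Longrightarrow> lead_mat e L \<in> carrier_mat m n"
  by (auto simp: lead_mat_def)

lemma coeff_mult_degree_bounds:
  fixes p q :: "'a::comm_semiring_0 poly"
  assumes "degree p \<le> a" "degree q \<le> b"
  shows "coeff (p * q) (a + b) = coeff p a * coeff q b"
proof -
  have "coeff (p * q) (a + b) = (\<Sum>i\<le>a + b. coeff p i * coeff q (a + b - i))"
    by (rule coeff_mult)
  also have "\<dots> = (\<Sum>i\<le>a + b. if i = a then coeff p a * coeff q b else 0)"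
  proof (intro sum.cong refl)
    fix i assume "i \<in> {..a + b}"
    show "coeff p i * coeff q (a + b - i) = (if i = a then coeff p a * coeff q b else 0)"
    proof (cases i a rule: linorder_cases)
      case less
      then show ?thesis using assms by (simp add: coeff_eq_0)
    next
      case greater
      then show ?thesis using assms by (simp add: coeff_eq_0)
    qed simp
  qed
  finally show ?thesis by simp
qed

lemma index_mult_mat_vec_sum:
  assumes "A \<in> carrier_mat m n" "v \<in> carrier_vec n" "i < m"
  shows "(A *\<^sub>v v) $ i = (\<Sum>j<n. A $$ (i, j) * v $ j)"
  using assms by (auto simp: mult_mat_vec_def scalar_prod_def atLeast0LessThan intro!: sum.cong)

text \<open>Forney's predictable degree property: leading terms cannot cancel. Let \<open>D\<close>
  be the largest \<open>e j + degree (x $ j)\<close> over the nonzero components. The coefficients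
  of \<open>x\<close> at weight \<open>D\<close> form a nonzero constant vector \<open>y\<close>,
  and the coefficient of \<open>\<lambda>^D\<close> in \<open>L *\<^sub>v x\<close> is
  \<open>lead_mat e L *\<^sub>v y\<close>.\<close>

lemma predictable_degree:
  assumes L: "L \<in> carrier_mat m n" and e: "\<forall>i<m. \<forall>j<n. degree (L $$ (i, j)) \<le> e j"
    and inj: "left_invertible m n (lead_mat e L)"
    and x: "x \<in> carrier_vec n" and j: "j < n" "x $ j \<noteq> 0"
  shows "\<exists>i<m. (L *\<^sub>v x) $ i \<noteq> 0 \<and> e j + degree (x $ j) \<le> degree ((L *\<^sub>v x) $ i)"
proof -
  let ?J = "{j. j < n \<and> x $ j \<noteq> 0}"
  let ?g = "\<lambda>j. e j + degree (x $ j)"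
  define D where "D = Max (?g ` ?J)"
  have fin: "finite (?g ` ?J)" "?g ` ?J \<noteq> {}" using j by auto
  have D_ge: "?g k \<le> D" if "k < n" "x $ k \<noteq> 0" for k
    unfolding D_def using that fin by (intro Max_ge) auto
  obtain k where k: "k < n" "x $ k \<noteq> 0" "D = ?g k"
    using Max_in[OF fin] unfolding D_def by auto
  define y where "y = vec n (\<lambda>j. if e j \<le> D then coeff (x $ j) (D - e j) else 0)"
  have y: "y \<in> carrier_vec n" by (simp add: y_def)
  have "y $ k = lead_coeff (x $ k)" using k by (simp add: y_def)
  then have "y \<noteq> 0\<^sub>v n" using k by auto
  then have "lead_mat e L *\<^sub>v y \<noteq> 0\<^sub>v m" using left_invertible_kernel[OF inj y] by blast
  then obtain i where i: "i < m" "(lead_mat e L *\<^sub>v y) $ i \<noteq> 0"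
    using lead_mat_carrier[OF L, of e] by (metis dim_mult_mat_vec carrier_matD(1) eq_vecI index_zero_vec)
  have "coeff ((L *\<^sub>v x) $ i) D = (\<Sum>j<n. coeff (L $$ (i, j) * x $ j) D)"
    unfolding index_mult_mat_vec_sum[OF L x i(1)] by (simp add: coeff_sum)
  also have "\<dots> = (\<Sum>j<n. lead_mat e L $$ (i, j) * y $ j)"
  proof (intro sum.cong refl)
    fix j assume "j \<in> {..<n}"
    then have j: "j < n" by simp
    show "coeff (L $$ (i, j) * x $ j) D = lead_mat e L $$ (i, j) * y $ j"
    proof (cases "x $ j = 0")
      case True
      then show ?thesis using j by (simp add: y_def)
    next
      case False
      then have "e j + degree (x $ j) \<le> D" using D_ge j by blast
      then show ?thesis
        using coeff_mult_degree_bounds[of "L $$ (i, j)" "e j" "x $ j" "D - e j"] e i(1) j L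
        by (simp add: y_def lead_mat_def)
    qed
  qed
  also have "\<dots> = (lead_mat e L *\<^sub>v y) $ i"
    using index_mult_mat_vec_sum[OF lead_mat_carrier[OF L] y i(1)] by simp
  finally have nz: "coeff ((L *\<^sub>v x) $ i) D \<noteq> 0" using i by simp
  then have "(L *\<^sub>v x) $ i \<noteq> 0" by (metis coeff_0)
  moreover have "e j + degree (x $ j) \<le> degree ((L *\<^sub>v x) $ i)"
    using le_degree[OF nz] D_ge[OF j] by simp
  ultimately show ?thesis using i(1) by blast
qed

section \<open>Leading coefficients of congruences and lowering of column degrees\<close>

lemma index_congruence_sum:
  assumes M: "M \<in> carrier_mat m n" and K: "K \<in> carrier_mat n n" and ab: "a < m" "b < m"
  shows "(M * K * transpose_mat M) $$ (a, b)
    = (\<Sum>i<n. \<Sum>j<n. M $$ (a, i) * K $$ (i, j) * (M $$ (b, j) :: 'a::comm_ring_1))"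
proof -
  have MK: "M * K \<in> carrier_mat m n" by (rule mult_carrier_mat[OF M K])
  have T: "transpose_mat M \<in> carrier_mat n m" using M by simp
  have "(M * K * transpose_mat M) $$ (a, b) = (\<Sum>j<n. (M * K) $$ (a, j) * M $$ (b, j))"
    unfolding index_mult_mat_sum[OF MK T ab] using M ab by (intro sum.cong) auto
  also have "\<dots> = (\<Sum>j<n. \<Sum>i<n. M $$ (a, i) * K $$ (i, j) * M $$ (b, j))"
    using index_mult_mat_sum[OF M K ab(1)] by (simp add: sum_distrib_right)
  finally show ?thesis by (subst sum.swap)
qed

text \<open>In each summand of the congruence the three degree bounds add up to at most
  \<open>D\<close>, so its coefficient at \<open>D\<close> is a product of coefficients taken at the
  bounds. The guard \<open>e i + e j \<le> D\<close> lets a nonzero entry of the middle matrix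
  testify to this inequality, which is used when a permutation is extracted from its
  determinant.\<close>

lemma mat_coeff_congruence:
  assumes M: "M \<in> carrier_mat m n" and K: "K \<in> carrier_mat n n"
    and e: "\<forall>i<m. \<forall>j<n. degree (M $$ (i, j)) \<le> e j"
    and D: "\<forall>i<n. \<forall>j<n. K $$ (i, j) \<noteq> 0 \<longrightarrow> e i + e j + degree (K $$ (i, j)) \<le> D"
  shows "mat_coeff (M * K * transpose_mat M) D = lead_mat e M *
    mat n n (\<lambda>(i, j). if e i + e j \<le> D then coeff (K $$ (i, j)) (D - e i - e j) else 0) *
    transpose_mat (lead_mat e M)" (is "_ = _ * ?K * _")
proof (rule eq_matI)
  have l: "lead_mat e M \<in> carrier_mat m n" by (rule lead_mat_carrier[OF M])
  have K': "?K \<in> carrier_mat n n" by simp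
  fix a b assume "a < dim_row (lead_mat e M * ?K * transpose_mat (lead_mat e M))"
    "b < dim_col (lead_mat e M * ?K * transpose_mat (lead_mat e M))"
  then have ab: "a < m" "b < m" using l by auto
  have summand: "coeff (M $$ (a, i) * K $$ (i, j) * M $$ (b, j)) D
      = lead_mat e M $$ (a, i) * ?K $$ (i, j) * lead_mat e M $$ (b, j)" if ij: "i < n" "j < n" for i j
  proof (cases "K $$ (i, j) = 0")
    case True
    then show ?thesis using ij by simp
  next
    case False
    then have le: "e i + e j + degree (K $$ (i, j)) \<le> D" using D ij by blast
    let ?k = "D - e i - e j"
    have 1: "coeff (M $$ (a, i) * K $$ (i, j)) (e i + ?k) = coeff (M $$ (a, i)) (e i) * coeff (K $$ (i, j)) ?k"
      using e ab ij le by (intro coeff_mult_degree_bounds) auto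
    have "degree (M $$ (a, i) * K $$ (i, j)) \<le> e i + ?k"
      using degree_mult_le[of "M $$ (a, i)" "K $$ (i, j)"] e[rule_format, OF ab(1) ij(1)] le by linarith
    then have "coeff (M $$ (a, i) * K $$ (i, j) * M $$ (b, j)) (e i + ?k + e j)
      = coeff (M $$ (a, i) * K $$ (i, j)) (e i + ?k) * coeff (M $$ (b, j)) (e j)"
      using e ab ij by (intro coeff_mult_degree_bounds) auto
    moreover have "e i + ?k + e j = D" using le by simp
    ultimately show ?thesis using 1 M ab ij le by (simp add: lead_mat_def)
  qed
  have "mat_coeff (M * K * transpose_mat M) D $$ (a, b) = coeff ((M * K * transpose_mat M) $$ (a, b)) D"
    using M ab by (simp add: mat_coeff_def)
  also have "\<dots> = (\<Sum>i<n. \<Sum>j<n. lead_mat e M $$ (a, i) * ?K $$ (i, j) * lead_mat e M $$ (b, j))"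
    unfolding index_congruence_sum[OF M K ab] coeff_sum using summand by (intro sum.cong refl) auto
  also have "\<dots> = (lead_mat e M * ?K * transpose_mat (lead_mat e M)) $$ (a, b)"
    by (rule index_congruence_sum[OF l K' ab, symmetric])
  finally show "mat_coeff (M * K * transpose_mat M) D $$ (a, b)
    = (lead_mat e M * ?K * transpose_mat (lead_mat e M)) $$ (a, b)" .
qed (use M in \<open>auto simp: mat_coeff_def lead_mat_def\<close>)

text \<open>As \<open>p $ i = 1\<close>, the relation can be solved for column \<open>i\<close> of
  \<open>L\<close>: it is \<open>q\<close> times \<open>w\<close> minus a combination of the other
  columns. \<open>E\<close> has determinant \<open>q\<close>, so it need not be unimodular.\<close>

lemma replace_column:
  fixes L :: "'a::comm_ring_1 mat"
  assumes L: "L \<in> carrier_mat m n" and i: "i < n" and w: "w \<in> carrier_vec m"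
    and p: "p \<in> carrier_vec n" "p $ i = 1" and eq: "L *\<^sub>v p = q \<cdot>\<^sub>v w"
  obtains E where "E \<in> carrier_mat n n"
    "L = mat m n (\<lambda>(a, j). if j = i then w $ a else L $$ (a, j)) * E"
proof -
  define L' where "L' = mat m n (\<lambda>(a, j). if j = i then w $ a else L $$ (a, j))"
  define E where "E = mat n n (\<lambda>(k, j). if j = i then (if k = i then q else - p $ k)
    else if k = j then 1 else 0)"
  have L': "L' \<in> carrier_mat m n" and E: "E \<in> carrier_mat n n" by (auto simp: L'_def E_def)
  have "L = L' * E"
  proof (rule eq_matI)
    fix a j assume "a < dim_row (L' * E)" "j < dim_col (L' * E)"
    then have aj: "a < m" "j < n" using L' E by auto
    have "(L' * E) $$ (a, j) = (\<Sum>k<n. L' $$ (a, k) * E $$ (k, j))"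
      by (rule index_mult_mat_sum[OF L' E aj])
    also have "\<dots> = L $$ (a, j)"
    proof (cases "j = i")
      case False
      have "(\<Sum>k<n. L' $$ (a, k) * E $$ (k, j)) = (\<Sum>k<n. if k = j then L $$ (a, j) else 0)"
        using False aj by (intro sum.cong) (auto simp: L'_def E_def)
      then show ?thesis using aj by simp
    next
      case True
      have "q * w $ a = (\<Sum>k<n. L $$ (a, k) * p $ k)"
        using arg_cong[OF eq, of "\<lambda>v. v $ a"] index_mult_mat_vec_sum[OF L p(1) aj(1)] w aj by simp
      also have "\<dots> = L $$ (a, i) + (\<Sum>k\<in>{..<n} - {i}. L $$ (a, k) * p $ k)"
        using i p(2) by (subst sum.remove[of _ i]) auto
      finally have qw: "q * w $ a = L $$ (a, i) + (\<Sum>k\<in>{..<n} - {i}. L $$ (a, k) * p $ k)" .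
      have "(\<Sum>k<n. L' $$ (a, k) * E $$ (k, j))
        = w $ a * q + (\<Sum>k\<in>{..<n} - {i}. L' $$ (a, k) * E $$ (k, j))"
        using i True aj by (subst sum.remove[of _ i]) (auto simp: L'_def E_def)
      also have "(\<Sum>k\<in>{..<n} - {i}. L' $$ (a, k) * E $$ (k, j))
        = (\<Sum>k\<in>{..<n} - {i}. - (L $$ (a, k) * p $ k))"
        using True aj by (intro sum.cong) (auto simp: L'_def E_def)
      finally show ?thesis using qw True by (simp add: sum_negf mult.commute)
    qed
    finally show "L $$ (a, j) = (L' * E) $$ (a, j)" by simp
  qed (use L L' E in auto)
  then show thesis using that[OF E] unfolding L'_def by blast
qed

text \<open>The two ways in which a polynomial basis can fail to be minimal: a combination of columns of
  maximal degree \<open>e i\<close> either is divisible by a linear factor or has a vanishing leading term.\<close>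

lemma column_degree_drop:
  assumes L: "L \<in> carrier_mat m n"
    and fail: "\<not> (\<forall>\<alpha>. left_invertible m n (eval_mat \<alpha> L)) \<or> \<not> left_invertible m n (lead_mat (col_degree L) L)"
  obtains i p q w where "i < n" "p \<in> carrier_vec n" "p $ i = 1" "w \<in> carrier_vec m"
    "L *\<^sub>v p = q \<cdot>\<^sub>v w" "\<forall>a<m. w $ a = 0 \<or> degree (w $ a) < col_degree L i"
proof -
  let ?e = "col_degree L"
  have e: "degree (L $$ (a, j)) \<le> ?e j" if "a < m" "j < n" for a j
    by (rule degree_le_vec_degree[OF L that])
  have pick: "\<exists>i<n. c $ i \<noteq> 0 \<and> (\<forall>j<n. c $ j \<noteq> 0 \<longrightarrow> ?e j \<le> ?e i)"
    if c: "c \<in> carrier_vec n" "c \<noteq> 0\<^sub>v n" for c :: "complex vec"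
  proof -
    let ?J = "{j. j < n \<and> c $ j \<noteq> 0}"
    have "?J \<noteq> {}" using c by (auto simp: vec_eq_iff)
    then have ne: "finite (?e ` ?J)" "?e ` ?J \<noteq> {}" by auto
    from Max_in[OF this] obtain i where i: "i \<in> ?J" "Max (?e ` ?J) = ?e i" by auto
    have "?e j \<le> ?e i" if "j < n" "c $ j \<noteq> 0" for j
      unfolding i(2)[symmetric] using that ne by (intro Max_ge) auto
    then show ?thesis using i by blast
  qed
  show thesis
  proof (cases "left_invertible m n (lead_mat ?e L)")
    case True
    then obtain \<alpha> where "\<not> left_invertible m n (eval_mat \<alpha> L)" using fail by blast
    moreover have Lc: "eval_mat \<alpha> L \<in> carrier_mat m n" using L by simp
    ultimately obtain c where c: "c \<in> carrier_vec n" "c \<noteq> 0\<^sub>v n" "eval_mat \<alpha> L *\<^sub>v c = 0\<^sub>v m"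
      using left_invertibleI_kernel[OF Lc] by blast
    obtain i where i: "i < n" "c $ i \<noteq> 0" "\<And>j. j < n \<Longrightarrow> c $ j \<noteq> 0 \<Longrightarrow> ?e j \<le> ?e i"
      using pick[OF c(1,2)] by blast
    \<comment> \<open>Column \<open>i\<close> has the largest degree among those that occur, so the
      combination has degree at most \<open>?e i\<close>, and dividing it by \<lambda> - \<alpha>
      gets strictly below.\<close>
    define p where "p = vec n (\<lambda>j. [:c $ j / c $ i:])"
    have p: "p \<in> carrier_vec n" by (simp add: p_def)
    have root: "[:- \<alpha>, 1:] dvd (L *\<^sub>v p) $ a" if a: "a < m" for a
    proof -
      have "poly ((L *\<^sub>v p) $ a) \<alpha> = (\<Sum>j<n. poly (L $$ (a, j)) \<alpha> * (c $ j / c $ i))"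
        unfolding index_mult_mat_vec_sum[OF L p a] poly_sum by (intro sum.cong) (auto simp: p_def)
      also have "\<dots> = (\<Sum>j<n. eval_mat \<alpha> L $$ (a, j) * c $ j) / c $ i"
        using L a by (simp add: sum_divide_distrib)
      also have "\<dots> = 0" using index_mult_mat_vec_sum[OF Lc c(1) a] c(3) a by simp
      finally show ?thesis by (simp add: poly_eq_0_iff_dvd)
    qed
    define w where "w = vec m (\<lambda>a. (L *\<^sub>v p) $ a div [:- \<alpha>, 1:])"
    have w: "w \<in> carrier_vec m" by (simp add: w_def)
    have wa: "(L *\<^sub>v p) $ a = [:- \<alpha>, 1:] * w $ a" if "a < m" for a
      using root[OF that] that by (simp only: w_def index_vec dvd_mult_div_cancel)
    have eq: "L *\<^sub>v p = [:- \<alpha>, 1:] \<cdot>\<^sub>v w"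
      by (rule eq_vecI) (use L wa w in auto)
    have "w $ a = 0 \<or> degree (w $ a) < ?e i" if a: "a < m" for a
    proof (rule disjCI)
      assume nz: "\<not> degree (w $ a) < ?e i"
      have "degree ((L *\<^sub>v p) $ a) \<le> ?e i"
        unfolding index_mult_mat_vec_sum[OF L p a]
      proof (intro degree_sum_le)
        fix j assume "j \<in> {..<n}"
        then have j: "j < n" by simp
        show "degree (L $$ (a, j) * p $ j) \<le> ?e i"
        proof (cases "c $ j = 0")
          case False
          have "degree (L $$ (a, j) * p $ j) \<le> degree (L $$ (a, j)) + degree (p $ j)"
            by (rule degree_mult_le)
          also have "\<dots> \<le> ?e i" using e[OF a j] i(3)[OF j False] j by (simp add: p_def)
          finally show ?thesis .
        qed (use j in \<open>simp add: p_def\<close>)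
      qed simp
      then show "w $ a = 0"
        using nz wa[OF a] degree_mult_eq[of "[:- \<alpha>, 1:]" "w $ a"] by (cases "w $ a = 0") auto
    qed
    then show thesis using that[OF i(1) p _ w eq] i by (simp add: p_def pCons_one)
  next
    case False
    have Lc: "lead_mat ?e L \<in> carrier_mat m n" by (rule lead_mat_carrier[OF L])
    obtain c where c: "c \<in> carrier_vec n" "c \<noteq> 0\<^sub>v n" "lead_mat ?e L *\<^sub>v c = 0\<^sub>v m"
      using left_invertibleI_kernel[OF Lc] False by blast
    obtain i where i: "i < n" "c $ i \<noteq> 0" "\<And>j. j < n \<Longrightarrow> c $ j \<noteq> 0 \<Longrightarrow> ?e j \<le> ?e i"
      using pick[OF c(1,2)] by blast
    \<comment> \<open>The shifts by \<open>?e i - ?e j\<close> lift all columns that occur to degree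
      \<open>?e i\<close>; the leading terms then add up to a multiple of
      \<open>lead_mat ?e L *\<^sub>v c = 0\<close>.\<close>
    define p where "p = vec n (\<lambda>j. monom (c $ j / c $ i) (?e i - ?e j))"
    have p: "p \<in> carrier_vec n" by (simp add: p_def)
    have bound: "degree (L $$ (a, j) * p $ j) \<le> ?e i
        \<and> coeff (L $$ (a, j) * p $ j) (?e i) = coeff (L $$ (a, j)) (?e j) * (c $ j / c $ i)"
      if a: "a < m" and j: "j < n" for a j
    proof (cases "c $ j = 0")
      case False
      have dp: "degree (p $ j) \<le> ?e i - ?e j" using j by (simp add: p_def degree_monom_le)
      have le: "?e j \<le> ?e i" by (rule i(3)[OF j False])
      have "degree (L $$ (a, j) * p $ j) \<le> ?e i"
        using degree_mult_le[of "L $$ (a, j)" "p $ j"] e[OF a j] dp le by linarith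
      then show ?thesis
        using coeff_mult_degree_bounds[OF e[OF a j] dp] le j by (simp add: p_def)
    qed (use j in \<open>simp add: p_def\<close>)
    have w: "L *\<^sub>v p \<in> carrier_vec m" using L p by simp
    have "(L *\<^sub>v p) $ a = 0 \<or> degree ((L *\<^sub>v p) $ a) < ?e i" if a: "a < m" for a
    proof -
      have d: "degree ((L *\<^sub>v p) $ a) \<le> ?e i"
        unfolding index_mult_mat_vec_sum[OF L p a] using bound[OF a] by (intro degree_sum_le) auto
      have "coeff ((L *\<^sub>v p) $ a) (?e i) = (\<Sum>j<n. coeff (L $$ (a, j)) (?e j) * (c $ j / c $ i))"
        unfolding index_mult_mat_vec_sum[OF L p a] coeff_sum using bound[OF a] by (intro sum.cong) auto
      also have "\<dots> = (\<Sum>j<n. lead_mat ?e L $$ (a, j) * c $ j) / c $ i"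
        using L a by (simp add: lead_mat_def sum_divide_distrib)
      also have "\<dots> = 0" using index_mult_mat_vec_sum[OF Lc c(1) a] c(3) a by simp
      finally show ?thesis using d by (metis le_neq_implies_less leading_coeff_0_iff)
    qed
    then show thesis using that[OF i(1) p _ w, of 1] i by (simp add: p_def)
  qed
qed

text \<open>The trivial kernel makes \<open>w\<close> nonzero. A nonzero entry of \<open>w\<close>
  has degree below \<open>col_degree L i\<close>, so this number is positive and the bound
  \<open>col_degree L i - 1\<close> for the new column is a genuine drop.\<close>

lemma reduce_column_degrees:
  assumes L: "L \<in> carrier_mat m n" and ker: "\<And>v. v \<in> carrier_vec n \<Longrightarrow> L *\<^sub>v v = 0\<^sub>v m \<Longrightarrow> v = 0\<^sub>v n"
    and fail: "\<not> (\<forall>\<alpha>. left_invertible m n (eval_mat \<alpha> L)) \<or> \<not> left_invertible m n (lead_mat (col_degree L) L)"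
  obtains L' E where "L' \<in> carrier_mat m n" "E \<in> carrier_mat n n" "L = L' * E"
    "(\<Sum>j<n. col_degree L' j) < (\<Sum>j<n. col_degree L j)"
proof -
  obtain i p q w where ip: "i < n" "p \<in> carrier_vec n" "p $ i = 1" "w \<in> carrier_vec m"
    "L *\<^sub>v p = q \<cdot>\<^sub>v w" and deg: "\<forall>a<m. w $ a = 0 \<or> degree (w $ a) < col_degree L i"
    by (rule column_degree_drop[OF L fail])
  define L' where "L' = mat m n (\<lambda>(a, j). if j = i then w $ a else L $$ (a, j))"
  obtain E where E: "E \<in> carrier_mat n n" "L = L' * E"
    unfolding L'_def by (rule replace_column[OF L ip(1,4,2,3,5)])
  have L': "L' \<in> carrier_mat m n" by (simp add: L'_def)
  have "p \<noteq> 0\<^sub>v n" using ip by auto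
  then have "L *\<^sub>v p \<noteq> 0\<^sub>v m" using ker ip(2) by blast
  then have "w \<noteq> 0\<^sub>v m" using ip(5) by auto
  then obtain a where "a < m" "w $ a \<noteq> 0" using ip(4) by (auto simp: vec_eq_iff)
  then have pos: "0 < col_degree L i" using deg by auto
  have "vec_degree w \<le> col_degree L i - 1"
    unfolding vec_degree_le_iff using deg ip(4) pos by (metis Suc_pred' carrier_vecD degree_0 less_Suc_eq_le zero_le)
  moreover have "col L' i = w" using ip by (intro eq_vecI) (auto simp: L'_def)
  ultimately have "col_degree L' i < col_degree L i" using pos by simp
  moreover have "col_degree L' j = col_degree L j" if "j < n" "j \<noteq> i" for j
  proof -
    have "col L' j = col L j" using that L by (intro eq_vecI) (auto simp: L'_def)
    then show ?thesis by simp
  qed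
  ultimately have "(\<Sum>j<n. col_degree L' j) < (\<Sum>j<n. col_degree L j)"
    using ip(1) by (intro sum_strict_mono_ex1) (auto simp: less_le, metis less_imp_le order_refl)
  then show thesis using that[OF L' E] by blast
qed

subsection \<open>Minimal bases\<close>

lemma (in vec_space) left_invertible_iff_lin_indpt:
  assumes A: "A \<in> carrier_mat n k"
  shows "left_invertible n k A \<longleftrightarrow> distinct (cols A) \<and> lin_indpt (set (cols A))"
proof
  assume l: "left_invertible n k A"
  then have d: "distinct (cols A)" by (rule left_invertible_distinct_cols)
  moreover have "lin_indpt (set (cols A))"
    using lin_depE[OF A _ d] left_invertible_kernel[OF l] by blast
  ultimately show "distinct (cols A) \<and> lin_indpt (set (cols A))" ..
next
  assume "distinct (cols A) \<and> lin_indpt (set (cols A))"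
  then show "left_invertible n k A"
    using left_invertibleI_kernel[OF A] lin_depI[OF A] by blast
qed

lemma (in vec_space) col_space_submodule:
  assumes "A \<in> carrier_mat n k"
  shows "submodule class_ring (col_space A) V" "vectorspace class_ring (vs (col_space A))"
proof -
  have "set (cols A) \<subseteq> carrier_vec n" using assms cols_dim by blast
  then show "submodule class_ring (col_space A) V" "vectorspace class_ring (vs (col_space A))"
    unfolding col_space_def using span_is_submodule span_is_subspace subspace_is_vs by blast+
qed

lemma (in vec_space) basis_col_space_iff:
  assumes A: "A \<in> carrier_mat n k" and S: "S \<subseteq> carrier_vec n"
  shows "vectorspace.basis class_ring (vs (col_space A)) S \<longleftrightarrow> lin_indpt S \<and> span S = col_space A"
proof -
  note sm = col_space_submodule[OF A]
  have "S \<subseteq> col_space A" if "span S = col_space A" using in_own_span S that by auto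
  then show ?thesis
    unfolding vectorspace.basis_def[OF sm(2)]
    using span_li_not_depend[OF _ sm(1), of S] by auto
qed

lemma (in vec_space) card_basis_col_space:
  assumes l: "left_invertible n k A" and S: "S \<subseteq> carrier_vec n" "lin_indpt S" "span S = col_space A"
  shows "finite S \<and> card S = k"
proof -
  have A: "A \<in> carrier_mat n k" using l unfolding left_invertible_def by blast
  interpret w: vectorspace class_ring "vs (col_space A)" by (rule col_space_submodule(2)[OF A])
  have ind: "distinct (cols A)" "lin_indpt (set (cols A))"
    using left_invertible_iff_lin_indpt[OF A] l by auto
  have Ac: "set (cols A) \<subseteq> carrier_vec n" using A cols_dim by blast
  have bA: "w.basis (set (cols A))"
    unfolding basis_col_space_iff[OF A Ac] using ind by (simp add: col_space_def)
  have bS: "w.basis S" unfolding basis_col_space_iff[OF A S(1)] using S by simp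
  have "w.fin_dim" unfolding w.fin_dim_def using bA unfolding w.basis_def by blast
  then have fin: "finite S" using w.fin_dim_li_fin bS unfolding w.basis_def by blast
  have "card S = card (set (cols A))"
    using w.dim_basis[OF fin bS] w.dim_basis[OF _ bA] by simp
  then show ?thesis using fin distinct_card[OF ind(1)] A by simp
qed

text \<open>If \<open>X\<close> is a left inverse of \<open>A\<close>, then \<open>X * A'\<close> is
  inverse to \<open>E\<close>, so \<open>A\<close> and \<open>A'\<close> are right multiples of each
  other. It is applied over C(\<lambda>), where the factor from a column replacement becomes
  invertible.\<close>

lemma left_invertible_factor:
  fixes A :: "'a::field mat"
  assumes l: "left_invertible m n A" and A': "A' \<in> carrier_mat m n" and E: "E \<in> carrier_mat n n"
    and eq: "A = A' * E"
  shows "left_invertible m n A'" "vec_space.col_space m A' = vec_space.col_space m A"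
proof -
  obtain X where X: "A \<in> carrier_mat m n" "X \<in> carrier_mat n m" "X * A = 1\<^sub>m n"
    using l unfolding left_invertible_def by blast
  have XA': "X * A' \<in> carrier_mat n n" by (rule mult_carrier_mat[OF X(2) A'])
  have "X * A' * E = 1\<^sub>m n" using X(3) unfolding eq assoc_mult_mat[OF X(2) A' E] .
  then have inv: "E * (X * A') = 1\<^sub>m n" by (rule mat_mult_left_right_inverse[OF XA' E])
  then have "(E * X) * A' = 1\<^sub>m n" unfolding assoc_mult_mat[OF E X(2) A'] .
  moreover have "E * X \<in> carrier_mat n m" by (rule mult_carrier_mat[OF E X(2)])
  ultimately show "left_invertible m n A'" unfolding left_invertible_def using A' by blast
  have eq': "A' = A * (X * A')"
    unfolding eq assoc_mult_mat[OF A' E XA'] inv using A' by simp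
  interpret vec_space "TYPE('a)" m .
  have sub: "col_space (B * F) \<subseteq> col_space B" if B: "B \<in> carrier_mat m n" and F: "F \<in> carrier_mat n n"
    for B F :: "'a mat"
  proof
    fix y assume "y \<in> col_space (B * F)"
    then obtain x where x: "x \<in> carrier_vec n" "y = (B * F) *\<^sub>v x"
      unfolding col_space_eq[OF mult_carrier_mat[OF B F]] using F by auto
    then have "y = B *\<^sub>v (F *\<^sub>v x)" using assoc_mult_mat_vec[OF B F x(1)] by simp
    moreover have "F *\<^sub>v x \<in> carrier_vec n" using F x by simp
    ultimately show "y \<in> col_space B" unfolding col_space_eq[OF B] using B by auto
  qed
  show "col_space A' = col_space A" using sub[OF A' E] sub[OF X(1) XA'] eq eq' by auto
qed

abbreviation fract_mat :: "complex poly mat \<Rightarrow> complex poly fract mat" where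
  "fract_mat \<equiv> map_mat to_fract"

lemma cols_fract_mat: "cols (fract_mat L) = map (map_vec to_fract) (cols L)"
  by (auto simp: cols_def intro!: eq_vecI)

lemma inj_map_vec_to_fract: "inj (map_vec (to_fract :: 'a::idom \<Rightarrow> 'a fract))"
proof (rule injI)
  fix v w :: "'a vec" assume eq: "map_vec to_fract v = map_vec to_fract w"
  have "dim_vec v = dim_vec w" using arg_cong[OF eq, of dim_vec] by simp
  moreover have "v $ i = w $ i" if "i < dim_vec w" for i
    using arg_cong[OF eq, of "\<lambda>u. u $ i"] that calculation by (simp add: fract_hom.eq_iff)
  ultimately show "v = w" by (intro eq_vecI) auto
qed

lemma polynomial_basis_iff:
  assumes A: "A \<in> carrier_mat m k"
  shows "polynomial_basis m (vec_space.col_space m A) B \<longleftrightarrow> B \<subseteq> carrier_vec m \<and>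
    \<not> LinearCombinations.module.lin_dep class_ring (module_vec TYPE(complex poly fract) m) (map_vec to_fract ` B) \<and>
    LinearCombinations.module.span class_ring (module_vec TYPE(complex poly fract) m) (map_vec to_fract ` B)
      = vec_space.col_space m A"
proof -
  interpret vec_space "TYPE(complex poly fract)" m .
  show ?thesis
  proof (cases "B \<subseteq> carrier_vec m")
    case True
    then have "map_vec to_fract ` B \<subseteq> carrier_vec m" by auto
    then show ?thesis unfolding polynomial_basis_def using True basis_col_space_iff[OF A] by simp
  next
    case False
    then show ?thesis unfolding polynomial_basis_def by simp
  qed
qed

lemma polynomial_basis_cols:
  assumes L: "L \<in> carrier_mat m n"
  shows "distinct (cols L) \<and> polynomial_basis m (vec_space.col_space m (fract_mat L)) (set (cols L))
    \<longleftrightarrow> left_invertible m n (fract_mat L)"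
proof -
  interpret vec_space "TYPE(complex poly fract)" m .
  have FL: "fract_mat L \<in> carrier_mat m n" using L by simp
  have "set (cols L) \<subseteq> carrier_vec m" using L cols_dim by blast
  moreover have "map_vec to_fract ` set (cols L) = set (cols (fract_mat L))"
    by (simp add: cols_fract_mat)
  moreover have "distinct (cols (fract_mat L)) \<longleftrightarrow> distinct (cols L)"
    using inj_map_vec_to_fract by (auto simp: cols_fract_mat distinct_map intro: inj_on_subset)
  ultimately show ?thesis
    unfolding polynomial_basis_iff[OF FL] left_invertible_iff_lin_indpt[OF FL]
    by (auto simp: col_space_def)
qed

text \<open>A competing basis comes as a set of unknown size. The dimension fixes its size to
  \<open>n\<close>, so it can be listed as the columns of a matrix and compared with
  \<open>L\<close> column by column.\<close>

lemma polynomial_basis_matrix: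
  assumes l: "left_invertible m n (fract_mat L)" and L: "L \<in> carrier_mat m n"
    and B: "polynomial_basis m (vec_space.col_space m (fract_mat L)) B"
  obtains L' where "L' \<in> carrier_mat m n" "distinct (cols L')" "set (cols L') = B"
    "left_invertible m n (fract_mat L')"
    "\<forall>j<n. \<exists>t \<in> carrier_vec n. col (fract_mat L') j = fract_mat L *\<^sub>v t"
proof -
  interpret vec_space "TYPE(complex poly fract)" m .
  let ?f = "map_vec (to_fract :: complex poly \<Rightarrow> _)"
  have FL: "fract_mat L \<in> carrier_mat m n" using L by simp
  have B: "B \<subseteq> carrier_vec m" "lin_indpt (?f ` B)" "span (?f ` B) = col_space (fract_mat L)"
    using B unfolding polynomial_basis_iff[OF FL] by auto
  have fB: "?f ` B \<subseteq> carrier_vec m" using B by auto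
  have inj: "inj_on ?f B" using inj_map_vec_to_fract by (rule inj_on_subset) simp
  have "finite (?f ` B)" "card (?f ` B) = n" using card_basis_col_space[OF l fB B(2,3)] by auto
  then have fin: "finite B" and card: "card B = n"
    using inj finite_image_iff card_image by metis+
  obtain bs where bs: "set bs = B" "distinct bs" using finite_distinct_list[OF fin] by blast
  have len: "length bs = n" using distinct_card[OF bs(2)] bs(1) card by simp
  define L' where "L' = mat_of_cols m bs"
  have L': "L' \<in> carrier_mat m n" using len unfolding L'_def by auto
  have cols: "cols L' = bs" unfolding L'_def using bs B(1) by (intro cols_mat_of_cols) auto
  have FL': "fract_mat L' \<in> carrier_mat m n" using L' by simp
  have img: "set (cols (fract_mat L')) = ?f ` B" by (simp add: cols_fract_mat cols bs)
  have dist: "distinct (cols (fract_mat L'))"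
    using inj bs by (simp add: cols_fract_mat cols distinct_map)
  have "left_invertible m n (fract_mat L')"
    unfolding left_invertible_iff_lin_indpt[OF FL'] img using dist B by simp
  moreover have "\<exists>t \<in> carrier_vec n. col (fract_mat L') j = fract_mat L *\<^sub>v t" if j: "j < n" for j
  proof -
    have "col (fract_mat L') j \<in> set (cols (fract_mat L'))" using j FL' by (auto simp: cols_def)
    then have "col (fract_mat L') j \<in> col_space (fract_mat L)"
      unfolding img using in_own_span[of "?f ` B"] fB B(3) by auto
    then obtain t where "t \<in> carrier_vec n" "fract_mat L *\<^sub>v t = col (fract_mat L') j"
      unfolding col_space_eq[OF FL] using FL by auto
    then show ?thesis by metis
  qed
  ultimately show thesis using that[OF L'] cols bs by metis
qed

lemma sum_vec_degree_cols:
  assumes "L \<in> carrier_mat m n" "distinct (cols L)"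
  shows "sum vec_degree (set (cols L)) = (\<Sum>j<n. col_degree L j)"
proof -
  have "sum vec_degree (set (cols L)) = sum_list (map vec_degree (cols L))"
    by (rule sum.distinct_set_conv_list[OF assms(2)])
  also have "\<dots> = (\<Sum>j<n. col_degree L j)"
    using assms(1) by (simp add: sum_list_sum_nth atLeast0LessThan)
  finally show ?thesis .
qed

lemma fract_kernel:
  assumes "left_invertible m n (fract_mat L)" "L \<in> carrier_mat m n"
    and "v \<in> carrier_vec n" "L *\<^sub>v v = 0\<^sub>v m"
  shows "v = 0\<^sub>v n"
proof -
  have "fract_mat L *\<^sub>v map_vec to_fract v = map_vec to_fract (L *\<^sub>v v)"
    using fract_hom.mult_mat_vec_hom[OF assms(2,3)] by simp
  also have "\<dots> = 0\<^sub>v m" unfolding assms(4) by (intro eq_vecI) auto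
  finally have "map_vec to_fract v = 0\<^sub>v n"
    by (rule left_invertible_kernel[OF assms(1), rotated]) (use assms(3) in simp)
  also have "\<dots> = map_vec to_fract (0\<^sub>v n)" by (intro eq_vecI) auto
  finally show ?thesis by (rule injD[OF inj_map_vec_to_fract])
qed

text \<open>If one of the conditions failed, some column could be replaced by one of smaller degree
  without changing the span over C(\<lambda>), contradicting minimality.\<close>

lemma minimal_basis_imp:
  assumes L: "L \<in> carrier_mat m n" and min: "is_minimal_basis L"
  shows "(\<forall>\<alpha>. left_invertible m n (eval_mat \<alpha> L)) \<and> left_invertible m n (lead_mat (col_degree L) L)"
proof (rule ccontr)
  assume "\<not> ?thesis"
  then have fail: "\<not> (\<forall>\<alpha>. left_invertible m n (eval_mat \<alpha> L))
      \<or> \<not> left_invertible m n (lead_mat (col_degree L) L)" by blast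
  let ?W = "vec_space.col_space m (fract_mat L)"
  have dist: "distinct (cols L)" and mb: "minimal_basis m ?W (set (cols L))"
    using min L unfolding is_minimal_basis_def by auto
  have lF: "left_invertible m n (fract_mat L)"
    using polynomial_basis_cols[OF L] dist mb unfolding minimal_basis_def by blast
  obtain L' E where L': "L' \<in> carrier_mat m n" "E \<in> carrier_mat n n" "L = L' * E"
    "(\<Sum>j<n. col_degree L' j) < (\<Sum>j<n. col_degree L j)"
    by (rule reduce_column_degrees[OF L fract_kernel[OF lF L] fail])
  have "fract_mat L = fract_mat L' * fract_mat E"
    unfolding L'(3) by (rule fract_hom.mat_hom_mult[OF L'(1,2)])
  from left_invertible_factor[OF lF _ _ this] L'
  have lF': "left_invertible m n (fract_mat L')" and W: "vec_space.col_space m (fract_mat L') = ?W"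
    by auto
  have "distinct (cols L')" "polynomial_basis m ?W (set (cols L'))"
    using polynomial_basis_cols[OF L'(1)] lF' unfolding W by auto
  then have "(\<Sum>j<n. col_degree L j) \<le> (\<Sum>j<n. col_degree L' j)"
    using mb sum_vec_degree_cols[OF L'(1)] sum_vec_degree_cols[OF L dist]
    unfolding minimal_basis_def by auto
  then show False using L'(4) by simp
qed

section \<open>Sufficiency in Forney's criterion\<close>

lemma common_denominator:
  fixes t :: "complex poly fract vec"
  assumes "t \<in> carrier_vec n"
  obtains q x where "q \<noteq> 0" "x \<in> carrier_vec n" "to_fract q \<cdot>\<^sub>v t = map_vec to_fract x"
proof -
  have "\<exists>a b. b \<noteq> 0 \<and> to_fract b * z = to_fract a" for z :: "complex poly fract"
  proof (cases z)
    case (Fract a b)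
    then have "to_fract b * z = to_fract a"
      by (simp add: to_fract_def eq_fract mult.commute)
    then show ?thesis using Fract by blast
  qed
  then obtain a b where ab: "\<And>z. b z \<noteq> 0" "\<And>z :: complex poly fract. to_fract (b z) * z = to_fract (a z)"
    by metis
  define q where "q = (\<Prod>j<n. b (t $ j))"
  define x where "x = vec n (\<lambda>j. (\<Prod>k\<in>{..<n} - {j}. b (t $ k)) * a (t $ j))"
  have "to_fract q * t $ j = to_fract (x $ j)" if j: "j < n" for j
  proof -
    have "q = b (t $ j) * (\<Prod>k\<in>{..<n} - {j}. b (t $ k))"
      unfolding q_def using j by (intro prod.remove) auto
    then have "to_fract q * t $ j = to_fract (\<Prod>k\<in>{..<n} - {j}. b (t $ k)) * (to_fract (b (t $ j)) * t $ j)"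
      by (simp add: fract_hom.hom_mult mult_ac)
    also have "\<dots> = to_fract (x $ j)"
      unfolding ab(2) using j by (simp add: x_def fract_hom.hom_mult)
    finally show ?thesis .
  qed
  then have "to_fract q \<cdot>\<^sub>v t = map_vec to_fract x"
    using assms by (intro eq_vecI) (auto simp: x_def)
  moreover have "q \<noteq> 0" unfolding q_def using ab(1) by simp
  moreover have "x \<in> carrier_vec n" by (simp add: x_def)
  ultimately show thesis using that by blast
qed

lemma mult_mat_smult_vec:
  fixes A :: "'a::comm_ring_1 mat"
  assumes "A \<in> carrier_mat m n" "v \<in> carrier_vec n"
  shows "A *\<^sub>v (k \<cdot>\<^sub>v v) = k \<cdot>\<^sub>v (A *\<^sub>v v)"
  using assms
  by (intro eq_vecI) (auto simp: index_mult_mat_vec_sum[of A m n] sum_distrib_left mult_ac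
      simp del: index_mult_mat_vec intro!: sum.cong)

text \<open>Linear factors of \<open>q\<close> are removed one at a time: at a root
  \<open>\<alpha>\<close> of \<open>q\<close> the vector \<open>x\<close> evaluates into the kernel
  of the injective \<open>eval_mat \<alpha> L\<close>, so all its entries are divisible by \<lambda>
  - \<alpha>.\<close>

lemma cancel_denominator:
  assumes L: "L \<in> carrier_mat m n" and inj: "\<forall>\<alpha>. left_invertible m n (eval_mat \<alpha> L)"
    and b: "b \<in> carrier_vec m"
  shows "q \<noteq> 0 \<Longrightarrow> x \<in> carrier_vec n \<Longrightarrow> L *\<^sub>v x = q \<cdot>\<^sub>v b \<Longrightarrow>
    \<exists>y \<in> carrier_vec n. L *\<^sub>v y = b"
proof (induction "degree q" arbitrary: q x)
  case 0
  then obtain c where c: "q = [:c:]" "c \<noteq> 0" by (metis degree_eq_zeroE pCons_0_0)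
  have "L *\<^sub>v ([:inverse c:] \<cdot>\<^sub>v x) = [:inverse c:] \<cdot>\<^sub>v (L *\<^sub>v x)"
    by (rule mult_mat_smult_vec[OF L 0(3)])
  also have "\<dots> = b" unfolding 0(4) c(1) using c(2) b by (intro eq_vecI) auto
  finally show ?case using 0(3) by (intro bexI[of _ "[:inverse c:] \<cdot>\<^sub>v x"]) auto
next
  case (Suc k)
  then have "\<not> constant (poly q)" by (simp add: constant_degree)
  then obtain \<alpha> where "poly q \<alpha> = 0" using fundamental_theorem_of_algebra by blast
  then obtain q' where q': "q = [:- \<alpha>, 1:] * q'" by (auto simp: poly_eq_0_iff_dvd elim: dvdE)
  have "q' \<noteq> 0" using Suc(3) q' by auto
  then have dq': "k = degree q'" using Suc(2) unfolding q' by (subst (asm) degree_mult_eq) auto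
  have eL: "eval_mat \<alpha> L \<in> carrier_mat m n" using L by simp
  have "eval_mat \<alpha> L *\<^sub>v map_vec (\<lambda>p. poly p \<alpha>) x = map_vec (\<lambda>p. poly p \<alpha>) (L *\<^sub>v x)"
    using eval_hom.mult_mat_vec_hom[OF L Suc(4)] by simp
  also have "\<dots> = 0\<^sub>v m" unfolding Suc(5) q' using b by (intro eq_vecI) auto
  finally have ev: "map_vec (\<lambda>p. poly p \<alpha>) x = 0\<^sub>v n"
    using left_invertible_kernel[of m n "eval_mat \<alpha> L"] inj Suc(4) by simp
  have "poly (x $ j) \<alpha> = 0" if "j < n" for j
    using arg_cong[OF ev, of "\<lambda>v. v $ j"] that Suc(4) by simp
  then have dv: "[:- \<alpha>, 1:] dvd x $ j" if "j < n" for j using that by (simp add: poly_eq_0_iff_dvd)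
  define x' where "x' = vec n (\<lambda>j. x $ j div [:- \<alpha>, 1:])"
  have x': "x' \<in> carrier_vec n" by (simp add: x'_def)
  have x: "x = [:- \<alpha>, 1:] \<cdot>\<^sub>v x'"
  proof (rule eq_vecI)
    fix j assume "j < dim_vec ([:- \<alpha>, 1:] \<cdot>\<^sub>v x')"
    then have j: "j < n" by (simp add: x'_def)
    then show "x $ j = ([:- \<alpha>, 1:] \<cdot>\<^sub>v x') $ j"
      using dvd_mult_div_cancel[OF dv[OF j]] by (simp only: x'_def index_smult_vec index_vec dim_vec)
  qed (use Suc(4) in \<open>simp add: x'_def\<close>)
  have "[:- \<alpha>, 1:] \<cdot>\<^sub>v (L *\<^sub>v x') = [:- \<alpha>, 1:] \<cdot>\<^sub>v (q' \<cdot>\<^sub>v b)"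
    using mult_mat_smult_vec[OF L x', of "[:- \<alpha>, 1:]"] Suc(5) unfolding x q' by (simp add: smult_smult_assoc)
  then have "L *\<^sub>v x' = q' \<cdot>\<^sub>v b"
  proof (intro eq_vecI)
    fix i assume i: "i < dim_vec (q' \<cdot>\<^sub>v b)"
    assume eq: "[:- \<alpha>, 1:] \<cdot>\<^sub>v (L *\<^sub>v x') = [:- \<alpha>, 1:] \<cdot>\<^sub>v (q' \<cdot>\<^sub>v b)"
    have "[:- \<alpha>, 1:] * (L *\<^sub>v x') $ i = [:- \<alpha>, 1:] * (q' \<cdot>\<^sub>v b) $ i"
      using arg_cong[OF eq, of "\<lambda>v. v $ i"] i b L by (simp only: index_smult_vec dim_mult_mat_vec carrier_matD carrier_vecD)
    then show "(L *\<^sub>v x') $ i = (q' \<cdot>\<^sub>v b) $ i" using mult_left_cancel[of "[:- \<alpha>, 1:]"] by (metis one_neq_zero pCons_eq_0_iff)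
  qed (use L b in auto)
  then show ?case using Suc(1)[OF dq' \<open>q' \<noteq> 0\<close> x'] by blast
qed

text \<open>A nonzero Leibniz term matches rows with columns through nonzero entries. This is how
  degrees of two bases are compared, and how the weights are paired later.\<close>

lemma det_nonzero_permutation:
  fixes T :: "'a::idom mat"
  assumes "T \<in> carrier_mat n n" "det T \<noteq> 0"
  obtains \<pi> where "\<pi> permutes {0..<n}" "\<And>i. i < n \<Longrightarrow> T $$ (i, \<pi> i) \<noteq> 0"
proof -
  have "det T = (\<Sum>p\<in>{p. p permutes {0..<n}}. signof p * (\<Prod>i = 0..<n. T $$ (i, p i)))"
    by (rule det_def'[OF assms(1)])
  then obtain p where "p permutes {0..<n}" "signof p * (\<Prod>i = 0..<n. T $$ (i, p i)) \<noteq> 0"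
    using assms(2) by (metis (mono_tags, lifting) mem_Collect_eq sum.neutral)
  then show thesis using that[of p] by (auto simp: prod_zero_iff)
qed

text \<open>Injectivity at all points makes any competitor a polynomial multiple
  \<open>L' = L * T\<close>. A matching through nonzero entries of \<open>T\<close> and the
  predictable degree property give \<open>col_degree L i \<le> col_degree L' (\<pi> i)\<close> for a
  permutation \<open>\<pi>\<close>, and summing over the columns finishes.\<close>

lemma minimal_basisI:
  assumes L: "L \<in> carrier_mat m n" and inj: "\<forall>\<alpha>. left_invertible m n (eval_mat \<alpha> L)"
    and lead: "left_invertible m n (lead_mat (col_degree L) L)"
  shows "is_minimal_basis L"
proof -
  let ?W = "vec_space.col_space m (fract_mat L)"
  have e: "\<forall>i<m. \<forall>j<n. degree (L $$ (i, j)) \<le> col_degree L j" using degree_le_vec_degree[OF L] by blast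
  have ker: "v = 0\<^sub>v n" if v: "v \<in> carrier_vec n" "L *\<^sub>v v = 0\<^sub>v m" for v
  proof (rule ccontr)
    assume "v \<noteq> 0\<^sub>v n"
    then obtain j where "j < n" "v $ j \<noteq> 0" using v by (auto simp: vec_eq_iff)
    from predictable_degree[OF L e lead v(1) this] show False using v by auto
  qed
  have FL: "fract_mat L \<in> carrier_mat m n" using L by simp
  have lF: "left_invertible m n (fract_mat L)"
  proof (rule left_invertibleI_kernel[OF FL])
    fix t assume t: "t \<in> carrier_vec n" "fract_mat L *\<^sub>v t = 0\<^sub>v m"
    obtain q x where q: "q \<noteq> 0" "x \<in> carrier_vec n" "to_fract q \<cdot>\<^sub>v t = map_vec to_fract x"
      by (rule common_denominator[OF t(1)])
    have "map_vec to_fract (L *\<^sub>v x) = fract_mat L *\<^sub>v (to_fract q \<cdot>\<^sub>v t)"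
      using fract_hom.mult_mat_vec_hom[OF L q(2)] q(3) by simp
    also have "\<dots> = to_fract q \<cdot>\<^sub>v (fract_mat L *\<^sub>v t)" by (rule mult_mat_vec[OF FL t(1)])
    also have "\<dots> = map_vec to_fract (0\<^sub>v m)" unfolding t(2) by (intro eq_vecI) auto
    finally have "L *\<^sub>v x = 0\<^sub>v m" by (rule injD[OF inj_map_vec_to_fract])
    then have "x = 0\<^sub>v n" by (rule ker[OF q(2)])
    then have z: "to_fract q \<cdot>\<^sub>v t = map_vec to_fract (0\<^sub>v n)" using q by simp
    show "t = 0\<^sub>v n"
    proof (rule eq_vecI)
      fix j assume "j < dim_vec (0\<^sub>v n :: complex poly fract vec)"
      then show "t $ j = 0\<^sub>v n $ j" using arg_cong[OF z, of "\<lambda>v. v $ j"] t(1) q(1) by simp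
    qed (use t in auto)
  qed
  have base: "distinct (cols L)" "polynomial_basis m ?W (set (cols L))"
    using polynomial_basis_cols[OF L] lF by auto
  have "sum vec_degree (set (cols L)) \<le> sum vec_degree B" if B: "polynomial_basis m ?W B" for B
  proof -
    obtain L' where L': "L' \<in> carrier_mat m n" "distinct (cols L')" "set (cols L') = B"
      "left_invertible m n (fract_mat L')"
      "\<forall>j<n. \<exists>t \<in> carrier_vec n. col (fract_mat L') j = fract_mat L *\<^sub>v t"
      by (rule polynomial_basis_matrix[OF lF L B])
    have "\<exists>y \<in> carrier_vec n. L *\<^sub>v y = col L' j" if j: "j < n" for j
    proof -
      obtain t where t: "t \<in> carrier_vec n" "col (fract_mat L') j = fract_mat L *\<^sub>v t"
        using L'(5) j by blast
      obtain q x where q: "q \<noteq> 0" "x \<in> carrier_vec n" "to_fract q \<cdot>\<^sub>v t = map_vec to_fract x"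
        by (rule common_denominator[OF t(1)])
      have "map_vec to_fract (L *\<^sub>v x) = fract_mat L *\<^sub>v (to_fract q \<cdot>\<^sub>v t)"
        using fract_hom.mult_mat_vec_hom[OF L q(2)] q(3) by simp
      also have "\<dots> = to_fract q \<cdot>\<^sub>v (fract_mat L *\<^sub>v t)" by (rule mult_mat_vec[OF FL t(1)])
      also have "\<dots> = map_vec to_fract (q \<cdot>\<^sub>v col L' j)"
        unfolding t(2)[symmetric] using L'(1) j by (intro eq_vecI) (auto simp: fract_hom.hom_mult)
      finally have "L *\<^sub>v x = q \<cdot>\<^sub>v col L' j" by (rule injD[OF inj_map_vec_to_fract])
      then show ?thesis using cancel_denominator[OF L inj _ q(1,2)] L'(1) j by simp
    qed
    then obtain y where y: "\<And>j. j < n \<Longrightarrow> y j \<in> carrier_vec n" "\<And>j. j < n \<Longrightarrow> L *\<^sub>v y j = col L' j"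
      by metis
    define T where "T = mat n n (\<lambda>(k, j). y j $ k)"
    have T: "T \<in> carrier_mat n n" by (simp add: T_def)
    have colT: "col T j = y j" if "j < n" for j
      using y(1)[OF that] that by (intro eq_vecI) (auto simp: T_def)
    have LT: "L' = L * T"
    proof (rule mat_col_eqI)
      fix j assume "j < dim_col (L * T)"
      then have j: "j < n" using T by simp
      show "col L' j = col (L * T) j" using col_mult2[OF L T j] colT[OF j] y(2)[OF j] by simp
    qed (use L T L' in auto)
    have "det T \<noteq> 0"
    proof
      assume "det T = 0"
      then obtain v where v: "v \<in> carrier_vec n" "v \<noteq> 0\<^sub>v n" "T *\<^sub>v v = 0\<^sub>v n"
        using det_0_iff_vec_prod_zero[OF T] by blast
      have "L' *\<^sub>v v = 0\<^sub>v m"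
        unfolding LT assoc_mult_mat_vec[OF L T v(1)] v(3) by (rule mult_mat_zero_vec[OF L])
      then show False using fract_kernel[OF L'(4,1) v(1)] v(2) by blast
    qed
    then obtain \<pi> where \<pi>: "\<pi> permutes {0..<n}" "\<And>i. i < n \<Longrightarrow> T $$ (i, \<pi> i) \<noteq> 0"
      by (rule det_nonzero_permutation[OF T]) (use that in blast)
    have "col_degree L i \<le> col_degree L' (\<pi> i)" if i: "i < n" for i
    proof -
      have pi: "\<pi> i < n" using permutes_in_image[OF \<pi>(1), of i] i by simp
      have "y (\<pi> i) $ i \<noteq> 0" using \<pi>(2)[OF i] i pi by (simp add: T_def)
      from predictable_degree[OF L e lead y(1)[OF pi] i this] obtain a where
        a: "a < m" "col_degree L i \<le> degree (col L' (\<pi> i) $ a)" unfolding y(2)[OF pi] by auto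
      have "degree (col L' (\<pi> i) $ a) \<le> col_degree L' (\<pi> i)"
        using degree_le_vec_degree[OF L'(1) a(1) pi] L'(1) a(1) pi by simp
      then show ?thesis using a(2) by simp
    qed
    then have "(\<Sum>i<n. col_degree L i) \<le> (\<Sum>i<n. col_degree L' (\<pi> i))" by (intro sum_mono) auto
    also have "\<dots> = (\<Sum>i<n. col_degree L' i)"
      using sum.permute[OF \<pi>(1), of "col_degree L'"] by (simp add: atLeast0LessThan o_def)
    finally show ?thesis
      using sum_vec_degree_cols[OF L base(1)] sum_vec_degree_cols[OF L'(1,2)] L'(3) by simp
  qed
  then show ?thesis unfolding is_minimal_basis_def minimal_basis_def using L base by auto
qed

subsection \<open>Symplectic reduction\<close>

lemma sum_remove_two:
  fixes f :: "'b \<Rightarrow> 'a::comm_monoid_add"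
  assumes "finite I" "i \<in> I" "j \<in> I" "i \<noteq> j"
  shows "sum f I = f i + f j + sum f (I - {i, j})"
proof -
  have "sum f I = f i + sum f (I - {i})" using assms by (intro sum.remove) auto
  also have "sum f (I - {i}) = f j + sum f (I - {i} - {j})" using assms by (intro sum.remove) auto
  also have "I - {i} - {j} = I - {i, j}" by auto
  finally show ?thesis by (simp add: add.assoc)
qed

text \<open>One step of symplectic Gram--Schmidt: for a hyperbolic pair \<open>i0, j0\<close> of indices, completing
  the square splits off a rank two summand and leaves a form in the remaining variables.\<close>

lemma symplectic_step:
  fixes K :: "nat \<Rightarrow> nat \<Rightarrow> 'a::comm_ring_1" and x y :: "nat \<Rightarrow> 'a"
  assumes fin: "finite I" and ij: "i0 \<in> I" "j0 \<in> I" "i0 \<noteq> j0"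
    and skew: "\<And>i j. i \<in> I \<Longrightarrow> j \<in> I \<Longrightarrow> K i j = - K j i"
    and diag: "K i0 i0 = 0" "K j0 j0 = 0"
    and c: "K i0 j0 * c' = 1"
  defines "u z \<equiv> \<Sum>j\<in>I. K i0 j * z j" and "v z \<equiv> \<Sum>j\<in>I. K j0 j * z j"
  shows "(\<Sum>i\<in>I. \<Sum>j\<in>I. K i j * x i * y j) =
    v x * (- c' * u y) - (- c' * u x) * v y +
    (\<Sum>i\<in>I - {i0, j0}. \<Sum>j\<in>I - {i0, j0}.
      (K i j - c' * (K i0 i * K j0 j - K j0 i * K i0 j)) * x i * y j)"
proof -
  let ?I = "I - {i0, j0}"
  define c where "c = K i0 j0"
  define U where "U z = (\<Sum>j\<in>?I. K i0 j * z j)" for z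
  define V where "V z = (\<Sum>j\<in>?I. K j0 j * z j)" for z
  define R where "R = (\<Sum>i\<in>?I. \<Sum>j\<in>?I. K i j * x i * y j)"
  note rem = sum_remove_two[OF fin ij]
  have K21: "K j0 i0 = - c" unfolding c_def using skew ij by blast
  have u: "u z = c * z j0 + U z" for z unfolding u_def U_def rem c_def using diag by simp
  have v: "v z = - c * z i0 + V z" for z unfolding v_def V_def rem K21 using diag by simp
  have row: "(\<Sum>j\<in>I. K i j * x i * y j) = - K i0 i * x i * y i0 - K j0 i * x i * y j0
      + (\<Sum>j\<in>?I. K i j * x i * y j)" if "i \<in> ?I" for i
  proof -
    have "K i i0 = - K i0 i" "K i j0 = - K j0 i" using that ij by (intro skew; simp)+
    then show ?thesis unfolding rem by simp
  qed
  have "(\<Sum>i\<in>?I. \<Sum>j\<in>I. K i j * x i * y j)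
    = (\<Sum>i\<in>?I. - K i0 i * x i * y i0 - K j0 i * x i * y j0 + (\<Sum>j\<in>?I. K i j * x i * y j))"
    using row by (intro sum.cong) auto
  also have "\<dots> = - (U x * y i0) - V x * y j0 + R"
    unfolding R_def U_def V_def
    by (simp add: sum.distrib sum_subtractf sum_distrib_right sum_negf)
  finally have rest: "(\<Sum>i\<in>?I. \<Sum>j\<in>I. K i j * x i * y j) = - (U x * y i0) - V x * y j0 + R" .
  have r1: "(\<Sum>j\<in>I. K i0 j * x i0 * y j) = x i0 * u y"
    unfolding u_def sum_distrib_left by (intro sum.cong) (auto simp: mult_ac)
  have r2: "(\<Sum>j\<in>I. K j0 j * x j0 * y j) = x j0 * v y"
    unfolding v_def sum_distrib_left by (intro sum.cong) (auto simp: mult_ac)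
  have lhs: "(\<Sum>i\<in>I. \<Sum>j\<in>I. K i j * x i * y j)
      = x i0 * u y + x j0 * v y - U x * y i0 - V x * y j0 + R"
    using rem[of "\<lambda>i. \<Sum>j\<in>I. K i j * x i * y j"] rest r1 r2 by simp
  have UV: "(\<Sum>i\<in>?I. \<Sum>j\<in>?I. K i0 i * K j0 j * x i * y j) = U x * V y"
    unfolding U_def V_def sum_product by (intro sum.cong refl) (simp add: mult_ac)
  have VU: "(\<Sum>i\<in>?I. \<Sum>j\<in>?I. K j0 i * K i0 j * x i * y j) = V x * U y"
    unfolding U_def V_def sum_product by (intro sum.cong refl) (simp add: mult_ac)
  have "(\<Sum>i\<in>?I. \<Sum>j\<in>?I. (K i j - c' * (K i0 i * K j0 j - K j0 i * K i0 j)) * x i * y j)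
    = (\<Sum>i\<in>?I. \<Sum>j\<in>?I. K i j * x i * y j - c' * (K i0 i * K j0 j * x i * y j)
        + c' * (K j0 i * K i0 j * x i * y j))"
    by (intro sum.cong refl) (simp add: algebra_simps)
  also have "\<dots> = R - c' * (U x * V y) + c' * (V x * U y)"
    unfolding R_def UV[symmetric] VU[symmetric]
    by (simp add: sum.distrib sum_subtractf sum_distrib_left)
  finally have new: "(\<Sum>i\<in>?I. \<Sum>j\<in>?I. (K i j - c' * (K i0 i * K j0 j - K j0 i * K i0 j)) * x i * y j)
    = R - c' * (U x * V y) + c' * (V x * U y)" .
  have cc: "c * c' = 1" "c' * c = 1" using c by (auto simp: c_def mult.commute)
  have e1: "c' * (c * z) = z" for z by (simp add: mult.assoc[symmetric] cc)
  have "v x * (- c' * u y) - (- c' * u x) * v y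
    = c' * (c * (x i0 * u y)) - c' * (V x * u y) + c' * (c * (x j0 * v y)) + c' * (U x * v y)"
    unfolding u[of x] v[of x] by (simp add: algebra_simps)
  also have "\<dots> = x i0 * u y + x j0 * v y - c' * (V x * u y) + c' * (U x * v y)"
    unfolding e1 by simp
  also have "c' * (V x * u y) = c' * (c * (V x * y j0)) + c' * (V x * U y)"
    unfolding u by (simp add: algebra_simps)
  also have "c' * (U x * v y) = - (c' * (c * (U x * y i0))) + c' * (U x * V y)"
    unfolding v by (simp add: algebra_simps)
  finally show ?thesis unfolding lhs new e1 by (simp add: algebra_simps)
qed

text \<open>Nondegeneracy passes to the split-off form: a kernel vector of the smaller form extends
  to one of the whole form.\<close>

lemma symplectic_step_kernel:
  fixes K :: "nat \<Rightarrow> nat \<Rightarrow> 'a::comm_ring_1"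
  assumes fin: "finite I" and ij: "i0 \<in> I" "j0 \<in> I" "i0 \<noteq> j0"
    and skew: "\<And>i j. i \<in> I \<Longrightarrow> j \<in> I \<Longrightarrow> K i j = - K j i"
    and diag: "K i0 i0 = 0" "K j0 j0 = 0"
    and c: "K i0 j0 * c' = 1"
    and ker: "\<And>x. (\<forall>i\<in>I. (\<Sum>j\<in>I. K i j * x j) = 0) \<Longrightarrow> \<forall>j\<in>I. x j = 0"
    and x: "\<forall>i\<in>I - {i0, j0}. (\<Sum>j\<in>I - {i0, j0}.
      (K i j - c' * (K i0 i * K j0 j - K j0 i * K i0 j)) * x j) = 0"
  shows "\<forall>j\<in>I - {i0, j0}. x j = 0"
proof -
  let ?I = "I - {i0, j0}"
  define s where "s = (\<Sum>j\<in>?I. K i0 j * x j)"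
  define t where "t = (\<Sum>j\<in>?I. K j0 j * x j)"
  \<comment> \<open>Rows \<open>j0\<close> and \<open>i0\<close> of the equation for the extended
    vector determine its values at \<open>i0\<close> and \<open>j0\<close>; the signs differ because
    \<open>K j0 i0 = - K i0 j0\<close>.\<close>
  define y where "y j = (if j = i0 then c' * t else if j = j0 then - c' * s else x j)" for j
  note rem = sum_remove_two[OF fin ij]
  have rest: "(\<Sum>j\<in>?I. K i j * y j) = (\<Sum>j\<in>?I. K i j * x j)" for i
    by (intro sum.cong) (auto simp: y_def)
  have sum: "(\<Sum>j\<in>I. K i j * y j) = K i i0 * (c' * t) - K i j0 * (c' * s) + (\<Sum>j\<in>?I. K i j * x j)" for i
    unfolding rem rest using ij by (simp add: y_def)
  have K21: "K j0 i0 = - K i0 j0" using skew ij by blast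
  have e1: "K i0 j0 * (c' * z) = z" for z using c by (simp add: mult.assoc[symmetric])
  have "(\<Sum>j\<in>I. K i j * y j) = 0" if i: "i \<in> I" for i
  proof -
    consider "i = i0" | "i = j0" | "i \<in> ?I" using i by blast
    then show ?thesis
    proof cases
      case 1
      show ?thesis unfolding sum 1 diag e1 s_def[symmetric] by simp
    next
      case 2
      show ?thesis unfolding sum 2 diag K21 mult_minus_left e1 t_def[symmetric] by simp
    next
      case 3
      have Ki: "K i i0 = - K i0 i" "K i j0 = - K j0 i" using 3 ij by (intro skew; simp)+
      have "0 = (\<Sum>j\<in>?I. (K i j - c' * (K i0 i * K j0 j - K j0 i * K i0 j)) * x j)"
        using x 3 by simp
      also have "\<dots> = (\<Sum>j\<in>?I. K i j * x j - (c' * K i0 i) * (K j0 j * x j) + (c' * K j0 i) * (K i0 j * x j))"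
        by (intro sum.cong refl) (simp add: algebra_simps)
      also have "\<dots> = (\<Sum>j\<in>?I. K i j * x j) - (c' * K i0 i) * t + (c' * K j0 i) * s"
        unfolding s_def t_def by (simp add: sum.distrib sum_subtractf sum_distrib_left)
      also have "\<dots> = (\<Sum>j\<in>I. K i j * y j)" unfolding sum Ki by (simp add: mult_ac)
      finally show ?thesis ..
    qed
  qed
  then have "\<forall>j\<in>I. y j = 0" by (rule ker[OF ballI])
  moreover have "y j = x j" if "j \<in> ?I" for j using that by (simp add: y_def)
  ultimately show ?thesis by auto
qed

lemma card_filter_remove_two:
  assumes "finite I" "i \<in> I" "j \<in> I" "i \<noteq> j"
  shows "card {k \<in> I. Q k} = (if Q i then 1 else 0) + (if Q j then 1 else 0) + card {k \<in> I - {i, j}. Q k}"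
proof -
  have "card {k \<in> I. Q k} = (\<Sum>k\<in>I. if Q k then 1 else 0)"
    using assms(1) by (simp add: sum.If_cases Int_def)
  also have "\<dots> = (if Q i then 1 else 0) + (if Q j then 1 else 0) + (\<Sum>k\<in>I - {i, j}. if Q k then 1 else 0)"
    by (rule sum_remove_two[OF assms])
  also have "(\<Sum>k\<in>I - {i, j}. if Q k then 1 else 0) = card {k \<in> I - {i, j}. Q k}"
    using assms(1) by (simp add: sum.If_cases Int_def)
  finally show ?thesis .
qed

text \<open>Index functions on a set \<open>I\<close> take the place of matrices so that a pair can
  be removed without renumbering. Symmetry of the weights under \<open>s \<mapsto> d - s\<close> is
  expressed by counting, because a fixed pairing would not survive: the pivot partner of
  \<open>i0\<close> is dictated by a nonzero entry of \<open>K\<close>. The bound \<open>E\<close>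
  carries the ordering through the induction, as the recursive call uses \<open>e i0\<close> in its
  place.\<close>

lemma symplectic_reduction:
  fixes K :: "nat \<Rightarrow> nat \<Rightarrow> complex poly" and M :: "nat \<Rightarrow> nat \<Rightarrow> complex poly"
  assumes "finite I" "card I = 2 * r"
    and "\<And>i j. i \<in> I \<Longrightarrow> j \<in> I \<Longrightarrow> K i j = - K j i"
    and "\<And>i j. i \<in> I \<Longrightarrow> j \<in> I \<Longrightarrow> K i j \<noteq> 0 \<Longrightarrow> e i + e j + degree (K i j) \<le> d"
    and "\<And>x. (\<forall>i\<in>I. (\<Sum>j\<in>I. K i j * x j) = 0) \<Longrightarrow> \<forall>j\<in>I. x j = 0"
    and "\<And>s. card {i \<in> I. e i = s} = card {i \<in> I. e i + s = d}"
    and "\<And>i a. i \<in> I \<Longrightarrow> degree (M i a) \<le> e i"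
    and "\<And>i. i \<in> I \<Longrightarrow> e i \<le> E"
  shows "\<exists>u v f. (\<forall>k<r. f k \<le> E \<and> f k \<le> d \<and> d \<le> 2 * f k) \<and>
    (\<forall>k<r. \<forall>l<r. k \<le> l \<longrightarrow> f l \<le> f k) \<and>
    (\<forall>k<r. \<forall>a. degree (u k a) \<le> f k \<and> degree (v k a) \<le> d - f k) \<and>
    (\<forall>a b. (\<Sum>i\<in>I. \<Sum>j\<in>I. K i j * M i a * M j b) = (\<Sum>k<r. u k a * v k b - v k a * u k b))"
  using assms
proof (induction r arbitrary: I K E)
  case 0
  then have "I = {}" by simp
  then show ?case by simp
next
  case (Suc r I K E)
  note fin = Suc.prems(1) and skew = Suc.prems(3) and bound = Suc.prems(4) and ker = Suc.prems(5)
    and cnt = Suc.prems(6) and dM = Suc.prems(7)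
  have ne: "I \<noteq> {}" using Suc.prems(2) by auto
  obtain i0 where i0: "i0 \<in> I" "\<And>i. i \<in> I \<Longrightarrow> e i \<le> e i0"
  proof -
    have "Max (e ` I) \<in> e ` I" using fin ne by (intro Max_in) auto
    then obtain i where "i \<in> I" "e i = Max (e ` I)" by force
    then show thesis using that[of i] Max_ge[of "e ` I"] fin by auto
  qed
  have partner: "\<exists>j\<in>I. e i + e j = d" if "i \<in> I" for i
  proof -
    have "card {j \<in> I. e j = e i} \<noteq> 0" using that fin by auto
    then have "{j \<in> I. e j + e i = d} \<noteq> {}" using cnt[of "e i"] by (metis card.empty)
    then show ?thesis by (auto simp: add.commute)
  qed
  have diag: "K i i = 0" if "i \<in> I" for i
  proof -
    have "K i i + K i i = 0" using skew[OF that that] by (metis add.right_inverse)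
    then show ?thesis by (simp add: mult_2[symmetric])
  qed
  obtain j0 where j0: "j0 \<in> I" "K i0 j0 \<noteq> 0"
  proof -
    have "\<exists>j\<in>I. K j i0 \<noteq> 0"
    proof (rule ccontr)
      assume "\<not> ?thesis"
      then have "\<forall>i\<in>I. (\<Sum>j\<in>I. K i j * (if j = i0 then 1 else 0)) = 0"
        using fin i0(1) by (simp add: sum.delta' if_distrib cong: if_cong)
      then show False using ker[of "\<lambda>j. if j = i0 then 1 else 0"] i0(1) by auto
    qed
    then show thesis using that skew i0(1) by (metis neg_equal_0_iff_equal)
  qed
  have ij: "i0 \<noteq> j0" using j0 diag i0(1) by auto
  \<comment> \<open>The weight of \<open>j0\<close> has a partner \<open>e k \<le> e i0\<close>,
    hence \<open>d \<le> e i0 + e j0\<close>. The weight bound for \<open>K i0 j0\<close> gives the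
    other inequality and leaves degree 0 for the pivot, which is therefore a unit.\<close>
  obtain k where k: "k \<in> I" "e j0 + e k = d" using partner[OF j0(1)] by blast
  have "e i0 + e j0 + degree (K i0 j0) \<le> d" using bound[OF i0(1) j0] .
  then have sum: "e i0 + e j0 = d" and "degree (K i0 j0) = 0" using k i0(2)[OF k(1)] by auto
  then obtain c where c: "K i0 j0 = [:c:]" "c \<noteq> 0" using j0(2) by (metis degree_eq_zeroE pCons_0_0)
  define c' where "c' = [:inverse c:]"
  have cc: "K i0 j0 * c' = 1" using c by (simp add: c'_def pCons_one)
  have dc: "degree (c' * p) \<le> degree p" for p by (simp add: c'_def)
  have e0: "e j0 \<le> e i0" by (rule i0(2)[OF j0(1)])
  let ?I = "I - {i0, j0}"
  define K' where "K' i j = K i j - c' * (K i0 i * K j0 j - K j0 i * K i0 j)" for i j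
  define u where "u a = (\<Sum>j\<in>I. K i0 j * M j a)" for a
  define v where "v a = (\<Sum>j\<in>I. K j0 j * M j a)" for a
  have step: "(\<Sum>i\<in>I. \<Sum>j\<in>I. K i j * M i a * M j b) =
    v a * (- c' * u b) - (- c' * u a) * v b + (\<Sum>i\<in>?I. \<Sum>j\<in>?I. K' i j * M i a * M j b)" for a b
    unfolding u_def v_def K'_def
    by (rule symplectic_step[OF fin i0(1) j0(1) ij skew diag[OF i0(1)] diag[OF j0(1)] cc])
  have dterm: "degree (K i j * M j a) \<le> d - e i" if "i \<in> I" "j \<in> I" for i j a
  proof (cases "K i j = 0")
    case False
    then show ?thesis
      using degree_mult_le[of "K i j" "M j a"] bound[OF that False] dM[OF that(2), of a] by linarith
  qed simp
  have du: "degree (- c' * u a) \<le> d - e i0" for a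
  proof -
    have "degree (u a) \<le> d - e i0" unfolding u_def
      using fin dterm[OF i0(1)] by (intro degree_sum_le) auto
    then show ?thesis using dc[of "u a"] by simp
  qed
  have dv: "degree (v a) \<le> e i0" for a
  proof -
    have "degree (v a) \<le> d - e j0" unfolding v_def
      using fin dterm[OF j0(1)] by (intro degree_sum_le) auto
    then show ?thesis using sum by simp
  qed
  \<comment> \<open>The two weight bounds add up to \<open>2 * d\<close>, of which the pivot pair
    takes exactly \<open>e i0 + e j0 = d\<close>.\<close>
  have prod: "K i0 i * K j0 j = 0 \<or> e i + e j + degree (K i0 i * K j0 j) \<le> d"
    if "i \<in> I" "j \<in> I" for i j
  proof (cases "K i0 i = 0 \<or> K j0 j = 0")
    case False
    then have "e i0 + e i + degree (K i0 i) \<le> d" "e j0 + e j + degree (K j0 j) \<le> d"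
      using bound i0(1) j0(1) that by blast+
    then show ?thesis using degree_mult_le[of "K i0 i" "K j0 j"] sum by linarith
  qed auto
  \<comment> \<open>Beyond \<open>e i + e j = d\<close> natural subtraction would hide the failure
    of the bound, so there each term of \<open>K' i j\<close> is shown to vanish by itself.\<close>
  have bound': "e i + e j + degree (K' i j) \<le> d" if ij: "i \<in> ?I" "j \<in> ?I" "K' i j \<noteq> 0" for i j
  proof (cases "e i + e j \<le> d")
    case False
    then have "K i j = 0" "K i0 i * K j0 j = 0" "K j0 i * K i0 j = 0"
      using bound[of i j] prod[of i j] prod[of j i] ij by (auto simp: mult.commute)
    then have "K' i j = 0" by (simp only: K'_def diff_zero mult_zero_right)
    then show ?thesis using ij(3) by simp
  next
    case True
    have 1: "degree (K i j) \<le> d - e i - e j" using bound[of i j] ij True by (cases "K i j = 0") auto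
    have 2: "degree (K i0 i * K j0 j) \<le> d - e i - e j"
      using prod[of i j] ij by (cases "K i0 i * K j0 j = 0") auto
    have 3: "degree (K j0 i * K i0 j) \<le> d - e i - e j"
      using prod[of j i] ij by (cases "K j0 i * K i0 j = 0") (auto simp: mult.commute)
    have "degree (K i0 i * K j0 j - K j0 i * K i0 j) \<le> d - e i - e j"
      by (rule degree_diff_le[OF 2 3])
    then have "degree (c' * (K i0 i * K j0 j - K j0 i * K i0 j)) \<le> d - e i - e j"
      using dc le_trans by blast
    then have "degree (K' i j) \<le> d - e i - e j" unfolding K'_def by (rule degree_diff_le[OF 1])
    then show ?thesis using True by simp
  qed
  have "\<exists>u v f. (\<forall>k<r. f k \<le> e i0 \<and> f k \<le> d \<and> d \<le> 2 * f k) \<and>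
    (\<forall>k<r. \<forall>l<r. k \<le> l \<longrightarrow> f l \<le> f k) \<and>
    (\<forall>k<r. \<forall>a. degree (u k a) \<le> f k \<and> degree (v k a) \<le> d - f k) \<and>
    (\<forall>a b. (\<Sum>i\<in>?I. \<Sum>j\<in>?I. K' i j * M i a * M j b) = (\<Sum>k<r. u k a * v k b - v k a * u k b))"
  proof (rule Suc.IH)
    show "finite ?I" using fin by simp
    show "card ?I = 2 * r" using Suc.prems(2) fin i0(1) j0(1) ij by (simp add: card_Diff_subset)
    show "K' i j = - K' j i" if "i \<in> ?I" "j \<in> ?I" for i j
      using skew[of i j] that unfolding K'_def by (simp add: algebra_simps)
    show "e i + e j + degree (K' i j) \<le> d" if "i \<in> ?I" "j \<in> ?I" "K' i j \<noteq> 0" for i j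
      using bound' that by blast
    show "\<forall>j\<in>?I. x j = 0" if "\<forall>i\<in>?I. (\<Sum>j\<in>?I. K' i j * x j) = 0" for x
      by (rule symplectic_step_kernel[OF fin i0(1) j0(1) ij skew diag[OF i0(1)] diag[OF j0(1)] cc ker
            that[unfolded K'_def]])
    show "card {i \<in> ?I. e i = s} = card {i \<in> ?I. e i + s = d}" for s
    proof -
      \<comment> \<open>Removing the pair lowers both counts equally: \<open>i0\<close> is counted
        on one side exactly when \<open>j0\<close> is counted on the other.\<close>
      have "e i0 + s = d \<longleftrightarrow> e j0 = s" "e j0 + s = d \<longleftrightarrow> e i0 = s" using sum by auto
      then show ?thesis
        using card_filter_remove_two[OF fin i0(1) j0(1) ij, of "\<lambda>i. e i = s"]
          card_filter_remove_two[OF fin i0(1) j0(1) ij, of "\<lambda>i. e i + s = d"] cnt[of s] by simp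
    qed
    show "degree (M i a) \<le> e i" if "i \<in> ?I" for i a using dM that by blast
    show "e i \<le> e i0" if "i \<in> ?I" for i using i0(2) that by blast
  qed
  then obtain u' v' f' where ex:
    "\<forall>k<r. f' k \<le> e i0 \<and> f' k \<le> d \<and> d \<le> 2 * f' k"
    "\<forall>k<r. \<forall>l<r. k \<le> l \<longrightarrow> f' l \<le> f' k"
    "\<forall>k<r. \<forall>a. degree (u' k a) \<le> f' k \<and> degree (v' k a) \<le> d - f' k"
    "\<forall>a b. (\<Sum>i\<in>?I. \<Sum>j\<in>?I. K' i j * M i a * M j b) = (\<Sum>k<r. u' k a * v' k b - v' k a * u' k b)"
    by (elim exE conjE) (rule that)
  note IH = ex[rule_format]
  \<comment> \<open>The form \<open>v\<close> has degree at most \<open>d - e j0 = e i0\<close> and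
    takes the larger slot; its partner \<open>- c' * u\<close> stays below
    \<open>d - e i0\<close>.\<close>
  define U where "U k = (case k of 0 \<Rightarrow> v | Suc k \<Rightarrow> u' k)" for k
  define V where "V k = (case k of 0 \<Rightarrow> (\<lambda>a. - c' * u a) | Suc k \<Rightarrow> v' k)" for k
  define f where "f k = (case k of 0 \<Rightarrow> e i0 | Suc k \<Rightarrow> f' k)" for k
  have 1: "f k \<le> E \<and> f k \<le> d \<and> d \<le> 2 * f k" if "k < Suc r" for k
  proof (cases k)
    case 0
    then show ?thesis using Suc.prems(8)[OF i0(1)] sum e0 by (simp add: f_def)
  next
    case (Suc l)
    then show ?thesis using IH(1)[of l] that Suc.prems(8)[OF i0(1)] by (auto simp: f_def)
  qed
  have 2: "f l \<le> f k" if "k < Suc r" "l < Suc r" "k \<le> l" for k l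
  proof (cases l)
    case 0
    then show ?thesis using that by simp
  next
    case (Suc l')
    then show ?thesis using that IH(1)[of l'] IH(2)[of "k - 1" l'] by (cases k) (auto simp: f_def)
  qed
  have 3: "degree (U k a) \<le> f k \<and> degree (V k a) \<le> d - f k" if "k < Suc r" for k a
    using that IH(3)[of "k - 1" a] du dv by (cases k) (auto simp: U_def V_def f_def)
  have 4: "(\<Sum>i\<in>I. \<Sum>j\<in>I. K i j * M i a * M j b) = (\<Sum>k<Suc r. U k a * V k b - V k a * U k b)" for a b
    unfolding step IH(4) sum.lessThan_Suc_shift by (simp add: U_def V_def)
  show ?case
    by (rule exI[of _ U], rule exI[of _ V], rule exI[of _ f], intro conjI allI impI)
      (use 1 2 3 in \<open>simp_all add: 4\<close>)
qed

subsection \<open>The standard symplectic congruence\<close>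

text \<open>The block matrix as a single formula over any ring, since evaluation and taking leading
  coefficients turn it into the same form over the complex numbers.\<close>

definition symplectic_mat :: "nat \<Rightarrow> 'a::comm_ring_1 mat" where
  "symplectic_mat r = mat (2 * r) (2 * r)
     (\<lambda>(i, j). if i + j + 1 = 2 * r then if i < r then 1 else - 1 else 0)"

lemma symplectic_mat_carrier [simp]: "symplectic_mat r \<in> carrier_mat (2 * r) (2 * r)"
  by (simp add: symplectic_mat_def)

lemma skew_Delta_eq: "skew_Delta r = symplectic_mat r"
  by (rule eq_matI) (auto simp: skew_Delta_def Delta_def symplectic_mat_def)

lemma (in comm_ring_hom) map_symplectic_mat: "map_mat hom (symplectic_mat r) = symplectic_mat r"
  by (rule eq_matI) (auto simp: symplectic_mat_def hom_uminus)

lemma symplectic_mat_square: "symplectic_mat r * (- symplectic_mat r) = (1\<^sub>m (2 * r) :: 'a::comm_ring_1 mat)"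
proof (rule eq_matI)
  let ?J = "symplectic_mat r :: 'a mat"
  have J: "- ?J \<in> carrier_mat (2 * r) (2 * r)" by simp
  fix i j assume "i < dim_row (1\<^sub>m (2 * r) :: 'a mat)" "j < dim_col (1\<^sub>m (2 * r) :: 'a mat)"
  then have ij: "i < 2 * r" "j < 2 * r" by auto
  have "(?J * (- ?J)) $$ (i, j) = (\<Sum>l<2 * r. ?J $$ (i, l) * (- ?J) $$ (l, j))"
    by (rule index_mult_mat_sum[OF symplectic_mat_carrier J ij])
  also have "\<dots> = (\<Sum>l<2 * r. if l = 2 * r - 1 - i then if i = j then 1 else 0 else 0)"
    using ij by (intro sum.cong refl) (auto simp: symplectic_mat_def)
  also have "\<dots> = 1\<^sub>m (2 * r) $$ (i, j)" using ij by simp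
  finally show "(?J * (- ?J)) $$ (i, j) = 1\<^sub>m (2 * r) $$ (i, j)" .
qed (auto simp: symplectic_mat_def)

lemma det_symplectic_mat: "det (symplectic_mat r :: 'a::field mat) \<noteq> 0"
proof
  assume z: "det (symplectic_mat r :: 'a mat) = 0"
  have J: "- symplectic_mat r \<in> carrier_mat (2 * r) (2 * r)" by simp
  have "det (symplectic_mat r * (- symplectic_mat r) :: 'a mat) = 0"
    unfolding det_mult[OF symplectic_mat_carrier J] z by simp
  then show False unfolding symplectic_mat_square by simp
qed

lemma sum_mirror:
  fixes f :: "nat \<Rightarrow> 'a::comm_monoid_add"
  shows "(\<Sum>i<2 * r. f i) = (\<Sum>k<r. f k) + (\<Sum>k<r. f (2 * r - 1 - k))"
proof -
  have im: "(\<lambda>k. 2 * r - 1 - k) ` {..<r} = {r..<2 * r}"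
  proof (intro equalityI subsetI)
    fix x assume "x \<in> {r..<2 * r}"
    then show "x \<in> (\<lambda>k. 2 * r - 1 - k) ` {..<r}" by (intro image_eqI[of _ _ "2 * r - 1 - x"]) auto
  qed auto
  have "inj_on (\<lambda>k. 2 * r - 1 - k) {..<r}" by (auto simp: inj_on_def)
  then have "(\<Sum>k<r. f (2 * r - 1 - k)) = sum f {r..<2 * r}"
    using sum.reindex[of "\<lambda>k. 2 * r - 1 - k" "{..<r}" f] im by (simp add: o_def)
  moreover have "sum f {..<2 * r} = sum f {..<r} + sum f {r..<2 * r}"
    by (subst sum.union_disjoint[symmetric]) (auto intro!: arg_cong[of _ _ "sum f"])
  ultimately show ?thesis by simp
qed

lemma index_symplectic_congruence:
  fixes L :: "'a::comm_ring_1 mat"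
  assumes L: "L \<in> carrier_mat m (2 * r)" and ab: "a < m" "b < m"
  shows "(L * symplectic_mat r * transpose_mat L) $$ (a, b)
    = (\<Sum>k<r. L $$ (a, k) * L $$ (b, 2 * r - 1 - k) - L $$ (a, 2 * r - 1 - k) * L $$ (b, k))"
proof -
  let ?s = "\<lambda>i. L $$ (a, i) * (if i < r then 1 else - 1) * L $$ (b, 2 * r - 1 - i)"
  have "(L * symplectic_mat r * transpose_mat L) $$ (a, b)
    = (\<Sum>i<2 * r. \<Sum>j<2 * r. L $$ (a, i) * symplectic_mat r $$ (i, j) * L $$ (b, j))"
    by (rule index_congruence_sum[OF L symplectic_mat_carrier ab])
  also have "\<dots> = (\<Sum>i<2 * r. ?s i)"
  proof (intro sum.cong refl)
    fix i assume "i \<in> {..<2 * r}"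
    then have i: "i < 2 * r" by simp
    have "(\<Sum>j<2 * r. L $$ (a, i) * symplectic_mat r $$ (i, j) * L $$ (b, j))
      = (\<Sum>j<2 * r. if j = 2 * r - 1 - i then ?s i else 0)"
      using i by (intro sum.cong refl) (auto simp: symplectic_mat_def)
    then show "(\<Sum>j<2 * r. L $$ (a, i) * symplectic_mat r $$ (i, j) * L $$ (b, j)) = ?s i"
      using i by simp
  qed
  also have "\<dots> = (\<Sum>k<r. ?s k) + (\<Sum>k<r. ?s (2 * r - 1 - k))" by (rule sum_mirror)
  also have "\<dots> = (\<Sum>k<r. ?s k + ?s (2 * r - 1 - k))" by (simp add: sum.distrib)
  also have "\<dots> = (\<Sum>k<r. L $$ (a, k) * L $$ (b, 2 * r - 1 - k) - L $$ (a, 2 * r - 1 - k) * L $$ (b, k))"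
    by (intro sum.cong refl) auto
  finally show ?thesis .
qed

lemma eval_congruence:
  assumes M: "M \<in> carrier_mat m n" and K: "K \<in> carrier_mat n n"
  shows "eval_mat \<alpha> (M * K * transpose_mat M) = eval_mat \<alpha> M * eval_mat \<alpha> K * transpose_mat (eval_mat \<alpha> M)"
proof -
  have T: "transpose_mat M \<in> carrier_mat n m" using M by simp
  have "eval_mat \<alpha> (transpose_mat M) = transpose_mat (eval_mat \<alpha> M)" by (intro eq_matI) auto
  then show ?thesis
    using eval_hom.mat_hom_mult[OF mult_carrier_mat[OF M K] T, of \<alpha>] eval_hom.mat_hom_mult[OF M K, of \<alpha>]
    by simp
qed

text \<open>The pairing of the bounds puts every nonzero entry of the standard form at weight
  exactly \<open>d\<close>, so its matrix of top coefficients is the standard form again.\<close>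

lemma mat_coeff_symplectic_congruence:
  assumes L: "L \<in> carrier_mat m (2 * r)" and e: "\<forall>i<m. \<forall>j<2 * r. degree (L $$ (i, j)) \<le> e j"
    and pair: "\<forall>i<2 * r. e i + e (2 * r - 1 - i) = d"
  shows "mat_coeff (L * symplectic_mat r * transpose_mat L) d
    = lead_mat e L * symplectic_mat r * transpose_mat (lead_mat e L)"
proof -
  let ?J = "symplectic_mat r :: complex poly mat"
  have p: "e i + e j = d" if "i < 2 * r" "i + j + 1 = 2 * r" for i j
  proof -
    have "j = 2 * r - 1 - i" using that by simp
    then show ?thesis using pair that by blast
  qed
  have D: "\<forall>i<2 * r. \<forall>j<2 * r. ?J $$ (i, j) \<noteq> 0 \<longrightarrow> e i + e j + degree (?J $$ (i, j)) \<le> d"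
  proof (intro allI impI)
    fix i j assume ij: "i < 2 * r" "j < 2 * r" "?J $$ (i, j) \<noteq> 0"
    then have "i + j + 1 = 2 * r" by (auto simp: symplectic_mat_def split: if_splits)
    then show "e i + e j + degree (?J $$ (i, j)) \<le> d" using p[of i j] ij by (simp add: symplectic_mat_def)
  qed
  have "mat (2 * r) (2 * r) (\<lambda>(i, j). if e i + e j \<le> d then coeff (?J $$ (i, j)) (d - e i - e j) else 0)
    = symplectic_mat r"
  proof (rule eq_matI)
    fix i j assume "i < dim_row (symplectic_mat r :: complex mat)" "j < dim_col (symplectic_mat r :: complex mat)"
    then have ij: "i < 2 * r" "j < 2 * r" by (auto simp: symplectic_mat_def)
    have "d - e i - e j = 0 \<and> e i + e j \<le> d" if "i + j + 1 = 2 * r" using p[OF ij(1) that] by simp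
    then show "mat (2 * r) (2 * r) (\<lambda>(i, j). if e i + e j \<le> d then coeff (?J $$ (i, j)) (d - e i - e j) else 0)
        $$ (i, j) = symplectic_mat r $$ (i, j)"
      using ij by (cases "i + j + 1 = 2 * r") (auto simp: symplectic_mat_def)
  qed (auto simp: symplectic_mat_def)
  then show ?thesis using mat_coeff_congruence[OF L symplectic_mat_carrier e D] by simp
qed

text \<open>The pairing of column degrees does two jobs: products of partner columns have degree at
  most \<open>d\<close>, and the coefficient of \<open>\<lambda>^d\<close> is a congruence by the
  leading matrix.\<close>

lemma symplectic_congruence_neig:
  assumes L: "L \<in> carrier_mat m (2 * r)" and r: "0 < r" and min: "is_minimal_basis L"
    and pair: "\<forall>i<2 * r. col_degree L i + col_degree L (2 * r - 1 - i) = d"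
  shows "L * symplectic_mat r * transpose_mat L \<in> POL_ss_neig d (2 * r) m" (is "?P \<in> _")
proof -
  note idx = index_symplectic_congruence[OF L]
  have P: "?P \<in> carrier_mat m m" using L by auto
  have skew: "transpose_mat ?P = - ?P"
  proof (rule eq_matI)
    fix a b assume "a < dim_row (- ?P)" "b < dim_col (- ?P)"
    then have ab: "a < m" "b < m" using L by auto
    have "transpose_mat ?P $$ (a, b) = ?P $$ (b, a)"
      using L ab by (intro index_transpose_mat(1)) auto
    also have "\<dots> = - ?P $$ (a, b)"
      unfolding idx[OF ab] idx[OF ab(2,1)] sum_negf[symmetric]
      by (intro sum.cong refl) (simp add: mult.commute)
    also have "\<dots> = (- ?P) $$ (a, b)" using L ab by (intro index_uminus_mat(1)[symmetric]) auto
    finally show "transpose_mat ?P $$ (a, b) = (- ?P) $$ (a, b)" .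
  qed (use P in auto)
  have e: "\<forall>i<m. \<forall>j<2 * r. degree (L $$ (i, j)) \<le> col_degree L j" using degree_le_vec_degree[OF L] by blast
  have deg: "\<forall>a<m. \<forall>b<m. degree (?P $$ (a, b)) \<le> d"
  proof (intro allI impI)
    fix a b assume ab: "a < m" "b < m"
    show "degree (?P $$ (a, b)) \<le> d"
      unfolding idx[OF ab]
    proof (intro degree_sum_le degree_diff_le finite_lessThan)
      fix k assume "k \<in> {..<r}"
      then have k: "k < 2 * r" "2 * r - 1 - k < 2 * r" "col_degree L k + col_degree L (2 * r - 1 - k) = d"
        using pair by auto
      show "degree (L $$ (a, k) * L $$ (b, 2 * r - 1 - k)) \<le> d"
        using degree_mult_le[of "L $$ (a, k)" "L $$ (b, 2 * r - 1 - k)"] k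
          e[rule_format, OF ab(1) k(1)] e[rule_format, OF ab(2) k(2)] by linarith
      show "degree (L $$ (a, 2 * r - 1 - k) * L $$ (b, k)) \<le> d"
        using degree_mult_le[of "L $$ (a, 2 * r - 1 - k)" "L $$ (b, k)"] k
          e[rule_format, OF ab(1) k(2)] e[rule_format, OF ab(2) k(1)] by linarith
    qed
  qed
  note inj = minimal_basis_imp[OF L min]
  have "vec_space.rank m (eval_mat \<alpha> ?P) = 2 * r" for \<alpha>
    unfolding eval_congruence[OF L symplectic_mat_carrier] eval_hom.map_symplectic_mat
    using rank_congruence[of "eval_mat \<alpha> L" m "2 * r" "symplectic_mat r"] L inj det_symplectic_mat by simp
  moreover have "vec_space.rank m (mat_coeff ?P d) = 2 * r"
    unfolding mat_coeff_symplectic_congruence[OF L e pair]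
    using rank_congruence[OF lead_mat_carrier[OF L] symplectic_mat_carrier] inj det_symplectic_mat by blast
  ultimately show ?thesis using POL_ss_neig_iff[of "2 * r"] P skew deg r by simp
qed

section \<open>Skew-symmetric factorizations with reduced columns\<close>

text \<open>Constant rank leaves invariant polynomials without roots, so the Smith form is the
  idempotent with \<open>n\<close> ones. Hence \<open>A * N * P = P\<close> for polynomial
  \<open>A\<close> and \<open>N\<close> with inner size \<open>n\<close>. Transposing this and using
  skewness gives \<open>P * N^T * A^T = P\<close>, and both together give the congruence with
  \<open>K = N * P * N^T\<close>, which inherits skewness from \<open>P\<close>.\<close>

lemma skew_factorization:
  assumes P: "P \<in> carrier_mat m m" and skew: "transpose_mat P = - P"
    and rank: "\<forall>\<alpha>. vec_space.rank m (eval_mat \<alpha> P) = n"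
  obtains A K where "A \<in> carrier_mat m n" "K \<in> carrier_mat n n" "transpose_mat K = - K"
    "P = A * K * transpose_mat A"
proof -
  obtain S where S: "is_smith_form P S" using smith_form_exists[OF P] by blast
  have Sc: "S \<in> carrier_mat m m" by (rule smith_form_carrier[OF S P])
  obtain \<beta> where "vec_space.rank m (eval_mat \<beta> P) = normal_rank P"
    using ex_new_if_finite[OF infinite_UNIV_char_0 finite_rank_drop[OF P]] by auto
  then have nr: "normal_rank P = n" using rank by simp
  have one: "S $$ (i, i) = 1" if i: "i < m" "S $$ (i, i) \<noteq> 0" for i
  proof -
    have "poly (S $$ (i, i)) \<alpha> \<noteq> 0" for \<alpha>
      using rank_eval_less_iff[OF P S, of \<alpha>] rank nr i by auto
    then have "constant (poly (S $$ (i, i)))" using fundamental_theorem_of_algebra by blast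
    then have "degree (S $$ (i, i)) = 0" by (simp add: constant_degree)
    moreover have "lead_coeff (S $$ (i, i)) = 1" using S Sc i unfolding is_smith_form_def by simp
    ultimately show ?thesis by (metis degree_eq_zeroE coeff_pCons_0 pCons_one)
  qed
  have "{i. i < m \<and> S $$ (i, i) \<noteq> 0} = {..<card {i. i < m \<and> S $$ (i, i) \<noteq> 0}}"
  proof (rule down_closed_eq_lessThan)
    fix i assume "Suc i < m" "S $$ (Suc i, Suc i) \<noteq> 0"
    then show "S $$ (i, i) \<noteq> 0" using S Sc unfolding is_smith_form_def by auto
  qed
  then have supp: "{i. i < m \<and> S $$ (i, i) \<noteq> 0} = {..<n}"
    using normal_rank_smith_form[OF P S] nr by simp
  then have nm: "n \<le> m" by (metis (mono_tags, lifting) lessThan_iff mem_Collect_eq not_le order_less_irrefl)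
  have Sij: "S $$ (i, j) = (if i = j \<and> i < n then 1 else 0)" if "i < m" "j < m" for i j
  proof (cases "i = j")
    case True
    then show ?thesis using supp one[of i] that by auto
  next
    case False
    then show ?thesis using S Sc that unfolding is_smith_form_def diagonal_mat_def by auto
  qed
  let ?E = "rect_id m n :: complex poly mat" and ?F = "rect_id n m :: complex poly mat"
  have EF: "?E * ?F = S"
    by (rule eq_matI) (use Sc nm in \<open>auto simp: rect_id_mult[OF rect_id_carrier] Sij simp del: index_mult_mat(1)\<close>,
      auto simp: rect_id_def)
  have SS: "S * S = S"
  proof (rule eq_matI)
    fix i j assume "i < dim_row S" "j < dim_col S"
    then have ij: "i < m" "j < m" using Sc by auto
    have "(S * S) $$ (i, j) = (\<Sum>l<m. S $$ (i, l) * S $$ (l, j))" by (rule index_mult_mat_sum[OF Sc Sc ij])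
    also have "\<dots> = (\<Sum>l<m. if l = i then S $$ (i, j) else 0)"
      using ij by (intro sum.cong refl) (auto simp: Sij)
    finally show "(S * S) $$ (i, j) = S $$ (i, j)" using ij by simp
  qed (use Sc in auto)
  obtain U V where UV: "U \<in> carrier_mat m m" "invertible_mat U" "V \<in> carrier_mat m m"
    "invertible_mat V" "S = U * P * V"
    using S P unfolding is_smith_form_def by auto
  obtain U' where U': "U' \<in> carrier_mat m m" "U' * U = 1\<^sub>m m"
    using UV unimodular_iff_invertible_mat unimodularE by metis
  obtain V' where V': "V' \<in> carrier_mat m m" "V * V' = 1\<^sub>m m"
    using UV unimodular_iff_invertible_mat unimodularE by metis
  have UP: "U * P \<in> carrier_mat m m" by (rule mult_carrier_mat[OF UV(1) P])
  have SV: "S * V' = U * P"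
    unfolding UV(5) assoc_mult_mat[OF UP UV(3) V'(1)] V'(2) by (rule right_mult_one_mat[OF UP])
  define A where "A = U' * ?E"
  define N where "N = ?F * U"
  have A: "A \<in> carrier_mat m n" unfolding A_def by (rule mult_carrier_mat[OF U'(1) rect_id_carrier])
  have N: "N \<in> carrier_mat n m" unfolding N_def by (rule mult_carrier_mat[OF rect_id_carrier UV(1)])
  have NP: "N * P \<in> carrier_mat n m" by (rule mult_carrier_mat[OF N P])
  have "A * (N * P) = A * (?F * (U * P))"
    unfolding N_def assoc_mult_mat[OF rect_id_carrier UV(1) P] ..
  also have "\<dots> = U' * (?E * (?F * (U * P)))"
    unfolding A_def by (rule assoc_mult_mat[OF U'(1) rect_id_carrier mult_carrier_mat[OF rect_id_carrier UP]])
  also have "?E * (?F * (U * P)) = S * (U * P)"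
    unfolding EF[symmetric] by (rule assoc_mult_mat[OF rect_id_carrier rect_id_carrier UP, symmetric])
  also have "\<dots> = S * S * V'" unfolding SV[symmetric] by (rule assoc_mult_mat[OF Sc Sc V'(1), symmetric])
  also have "\<dots> = U * P" unfolding SS SV ..
  also have "U' * (U * P) = P"
    unfolding assoc_mult_mat[OF U'(1) UV(1) P, symmetric] U'(2) by (rule left_mult_one_mat[OF P])
  finally have ANP: "A * (N * P) = P" .
  let ?At = "transpose_mat A" and ?Nt = "transpose_mat N"
  have At: "?At \<in> carrier_mat n m" and Nt: "?Nt \<in> carrier_mat m n" using A N by auto
  have PN: "P * ?Nt \<in> carrier_mat m n" by (rule mult_carrier_mat[OF P Nt])
  have "transpose_mat P = transpose_mat P * ?Nt * ?At"
    using arg_cong[OF ANP, of transpose_mat] transpose_mult[OF A NP] transpose_mult[OF N P] by simp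
  then have "- P = - (P * ?Nt * ?At)"
    unfolding skew using P Nt PN At by simp
  then have PNA: "P * ?Nt * ?At = P" by (metis uminus_uminus_mat)
  define K where "K = N * P * ?Nt"
  have K: "K \<in> carrier_mat n n" unfolding K_def by (rule mult_carrier_mat[OF NP Nt])
  have "P = A * (N * (P * ?Nt * ?At))" using ANP PNA by simp
  also have "N * (P * ?Nt * ?At) = N * (P * ?Nt) * ?At" by (rule assoc_mult_mat[OF N PN At, symmetric])
  also have "N * (P * ?Nt) = K" unfolding K_def by (rule assoc_mult_mat[OF N P Nt, symmetric])
  also have "A * (K * ?At) = A * K * ?At" by (rule assoc_mult_mat[OF A K At, symmetric])
  finally have eq: "P = A * K * ?At" .
  have "transpose_mat K = N * (transpose_mat P * ?Nt)"
    unfolding K_def using transpose_mult[OF NP Nt] transpose_mult[OF N P] by simp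
  also have "\<dots> = N * (- (P * ?Nt))" unfolding skew using P Nt by simp
  also have "\<dots> = - (N * (P * ?Nt))" using N P by simp
  also have "N * (P * ?Nt) = K" unfolding K_def by (rule assoc_mult_mat[OF N P Nt, symmetric])
  finally show thesis using that[OF A K _ eq] by blast
qed

lemma congruence_skew:
  fixes E :: "'a::comm_ring_1 mat"
  assumes E: "E \<in> carrier_mat m n" and K: "K \<in> carrier_mat n n" and sk: "transpose_mat K = - K"
  shows "transpose_mat (E * K * transpose_mat E) = - (E * K * transpose_mat E)"
proof -
  have T: "transpose_mat E \<in> carrier_mat n m" using E by simp
  have KT: "K * transpose_mat E \<in> carrier_mat n m" by (rule mult_carrier_mat[OF K T])
  have "transpose_mat (E * K * transpose_mat E) = E * (transpose_mat K * transpose_mat E)"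
    using transpose_mult[OF mult_carrier_mat[OF E K] T] transpose_mult[OF E K] by simp
  also have "\<dots> = E * (- (K * transpose_mat E))"
    unfolding sk using K T by simp
  also have "\<dots> = - (E * (K * transpose_mat E))" using E K by simp
  also have "E * (K * transpose_mat E) = E * K * transpose_mat E"
    by (rule assoc_mult_mat[OF E K T, symmetric])
  finally show ?thesis .
qed

text \<open>Writing \<open>M = M' * E\<close> turns \<open>K\<close> into
  \<open>E * K * E^T\<close>, which is still polynomial and skew-symmetric. The competitors are thus
  closed under column reduction, and one with the least degree sum cannot be reduced. Injectivity at
  each \<open>\<alpha>\<close> follows from the rank, which leaves only the leading matrix to be
  settled.\<close>

lemma reduced_skew_factorization:
  assumes P: "P \<in> carrier_mat m m" and skew: "transpose_mat P = - P"
    and rank: "\<forall>\<alpha>. vec_space.rank m (eval_mat \<alpha> P) = n"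
  obtains M K where "M \<in> carrier_mat m n" "K \<in> carrier_mat n n" "transpose_mat K = - K"
    "P = M * K * transpose_mat M" "left_invertible m n (lead_mat (col_degree M) M)"
proof -
  let ?C = "\<lambda>M. M \<in> carrier_mat m n \<and> (\<exists>K \<in> carrier_mat n n. transpose_mat K = - K \<and>
    P = M * K * transpose_mat M)"
  let ?w = "\<lambda>M. \<Sum>j<n. col_degree M j"
  obtain A K where "A \<in> carrier_mat m n" "K \<in> carrier_mat n n" "transpose_mat K = - K"
    "P = A * K * transpose_mat A" by (rule skew_factorization[OF P skew rank])
  then have "?C A" by blast
  from ex_has_least_nat[of ?C, OF this, of ?w] obtain M where
    M0: "?C M" and least: "\<forall>M'. ?C M' \<longrightarrow> ?w M \<le> ?w M'" by (rule exE) (erule conjE, rule that)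
  from M0 obtain K where M: "M \<in> carrier_mat m n" and K: "K \<in> carrier_mat n n" "transpose_mat K = - K"
    "P = M * K * transpose_mat M" by blast
  have inj: "left_invertible m n (eval_mat \<alpha> M)" for \<alpha>
    using rank[rule_format, of \<alpha>] rank_congruence[of "eval_mat \<alpha> M" m n "eval_mat \<alpha> K"] M K
    unfolding K(3) eval_congruence[OF M K(1)] by simp
  have ker: "v = 0\<^sub>v n" if v: "v \<in> carrier_vec n" "M *\<^sub>v v = 0\<^sub>v m" for v
  proof -
    have "map_vec (\<lambda>p. poly p \<alpha>) v = 0\<^sub>v n" for \<alpha>
    proof (rule left_invertible_kernel[OF inj])
      show "eval_mat \<alpha> M *\<^sub>v map_vec (\<lambda>p. poly p \<alpha>) v = 0\<^sub>v m"
        using eval_hom.mult_mat_vec_hom[OF M v(1), of \<alpha>] v(2) by (simp add: eval_hom.vec_hom_zero)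
    qed (use v in simp)
    then have "poly (v $ j) \<alpha> = 0" if "j < n" for j \<alpha>
      using that v(1) by (metis carrier_vecD index_map_vec(1) index_zero_vec(1))
    then have "v $ j = 0" if "j < n" for j using that poly_all_0_iff_0 by blast
    then show ?thesis using v(1) by (intro eq_vecI) auto
  qed
  have "left_invertible m n (lead_mat (col_degree M) M)"
  proof (rule ccontr)
    assume f: "\<not> ?thesis"
    obtain M' E where M': "M' \<in> carrier_mat m n" "E \<in> carrier_mat n n" "M = M' * E" "?w M' < ?w M"
      by (rule reduce_column_degrees[OF M ker disjI2[OF f]])
    let ?Et = "transpose_mat E" and ?Mt = "transpose_mat M'"
    have T: "?Et \<in> carrier_mat n n" "?Mt \<in> carrier_mat n m" using M' by auto
    have EK: "E * K \<in> carrier_mat n n" by (rule mult_carrier_mat[OF M'(2) K(1)])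
    have "P = M' * E * K * (?Et * ?Mt)"
      unfolding K(3) unfolding M'(3) transpose_mult[OF M'(1,2)] ..
    also have "M' * E * K = M' * (E * K)" by (rule assoc_mult_mat[OF M'(1,2) K(1)])
    also have "M' * (E * K) * (?Et * ?Mt) = M' * (E * K) * ?Et * ?Mt"
      by (rule assoc_mult_mat[OF mult_carrier_mat[OF M'(1) EK] T, symmetric])
    also have "M' * (E * K) * ?Et = M' * (E * K * ?Et)" by (rule assoc_mult_mat[OF M'(1) EK T(1)])
    finally have "P = M' * (E * K * ?Et) * ?Mt" .
    moreover have "E * K * ?Et \<in> carrier_mat n n" by (rule mult_carrier_mat[OF EK T(1)])
    ultimately have "?C M'" using M'(1) congruence_skew[OF M'(2) K(1,2)] by blast
    then have "?w M \<le> ?w M'" by (rule least[rule_format])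
    then show False using M'(4) by simp
  qed
  then show thesis by (rule that[OF M K])
qed

section \<open>Weights of the form and its determinant\<close>

lemma congruence_cancel:
  assumes A: "left_invertible m n A" and C: "C \<in> carrier_mat n n"
    and eq: "A * C * transpose_mat A = 0\<^sub>m m m"
  shows "C = 0\<^sub>m n n"
proof -
  obtain X where X: "A \<in> carrier_mat m n" "X \<in> carrier_mat n m" "X * A = 1\<^sub>m n"
    using A unfolding left_invertible_def by blast
  let ?At = "transpose_mat A" and ?Xt = "transpose_mat X"
  have T: "?At \<in> carrier_mat n m" "?Xt \<in> carrier_mat m n" using X by auto
  have CT: "C * ?At \<in> carrier_mat n m" by (rule mult_carrier_mat[OF C T(1)])
  have TX: "?At * ?Xt = 1\<^sub>m n" using transpose_mult[OF X(2,1)] X(3) by simp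
  have "C * ?At = (X * A) * (C * ?At)" unfolding X(3) using left_mult_one_mat[OF CT] by simp
  also have "\<dots> = X * (A * (C * ?At))" by (rule assoc_mult_mat[OF X(2,1) CT])
  also have "A * (C * ?At) = 0\<^sub>m m m" using eq unfolding assoc_mult_mat[OF X(1) C T(1)] .
  also have "X * 0\<^sub>m m m = 0\<^sub>m n m" by (rule right_mult_zero_mat[OF X(2)])
  finally have z: "C * ?At = 0\<^sub>m n m" .
  have "C = C * (?At * ?Xt)" unfolding TX using right_mult_one_mat[OF C] by simp
  also have "\<dots> = C * ?At * ?Xt" by (rule assoc_mult_mat[OF C T, symmetric])
  also have "\<dots> = 0\<^sub>m n n" unfolding z by (rule left_mult_zero_mat[OF T(2)])
  finally show ?thesis .
qed

text \<open>If the largest weight \<open>D\<close> exceeded \<open>d\<close>, the coefficient of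
  \<open>\<lambda>^D\<close> in the congruence would vanish. It is the congruence, by an injective
  leading matrix, of the nonzero matrix of coefficients at weight \<open>D\<close>.\<close>

lemma form_degree_bound:
  assumes M: "M \<in> carrier_mat m n" and K: "K \<in> carrier_mat n n"
    and e: "\<forall>i<m. \<forall>j<n. degree (M $$ (i, j)) \<le> e j"
    and lead: "left_invertible m n (lead_mat e M)"
    and deg: "\<forall>a<m. \<forall>b<m. degree ((M * K * transpose_mat M) $$ (a, b)) \<le> d"
    and ij: "i < n" "j < n" "K $$ (i, j) \<noteq> 0"
  shows "e i + e j + degree (K $$ (i, j)) \<le> d"
proof (rule ccontr)
  let ?S = "{(i, j). i < n \<and> j < n \<and> K $$ (i, j) \<noteq> 0}"
  let ?g = "\<lambda>(i, j). e i + e j + degree (K $$ (i, j))"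
  assume c: "\<not> ?thesis"
  define D where "D = Max (?g ` ?S)"
  have "finite ?S" by (rule finite_subset[of _ "{..<n} \<times> {..<n}"]) auto
  then have fin: "finite (?g ` ?S)" "?g ` ?S \<noteq> {}" using ij by auto
  have D_ge: "\<forall>i<n. \<forall>j<n. K $$ (i, j) \<noteq> 0 \<longrightarrow> e i + e j + degree (K $$ (i, j)) \<le> D"
  proof (intro allI impI)
    fix i j assume "i < n" "j < n" "K $$ (i, j) \<noteq> 0"
    then have "?g (i, j) \<in> ?g ` ?S" by (intro imageI) auto
    then show "e i + e j + degree (K $$ (i, j)) \<le> D" unfolding D_def using Max_ge[OF fin(1)] by simp
  qed
  have Dd: "d < D" using D_ge ij c by (metis le_trans not_le)
  have "D \<in> ?g ` ?S" unfolding D_def by (rule Max_in[OF fin])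
  then obtain k l where kl: "k < n" "l < n" "K $$ (k, l) \<noteq> 0" "D = e k + e l + degree (K $$ (k, l))"
    by auto
  let ?K = "mat n n (\<lambda>(i, j). if e i + e j \<le> D then coeff (K $$ (i, j)) (D - e i - e j) else 0)"
  have "mat_coeff (M * K * transpose_mat M) D = 0\<^sub>m m m"
  proof (rule eq_matI)
    fix a b assume "a < dim_row (0\<^sub>m m m :: complex mat)" "b < dim_col (0\<^sub>m m m :: complex mat)"
    then have ab: "a < m" "b < m" by auto
    then have "degree ((M * K * transpose_mat M) $$ (a, b)) < D" using deg Dd by (meson le_less_trans)
    then have "coeff ((M * K * transpose_mat M) $$ (a, b)) D = 0" by (rule coeff_eq_0)
    then show "mat_coeff (M * K * transpose_mat M) D $$ (a, b) = 0\<^sub>m m m $$ (a, b)"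
      using M ab by (simp add: mat_coeff_def del: index_mult_mat(1))
  qed (use M in \<open>auto simp: mat_coeff_def\<close>)
  then have "lead_mat e M * ?K * transpose_mat (lead_mat e M) = 0\<^sub>m m m"
    using mat_coeff_congruence[OF M K e D_ge] by simp
  then have "?K = 0\<^sub>m n n" by (intro congruence_cancel[OF lead]) auto
  then have "?K $$ (k, l) = 0" using kl by simp
  then show False using kl by simp
qed

lemma coeff_prod_degree_bounds:
  fixes p :: "'b \<Rightarrow> 'a::comm_semiring_1 poly"
  assumes "finite S" "\<forall>i\<in>S. degree (p i) \<le> k i"
  shows "degree (\<Prod>i\<in>S. p i) \<le> (\<Sum>i\<in>S. k i) \<and>
    coeff (\<Prod>i\<in>S. p i) (\<Sum>i\<in>S. k i) = (\<Prod>i\<in>S. coeff (p i) (k i))"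
  using assms
proof (induction S rule: finite_induct)
  case (insert x S)
  then have IH: "degree (prod p S) \<le> sum k S" "coeff (prod p S) (sum k S) = (\<Prod>i\<in>S. coeff (p i) (k i))"
    and x: "degree (p x) \<le> k x" by auto
  have "degree (p x * prod p S) \<le> k x + sum k S"
    using degree_mult_le[of "p x" "prod p S"] IH(1) x by linarith
  then show ?case using insert(1,2) coeff_mult_degree_bounds[OF x IH(1)] IH(2) by simp
qed simp

text \<open>The total is the same for every admissible permutation, because each \<open>e i\<close>
  is counted once as a row and once as a column. This gives all Leibniz terms a common degree
  bound.\<close>

lemma sum_degree_gap:
  fixes e :: "nat \<Rightarrow> nat"
  assumes p: "p permutes {0..<n}" and le: "\<forall>i<n. e i + e (p i) \<le> d"
  shows "(\<Sum>i = 0..<n. d - e i - e (p i)) = n * d - 2 * (\<Sum>i = 0..<n. e i)"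
proof -
  have "(\<Sum>i = 0..<n. e (p i)) = (\<Sum>i = 0..<n. e i)"
    using sum.permute[OF p, of e] by (simp add: o_def)
  moreover have "(\<Sum>i = 0..<n. (d - e i - e (p i)) + e i + e (p i)) = (\<Sum>i = 0..<n. d)"
    using le by (intro sum.cong refl) auto
  ultimately show ?thesis by (simp add: sum.distrib)
qed

text \<open>Each Leibniz term is read off at its degree bound, which does not depend on the
  permutation. A permutation with some \<open>e i + e (p i) > d\<close> hits a zero entry in both
  matrices.\<close>

lemma coeff_det_graded:
  fixes K :: "complex poly mat"
  assumes K: "K \<in> carrier_mat n n"
    and bound: "\<forall>i<n. \<forall>j<n. K $$ (i, j) \<noteq> 0 \<longrightarrow> e i + e j + degree (K $$ (i, j)) \<le> d"
  shows "coeff (det K) (n * d - 2 * (\<Sum>i = 0..<n. e i)) =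
    det (mat n n (\<lambda>(i, j). if e i + e j \<le> d then coeff (K $$ (i, j)) (d - e i - e j) else 0))"
    (is "coeff _ ?s = det ?K")
proof -
  have K': "?K \<in> carrier_mat n n" by simp
  have perm: "coeff (signof p * (\<Prod>i = 0..<n. K $$ (i, p i))) ?s = signof p * (\<Prod>i = 0..<n. ?K $$ (i, p i))"
    if p: "p permutes {0..<n}" for p
  proof -
    have pn: "p i < n" if "i < n" for i using permutes_in_image[OF p, of i] that by simp
    have "coeff (\<Prod>i = 0..<n. K $$ (i, p i)) ?s = (\<Prod>i = 0..<n. ?K $$ (i, p i))"
    proof (cases "\<forall>i<n. e i + e (p i) \<le> d")
      case True
      have "\<forall>i\<in>{0..<n}. degree (K $$ (i, p i)) \<le> d - e i - e (p i)"
      proof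
        fix i assume "i \<in> {0..<n}"
        then show "degree (K $$ (i, p i)) \<le> d - e i - e (p i)"
          using bound[rule_format, of i "p i"] pn[of i] by (cases "K $$ (i, p i) = 0") auto
      qed
      from coeff_prod_degree_bounds[OF _ this]
      have "coeff (\<Prod>i = 0..<n. K $$ (i, p i)) ?s = (\<Prod>i = 0..<n. coeff (K $$ (i, p i)) (d - e i - e (p i)))"
        unfolding sum_degree_gap[OF p True] by simp
      also have "\<dots> = (\<Prod>i = 0..<n. ?K $$ (i, p i))" using True pn by (intro prod.cong refl) auto
      finally show ?thesis .
    next
      case False
      then obtain i where i: "i < n" "\<not> e i + e (p i) \<le> d" by blast
      then have "K $$ (i, p i) = 0" "?K $$ (i, p i) = 0"
        using bound[rule_format, OF i(1) pn[OF i(1)]] pn[OF i(1)] by auto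
      then have "(\<Prod>i = 0..<n. K $$ (i, p i)) = 0" "(\<Prod>i = 0..<n. ?K $$ (i, p i)) = 0"
        using i(1) by (intro prod_zero; force)+
      then show ?thesis by (simp only: coeff_0)
    qed
    moreover have "sign p = 1 \<or> sign p = - 1" by (simp add: sign_def)
    ultimately show ?thesis
      by (elim disjE) (simp_all only: of_int_1 of_int_minus mult_1 mult_minus_left coeff_minus)
  qed
  show ?thesis
    unfolding det_def'[OF K] det_def'[OF K'] coeff_sum using perm by (intro sum.cong refl) auto
qed

section \<open>The minimal basis and the equality of both sets\<close>

lemma neig_imp_symplectic_congruence:
  assumes P: "P \<in> POL_ss_neig d (2 * r) m" and r: "0 < r"
  obtains L where "L \<in> carrier_mat m (2 * r)" "is_minimal_basis L"
    "\<forall>i j. i \<le> j \<and> j < 2 * r \<longrightarrow> col_degree L j \<le> col_degree L i"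
    "\<forall>i<2 * r. col_degree L i + col_degree L (2 * r - 1 - i) = d"
    "P = L * symplectic_mat r * transpose_mat L"
proof -
  let ?n = "2 * r"
  have Pc: "P \<in> carrier_mat m m" and skew: "transpose_mat P = - P"
    and deg: "\<forall>i<m. \<forall>j<m. degree (P $$ (i, j)) \<le> d"
    and rank: "\<forall>\<alpha>. vec_space.rank m (eval_mat \<alpha> P) = ?n"
    and rank_d: "vec_space.rank m (mat_coeff P d) = ?n"
    using P r unfolding POL_ss_neig_iff[of ?n P d m, simplified r] by (auto simp: POL_ss_neig_iff)
  obtain M K where M: "M \<in> carrier_mat m ?n" and K: "K \<in> carrier_mat ?n ?n" "transpose_mat K = - K"
    and PMK: "P = M * K * transpose_mat M" and lead: "left_invertible m ?n (lead_mat (col_degree M) M)"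
    by (rule reduced_skew_factorization[OF Pc skew rank])
  define e where "e = col_degree M"
  have e: "\<forall>i<m. \<forall>j<?n. degree (M $$ (i, j)) \<le> e j" unfolding e_def using degree_le_vec_degree[OF M] by blast
  have lead: "left_invertible m ?n (lead_mat e M)" using lead by (simp add: e_def)
  have bound: "\<forall>i<?n. \<forall>j<?n. K $$ (i, j) \<noteq> 0 \<longrightarrow> e i + e j + degree (K $$ (i, j)) \<le> d"
    using form_degree_bound[OF M K(1) e lead deg[unfolded PMK]] by blast
  let ?K = "mat ?n ?n (\<lambda>(i, j). if e i + e j \<le> d then coeff (K $$ (i, j)) (d - e i - e j) else 0)"
  have K': "?K \<in> carrier_mat ?n ?n" by simp
  have det': "det ?K \<noteq> 0"
    using rank_d rank_congruence[OF lead_mat_carrier[OF M] K', of e]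
    unfolding PMK mat_coeff_congruence[OF M K(1) e bound] by blast
  have nz: "poly (det K) \<alpha> \<noteq> 0" for \<alpha>
    using rank[rule_format, of \<alpha>] rank_congruence[of "eval_mat \<alpha> M" m ?n "eval_mat \<alpha> K"] M K
    unfolding PMK eval_congruence[OF M K(1)] by simp
  have detK: "det K \<noteq> 0" using nz[of 0] by auto
  have "constant (poly (det K))" using fundamental_theorem_of_algebra nz by blast
  then have "degree (det K) = 0" by (simp add: constant_degree)
  moreover have "coeff (det K) (?n * d - 2 * (\<Sum>i = 0..<?n. e i)) \<noteq> 0"
    using det' unfolding coeff_det_graded[OF K(1) bound] .
  \<comment> \<open>The constant \<open>det K\<close> can have a nonzero coefficient only at index
    0. By \<open>sum_degree_gap\<close> this index is a sum of nonnegative slacks along any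
    admissible permutation, so each slack is 0.\<close>
  ultimately have gap: "?n * d - 2 * (\<Sum>i = 0..<?n. e i) = 0" using le_degree by fastforce
  obtain \<pi> where \<pi>: "\<pi> permutes {0..<?n}" "\<And>i. i < ?n \<Longrightarrow> ?K $$ (i, \<pi> i) \<noteq> 0"
    by (rule det_nonzero_permutation[OF K' det']) (use that in blast)
  have \<pi>n: "\<pi> i < ?n" if "i < ?n" for i using permutes_in_image[OF \<pi>(1), of i] that by simp
  have \<pi>le: "\<forall>i<?n. e i + e (\<pi> i) \<le> d"
  proof (intro allI impI)
    fix i assume i: "i < ?n"
    show "e i + e (\<pi> i) \<le> d" using \<pi>(2)[OF i] i \<pi>n[OF i] by (auto split: if_splits)
  qed
  have pair: "e i + e (\<pi> i) = d" if i: "i < ?n" for i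
  proof -
    have "(\<Sum>i = 0..<?n. d - e i - e (\<pi> i)) = 0" using sum_degree_gap[OF \<pi>(1) \<pi>le] gap by simp
    then have "d - e i - e (\<pi> i) = 0" using i by simp
    then show ?thesis using \<pi>le i by (simp add: le_antisym)
  qed
  let ?I = "{..<?n}"
  \<comment> \<open>Only the symmetry of the weights is passed on, since the pivots of the
    elimination need not follow \<open>\<pi>\<close>.\<close>
  have cnt: "card {i \<in> ?I. e i = s} = card {i \<in> ?I. e i + s = d}" for s
  proof (rule bij_betw_same_card[of \<pi>])
    have "inj_on \<pi> {i \<in> ?I. e i = s}" using permutes_inj[OF \<pi>(1)] by (rule inj_on_subset) simp
    moreover have "\<pi> ` {i \<in> ?I. e i = s} = {i \<in> ?I. e i + s = d}"
    proof (intro equalityI subsetI)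
      fix j assume "j \<in> \<pi> ` {i \<in> ?I. e i = s}"
      then show "j \<in> {i \<in> ?I. e i + s = d}" using \<pi>n pair by (auto simp: add.commute)
    next
      fix j assume j: "j \<in> {i \<in> ?I. e i + s = d}"
      then obtain i where i: "i < ?n" "\<pi> i = j"
        using permutes_image[OF \<pi>(1)] by (metis (no_types, lifting) atLeastLessThan_iff imageE lessThan_iff mem_Collect_eq zero_le)
      then show "j \<in> \<pi> ` {i \<in> ?I. e i = s}" using pair[OF i(1)] j by (intro image_eqI[of _ _ i]) auto
    qed
    ultimately show "bij_betw \<pi> {i \<in> ?I. e i = s} {i \<in> ?I. e i + s = d}" by (simp add: bij_betw_def)
  qed
  \<comment> \<open>The reduction quantifies over all \<open>a\<close>, so the rows of
    \<open>M\<close> are continued by zero.\<close>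
  define F where "F i a = (if a < m then M $$ (a, i) else 0)" for i a
  have ex: "\<exists>u v f. (\<forall>k<r. f k \<le> Max (e ` ?I) \<and> f k \<le> d \<and> d \<le> 2 * f k) \<and>
    (\<forall>k<r. \<forall>l<r. k \<le> l \<longrightarrow> f l \<le> f k) \<and>
    (\<forall>k<r. \<forall>a. degree (u k a) \<le> f k \<and> degree (v k a) \<le> d - f k) \<and>
    (\<forall>a b. (\<Sum>i\<in>?I. \<Sum>j\<in>?I. K $$ (i, j) * F i a * F j b) = (\<Sum>k<r. u k a * v k b - v k a * u k b))"
  proof (rule symplectic_reduction[where e = e])
    show "K $$ (i, j) = - K $$ (j, i)" if "i \<in> ?I" "j \<in> ?I" for i j
      using arg_cong[OF K(2), of "\<lambda>X. X $$ (j, i)"] that K(1) by simp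
    show "e i + e j + degree (K $$ (i, j)) \<le> d" if "i \<in> ?I" "j \<in> ?I" "K $$ (i, j) \<noteq> 0" for i j
      using bound that by simp
    show "\<forall>j\<in>?I. x j = 0" if x: "\<forall>i\<in>?I. (\<Sum>j\<in>?I. K $$ (i, j) * x j) = 0" for x
    proof -
      have "K *\<^sub>v vec ?n x = 0\<^sub>v ?n"
      proof (rule eq_vecI)
        fix i assume "i < dim_vec (0\<^sub>v ?n :: complex poly vec)"
        then have i: "i < ?n" by simp
        have "(K *\<^sub>v vec ?n x) $ i = (\<Sum>j<?n. K $$ (i, j) * vec ?n x $ j)"
          by (rule index_mult_mat_vec_sum[OF K(1) vec_carrier i])
        also have "\<dots> = (\<Sum>j<?n. K $$ (i, j) * x j)" by (intro sum.cong) auto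
        also have "\<dots> = 0" using x i by simp
        finally show "(K *\<^sub>v vec ?n x) $ i = 0\<^sub>v ?n $ i" using i by simp
      qed (use K in simp)
      then have z: "vec ?n x = 0\<^sub>v ?n" using det_0_iff_vec_prod_zero[OF K(1)] detK vec_carrier by blast
      show ?thesis
      proof
        fix j assume "j \<in> ?I"
        then show "x j = 0" using arg_cong[OF z, of "\<lambda>v. v $ j"] by simp
      qed
    qed
    show "degree (F i a) \<le> e i" if "i \<in> ?I" for i a using e that by (simp add: F_def)
  qed (use cnt in auto)
  then obtain u v f where
    f: "\<forall>k<r. f k \<le> Max (e ` ?I) \<and> f k \<le> d \<and> d \<le> 2 * f k"
    and mono: "\<forall>k<r. \<forall>l<r. k \<le> l \<longrightarrow> f l \<le> f k"
    and uv: "\<forall>k<r. \<forall>a. degree (u k a) \<le> f k \<and> degree (v k a) \<le> d - f k"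
    and sum: "\<forall>a b. (\<Sum>i\<in>?I. \<Sum>j\<in>?I. K $$ (i, j) * F i a * F j b)
      = (\<Sum>k<r. u k a * v k b - v k a * u k b)"
    by (elim exE conjE) (rule that)
  \<comment> \<open>The \<open>v\<close> columns are stored in reverse, so that column
    \<open>k\<close> meets its partner at \<open>?n - 1 - k\<close>, as the standard form
    requires.\<close>
  define L where "L = mat m ?n (\<lambda>(a, k). if k < r then u k a else v (?n - 1 - k) a)"
  define g where "g k = (if k < r then f k else d - f (?n - 1 - k))" for k
  have L: "L \<in> carrier_mat m ?n" by (simp add: L_def)
  have PL: "P = L * symplectic_mat r * transpose_mat L"
  proof (rule eq_matI)
    fix a b assume "a < dim_row (L * symplectic_mat r * transpose_mat L)"
      "b < dim_col (L * symplectic_mat r * transpose_mat L)"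
    then have ab: "a < m" "b < m" using L by auto
    have "P $$ (a, b) = (\<Sum>i<?n. \<Sum>j<?n. M $$ (a, i) * K $$ (i, j) * M $$ (b, j))"
      unfolding PMK by (rule index_congruence_sum[OF M K(1) ab])
    also have "\<dots> = (\<Sum>i\<in>?I. \<Sum>j\<in>?I. K $$ (i, j) * F i a * F j b)"
      using ab by (intro sum.cong refl) (simp add: F_def mult_ac)
    also have "\<dots> = (\<Sum>k<r. u k a * v k b - v k a * u k b)" using sum by blast
    also have "\<dots> = (\<Sum>k<r. L $$ (a, k) * L $$ (b, ?n - 1 - k) - L $$ (a, ?n - 1 - k) * L $$ (b, k))"
    proof (intro sum.cong refl)
      fix k assume "k \<in> {..<r}"
      then have "k < r" "k < ?n" "?n - 1 - k < ?n" "\<not> ?n - 1 - k < r" "?n - 1 - (?n - 1 - k) = k" by auto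
      then show "u k a * v k b - v k a * u k b
        = L $$ (a, k) * L $$ (b, ?n - 1 - k) - L $$ (a, ?n - 1 - k) * L $$ (b, k)"
        using ab unfolding L_def by simp
    qed
    also have "\<dots> = (L * symplectic_mat r * transpose_mat L) $$ (a, b)"
      by (rule index_symplectic_congruence[OF L ab, symmetric])
    finally show "P $$ (a, b) = (L * symplectic_mat r * transpose_mat L) $$ (a, b)" .
  qed (use Pc L in auto)
  have gL: "\<forall>a<m. \<forall>k<?n. degree (L $$ (a, k)) \<le> g k"
  proof (intro allI impI)
    fix a k assume "a < m" "k < ?n"
    then show "degree (L $$ (a, k)) \<le> g k"
      using uv[rule_format, of k a] uv[rule_format, of "?n - 1 - k" a] by (cases "k < r") (auto simp: L_def g_def)
  qed
  have gpair: "\<forall>k<?n. g k + g (?n - 1 - k) = d"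
  proof (intro allI impI)
    fix k assume k: "k < ?n"
    show "g k + g (?n - 1 - k) = d"
    proof (cases "k < r")
      case True
      then have "\<not> ?n - 1 - k < r" "?n - 1 - (?n - 1 - k) = k" by auto
      then show ?thesis using True f by (simp add: g_def)
    next
      case False
      then have "?n - 1 - k < r" using k by auto
      then show ?thesis using False f by (simp add: g_def)
    qed
  qed
  have gmono: "g j \<le> g i" if "i \<le> j" "j < ?n" for i j
  proof -
    consider "j < r" | "i < r" "\<not> j < r" | "\<not> i < r" by linarith
    then show ?thesis
    proof cases
      case 1
      then show ?thesis using that mono by (simp add: g_def)
    next
      \<comment> \<open>The order across the middle rests on \<open>d \<le> 2 * f k\<close>, which
        comes from \<open>e j0 \<le> e i0\<close> at each pivot.\<close>
      case 2
      then have "d \<le> 2 * f i" "d \<le> 2 * f (?n - 1 - j)" using f that by auto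
      then have "d - f (?n - 1 - j) \<le> f i" by linarith
      then show ?thesis using 2 by (simp add: g_def)
    next
      case 3
      then have "f (?n - 1 - i) \<le> f (?n - 1 - j)" using mono that by auto
      then show ?thesis using 3 that by (simp add: g_def)
    qed
  qed
  have inj: "left_invertible m ?n (eval_mat \<alpha> L)" for \<alpha>
    using rank[rule_format, of \<alpha>] rank_congruence[of "eval_mat \<alpha> L" m ?n "symplectic_mat r"] L
    unfolding PL eval_congruence[OF L symplectic_mat_carrier] eval_hom.map_symplectic_mat by simp
  have leadL: "left_invertible m ?n (lead_mat g L)"
    using rank_d rank_congruence[OF lead_mat_carrier[OF L] symplectic_mat_carrier, of g]
    unfolding PL mat_coeff_symplectic_congruence[OF L gL gpair] by blast
  have cd: "col_degree L k = g k" if k: "k < ?n" for k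
  proof (rule antisym)
    show "col_degree L k \<le> g k" unfolding vec_degree_le_iff using gL k L by auto
    \<comment> \<open>Applied to a unit vector, the predictable degree property says that column
      \<open>k\<close> attains its bound \<open>g k\<close>. So far \<open>g\<close> only bounded
      the degrees from above.\<close>
    have "\<exists>a<m. (L *\<^sub>v unit_vec ?n k) $ a \<noteq> 0 \<and> g k + degree (unit_vec ?n k $ k :: complex poly)
        \<le> degree ((L *\<^sub>v unit_vec ?n k) $ a)"
      by (rule predictable_degree[OF L gL leadL unit_vec_carrier k]) (use k in simp)
    then obtain a where a: "a < m" "g k \<le> degree ((L *\<^sub>v unit_vec ?n k) $ a)" by auto
    have "(L *\<^sub>v unit_vec ?n k) $ a = (\<Sum>j<?n. L $$ (a, j) * unit_vec ?n k $ j)"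
      by (rule index_mult_mat_vec_sum[OF L unit_vec_carrier a(1)])
    also have "\<dots> = (\<Sum>j<?n. if j = k then L $$ (a, k) else 0)"
      using k by (intro sum.cong) auto
    also have "\<dots> = L $$ (a, k)" using k by simp
    finally show "g k \<le> col_degree L k" using a(2) degree_le_vec_degree[OF L a(1) k] by simp
  qed
  have "lead_mat (col_degree L) L = lead_mat g L"
    by (rule eq_matI) (use L cd in \<open>auto simp: lead_mat_def\<close>)
  then have "is_minimal_basis L" using minimal_basisI[OF L] inj leadL by simp
  moreover have "\<forall>i j. i \<le> j \<and> j < ?n \<longrightarrow> col_degree L j \<le> col_degree L i"
    using cd gmono by simp
  moreover have "\<forall>i<?n. col_degree L i + col_degree L (?n - 1 - i) = d"
    using cd gpair by simp
  ultimately show thesis using that[OF L] PL by blast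
qed

theorem theorem3p5:
  fixes m r d :: nat
  assumes "d \<ge> 1" and "2 \<le> 2 * r" and "2 * r \<le> m - 1"
  shows "POL_ss_neig d (2 * r) m =
    {L * skew_Delta r * transpose_mat L | L.
       L \<in> carrier_mat m (2 * r) \<and>
       is_minimal_basis L \<and>
       (\<forall>i j. i \<le> j \<and> j < 2 * r \<longrightarrow> vec_degree (col L j) \<le> vec_degree (col L i)) \<and>
       (\<forall>i < 2 * r. vec_degree (col L i) + vec_degree (col L (2 * r - 1 - i)) = d)}"
  unfolding skew_Delta_eq
proof (intro equalityI subsetI)
  have r: "0 < r" using assms by simp
  fix P
  {
    assume "P \<in> POL_ss_neig d (2 * r) m"
    then obtain L where "L \<in> carrier_mat m (2 * r)" "is_minimal_basis L"
      "\<forall>i j. i \<le> j \<and> j < 2 * r \<longrightarrow> col_degree L j \<le> col_degree L i"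
      "\<forall>i<2 * r. col_degree L i + col_degree L (2 * r - 1 - i) = d"
      "P = L * symplectic_mat r * transpose_mat L"
      using neig_imp_symplectic_congruence[OF _ r] by blast
    then show "P \<in> {L * symplectic_mat r * transpose_mat L | L.
       L \<in> carrier_mat m (2 * r) \<and> is_minimal_basis L \<and>
       (\<forall>i j. i \<le> j \<and> j < 2 * r \<longrightarrow> col_degree L j \<le> col_degree L i) \<and>
       (\<forall>i < 2 * r. col_degree L i + col_degree L (2 * r - 1 - i) = d)}"
      by blast
  next
    assume "P \<in> {L * symplectic_mat r * transpose_mat L | L.
       L \<in> carrier_mat m (2 * r) \<and> is_minimal_basis L \<and>
       (\<forall>i j. i \<le> j \<and> j < 2 * r \<longrightarrow> col_degree L j \<le> col_degree L i) \<and>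
       (\<forall>i < 2 * r. col_degree L i + col_degree L (2 * r - 1 - i) = d)}"
    then show "P \<in> POL_ss_neig d (2 * r) m"
      using symplectic_congruence_neig[OF _ r] by blast
  }
qed

end
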